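(* Let $n\ge2$, let $\mathbb{X}=\{X_{ij}:i,j\in[n]\}$ be an array of independent real random variables with $\mathbb{E}X_{ij}=c_{ij}$, $\mathrm{Var}\,X_{ij}=\sigma_{ij}^2\ge 0$, $\mathbb{E}|X_{ij}|^3<\infty$, and suppose $\sum_{j=1}^n c_{ij}=0$ for every $i$ and $\sum_{i=1}^n c_{ij}=0$ for every $j$. Let $\pi$ be a uniform random permutation of $[n]$ independent of $\mathbb{X}$, let $$s_n^2=\frac1n\sum_{i,j=1}^n\sigma_{ij}^2+\frac{1}{n-1}\sum_{i,j=1}^nc_{ij}^2,\qquad s_n>0,$$ and let $$\mathbf{Y}_n(t)=\frac1{s_n}\sum_{i=1}^{\lfloor nt\rfloor}X_{i\pi(i)},\qquad t\in[0,1].$$ Let $\mathbb{X}''=\{X_{ij}'':i,j\in[n]\}$ be an independent copy of $\mathbb{X}$, let $\{Z_{il}:i,l\in[n]\}$ be i.i.d. standard normal random variables independent of $\mathbb{X}\cup\mathbb{X}''$, and let $$\hat Z_i=\frac{1}{\sqrt{n-1}}\sum_{l=1}^nX_{il}''\left(Z_{il}-\frac1n\sum_{j=1}^nZ_{jl}\right),\qquad \mathbf{D}_n(t)=\frac1{s_n}\sum_{i=1}^{\lfloor nt\rfloor}\hat Z_i,\quad t\in[0,1].$$ Then for any $g\in M^1$, \begin{align*} &|\mathbb{E}g(\mathbf{Y}_n)-\mathbb{E}g(\mathbf{D}_n)|\\ \le{}&\frac{\|g\|_{M^1}}{2n^2(n-1)^2s_n^3}\sum_{1\le i,j,k,l,u\le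 n}\Big\{\mathbb{E}|X_{ik}|^3+5\,\mathbb{E}|X_{ik}|^2\,\mathbb{E}|X_{il}|+9\,\mathbb{E}|X_{ik}|^2\,\mathbb{E}|X_{jl}|+5\,\mathbb{E}|X_{ik}|^2\,\mathbb{E}|X_{jk}|\\ &+14\,\mathbb{E}|X_{ik}|\,\mathbb{E}|X_{il}|\,\mathbb{E}|X_{jl}|+2\,\mathbb{E}|X_{ik}|\,\mathbb{E}|X_{il}|\,\mathbb{E}|X_{iu}|+6\,\mathbb{E}|X_{ik}|\,\mathbb{E}|X_{jl}|\,\mathbb{E}|X_{iu}|+2\,\mathbb{E}\left[|X_{uk}||X_{ik}|^2\right]\\ &+4\,\mathbb{E}|X_{uk}X_{ik}|\,\mathbb{E}|X_{il}|+4\,\mathbb{E}|X_{uk}X_{ik}|\,\mathbb{E}|X_{jl}|+8\,\mathbb{E}|X_{uk}|\,\mathbb{E}|X_{ik}|\,\mathbb{E}|X_{jl}|+2\,\mathbb{E}|X_{uk}X_{ik}X_{jk}|\\ &+2\,\mathbb{E}|X_{uk}|\,\mathbb{E}|X_{ik}|\,\mathbb{E}|X_{jk}|+\frac2n\,\mathbb{E}\left(2|X_{ik}|+6|X_{jl}|\right)\cdot\Big(\sum_{r=1}^n\mathbb{E}|X_{ir}|^2+\Big|\sum_{r=1}^nc_{ir}c_{jr}\Big|\Big)\Big\}\\ &+\frac{2\|g\|_{M^1}}{\sqrt n}+\frac{\|g\|_{M^1}}{n^2s_n^2}\sum_{i,j=1}^n\sigma_{ij}^2 . \end{align*}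
   Context: $[n]=\{1,\dots,n\}$. $D=D([0,1],\mathbb{R})$ is the Skorokhod space of càdlàg functions $[0,1]\to\mathbb{R}$, with $\|w\|=\sup_{t\in[0,1]}|w(t)|$. Fréchet derivatives are with respect to this norm, and a $k$-linear form $B$ on $D$ has norm $\|B\|=\sup_{\{h:\|h\|=1\}}|B[h,\dots,h]|$. $M$ is the set of continuous functions $f:D\to\mathbb{R}$ with $\sup_{w\in D}\frac{|f(w)|}{1+\|w\|^3}<\infty$ that are twice Fréchet differentiable and satisfy $\|D^2f(w+h)-D^2f(w)\|\le k_f\|h\|$ for some constant $k_f$, uniformly in $w,h\in D$. $M^1$ is the set of $g\in M$ with $$\|g\|_{M^1}=\sup_{w}\frac{|g(w)|}{1+\|w\|^3}+\sup_{w}\|Dg(w)\|+\sup_{w}\|D^2g(w)\|+\sup_{w,h}\frac{\|D^2g(w+h)-D^2g(w)\|}{\|h\|}<\infty .$$ *)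

theory Defs
  imports "HOL-Probability.Probability"
begin

section \<open>The Skorokhod space with the supremum norm\<close>

text \<open>The value at \<open>1\<close> is unconstrained by right-continuity, and no left limit is required at \<open>0\<close>.\<close>

definition cadlag_on_unit :: "(real \<Rightarrow> real) \<Rightarrow> bool" where
  "cadlag_on_unit f \<longleftrightarrow>
     (\<forall>t\<in>{0..<1}. (f \<longlongrightarrow> f t) (at_right t)) \<and>
     (\<forall>t\<in>{0<..1}. \<exists>l. (f \<longlongrightarrow> l) (at_left t))"

text \<open>Functions on \<open>[0,1]\<close> are represented by total functions that vanish off \<open>[0,1]\<close>, so that
  equality in the type is equality on \<open>[0,1]\<close>.\<close>

typedef skorokhod = "{f. cadlag_on_unit f \<and> (\<forall>t. t \<notin> {0..1} \<longrightarrow> f t = 0)}"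
  morphisms skor_fun Abs_skorokhod
  by (rule exI[of _ "\<lambda>_. 0"]) (auto simp: cadlag_on_unit_def)

setup_lifting type_definition_skorokhod

lemma skor_fun_outside: "t \<notin> {0..1} \<Longrightarrow> skor_fun w t = 0"
  using skor_fun[of w] by blast

lemma skor_fun_eqI: "(\<And>t. t \<in> {0..1} \<Longrightarrow> skor_fun v t = skor_fun w t) \<Longrightarrow> v = w"
  by (metis skor_fun_inject skor_fun_outside ext)

lemma cadlag_bounded:
  assumes "cadlag_on_unit f"
  obtains B where "\<And>t. t \<in> {0..1} \<Longrightarrow> \<bar>f t\<bar> \<le> B"
proof -
  define P where "P = (\<lambda>a b::real. \<exists>B. \<forall>t\<in>{a..b} \<inter> {0..1}. \<bar>f t\<bar> \<le> B)"
  have left: "\<exists>d>0. \<exists>B. \<forall>t\<in>{x-d<..<x} \<inter> {0..1}. \<bar>f t\<bar> \<le> B" if "x \<in> {0..1}" for x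
  proof (cases "x = 0")
    case True
    then show ?thesis by (intro exI[of _ 1]) auto
  next
    case False
    with that assms obtain l where "(f \<longlongrightarrow> l) (at_left x)"
      by (force simp: cadlag_on_unit_def)
    then have "\<forall>\<^sub>F t in at_left x. dist (f t) l < 1"
      by (rule tendstoD) simp
    then obtain b where "b < x" "\<And>t. b < t \<Longrightarrow> t < x \<Longrightarrow> dist (f t) l < 1"
      by (auto simp: eventually_at_left_field)
    then show ?thesis
      by (intro exI[of _ "x - b"] conjI exI[of _ "\<bar>l\<bar> + 1"]) (force simp: dist_real_def)+
  qed
  have right: "\<exists>d>0. \<exists>B. \<forall>t\<in>{x<..<x+d} \<inter> {0..1}. \<bar>f t\<bar> \<le> B" if "x \<in> {0..1}" for x
  proof (cases "x = 1")
    case True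
    then show ?thesis by (intro exI[of _ 1]) auto
  next
    case False
    with that assms have "(f \<longlongrightarrow> f x) (at_right x)"
      by (force simp: cadlag_on_unit_def)
    then have "\<forall>\<^sub>F t in at_right x. dist (f t) (f x) < 1"
      by (rule tendstoD) simp
    then obtain b where "b > x" "\<And>t. x < t \<Longrightarrow> t < b \<Longrightarrow> dist (f t) (f x) < 1"
      by (auto simp: eventually_at_right_field)
    then show ?thesis
      by (intro exI[of _ "b - x"] conjI exI[of _ "\<bar>f x\<bar> + 1"]) (force simp: dist_real_def)+
  qed
  have "(0::real) \<le> 1" by simp
  then have "P 0 1"
  proof (induction rule: Bolzano)
    case (trans a b c)
    then obtain B1 B2 where B1: "\<forall>t\<in>{a..b} \<inter> {0..1}. \<bar>f t\<bar> \<le> B1"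
      and B2: "\<forall>t\<in>{b..c} \<inter> {0..1}. \<bar>f t\<bar> \<le> B2"
      unfolding P_def by blast
    show ?case
      unfolding P_def
    proof (intro exI[of _ "max B1 B2"] ballI)
      fix t assume t: "t \<in> {a..c} \<inter> {0..1}"
      show "\<bar>f t\<bar> \<le> max B1 B2"
        using t B1 B2 by (cases "t \<le> b") (auto simp: le_max_iff_disj)
    qed
  next
    case (local x)
    then have x: "x \<in> {0..1}" by auto
    obtain d1 B1 where 1: "d1 > 0" "\<forall>t\<in>{x-d1<..<x} \<inter> {0..1}. \<bar>f t\<bar> \<le> B1"
      using left[OF x] by blast
    obtain d2 B2 where 2: "d2 > 0" "\<forall>t\<in>{x<..<x+d2} \<inter> {0..1}. \<bar>f t\<bar> \<le> B2"
      using right[OF x] by blast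
    show ?case
    proof (intro exI[of _ "min d1 d2"] conjI allI impI)
      show "min d1 d2 > 0" using 1 2 by simp
      fix a b assume ab: "a \<le> x \<and> x \<le> b \<and> b - a < min d1 d2"
      show "P a b"
        unfolding P_def
      proof (intro exI[of _ "max (max B1 B2) \<bar>f x\<bar>"] ballI)
        fix t assume t: "t \<in> {a..b} \<inter> {0..1}"
        consider "t < x" | "t = x" | "t > x" by linarith
        then show "\<bar>f t\<bar> \<le> max (max B1 B2) \<bar>f x\<bar>"
        proof cases
          case 1
          then have "t \<in> {x-d1<..<x} \<inter> {0..1}" using t ab by auto
          then have "\<bar>f t\<bar> \<le> B1" using \<open>\<forall>t\<in>{x-d1<..<x} \<inter> {0..1}. \<bar>f t\<bar> \<le> B1\<close> by blast
          then show ?thesis by simp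
        next
          case 3
          then have "t \<in> {x<..<x+d2} \<inter> {0..1}" using t ab by auto
          then have "\<bar>f t\<bar> \<le> B2" using \<open>\<forall>t\<in>{x<..<x+d2} \<inter> {0..1}. \<bar>f t\<bar> \<le> B2\<close> by blast
          then show ?thesis by simp
        qed simp
      qed
    qed
  qed
  then obtain B where "\<forall>t\<in>{0..1}. \<bar>f t\<bar> \<le> B" unfolding P_def by auto
  then show thesis using that by blast
qed

instantiation skorokhod :: real_vector
begin

lift_definition zero_skorokhod :: skorokhod is "\<lambda>_. 0"
  by (auto simp: cadlag_on_unit_def)

lift_definition plus_skorokhod :: "skorokhod \<Rightarrow> skorokhod \<Rightarrow> skorokhod" is "\<lambda>f g t. f t + g t"
  unfolding cadlag_on_unit_def by (fastforce intro: tendsto_add)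

lift_definition minus_skorokhod :: "skorokhod \<Rightarrow> skorokhod \<Rightarrow> skorokhod" is "\<lambda>f g t. f t - g t"
  unfolding cadlag_on_unit_def by (fastforce intro: tendsto_diff)

lift_definition uminus_skorokhod :: "skorokhod \<Rightarrow> skorokhod" is "\<lambda>f t. - f t"
  unfolding cadlag_on_unit_def by (fastforce intro: tendsto_minus)

lift_definition scaleR_skorokhod :: "real \<Rightarrow> skorokhod \<Rightarrow> skorokhod" is "\<lambda>c f t. c * f t"
  unfolding cadlag_on_unit_def by (fastforce intro: tendsto_mult_left)

instance
  by standard (transfer; force simp: algebra_simps)+

end

lemma skor_fun_simps [simp]:
  "skor_fun 0 t = 0" "skor_fun (v + w) t = skor_fun v t + skor_fun w t" "skor_fun (v - w) t = skor_fun v t - skor_fun w t"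
  "skor_fun (- w) t = - skor_fun w t" "skor_fun (c *\<^sub>R w) t = c * skor_fun w t"
  by (transfer; simp)+

lemma bdd_above_skor_fun: "bdd_above ((\<lambda>t. \<bar>skor_fun w t\<bar>) ` {0..1})"
proof -
  have "cadlag_on_unit (skor_fun w)" using skor_fun[of w] by blast
  then obtain B where "\<And>t. t \<in> {0..1} \<Longrightarrow> \<bar>skor_fun w t\<bar> \<le> B"
    using cadlag_bounded by blast
  then show ?thesis by (rule bdd_aboveI2)
qed

instantiation skorokhod :: real_normed_vector
begin

definition norm_skorokhod :: "skorokhod \<Rightarrow> real" where
  "norm_skorokhod w = (SUP t\<in>{0..1}. \<bar>skor_fun w t\<bar>)"

definition dist_skorokhod :: "skorokhod \<Rightarrow> skorokhod \<Rightarrow> real" where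
  "dist_skorokhod v w = norm (v - w)"

definition sgn_skorokhod :: "skorokhod \<Rightarrow> skorokhod" where
  "sgn_skorokhod w = inverse (norm w) *\<^sub>R w"

definition uniformity_skorokhod :: "(skorokhod \<times> skorokhod) filter" where
  "uniformity_skorokhod = (INF e\<in>{0<..}. principal {(v, w). dist v w < e})"

definition open_skorokhod :: "skorokhod set \<Rightarrow> bool" where
  "open_skorokhod U \<longleftrightarrow> (\<forall>w\<in>U. \<forall>\<^sub>F (w', v) in uniformity. w' = w \<longrightarrow> v \<in> U)"

lemma skor_fun_le_norm: "\<bar>skor_fun w t\<bar> \<le> norm w" for w :: skorokhod
proof (cases "t \<in> {0..1}")
  case True
  then show ?thesis
    unfolding norm_skorokhod_def by (intro cSUP_upper bdd_above_skor_fun)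
next
  case False
  have "0 \<le> \<bar>skor_fun w 0\<bar>" by simp
  also have "\<dots> \<le> norm w"
    unfolding norm_skorokhod_def by (intro cSUP_upper bdd_above_skor_fun) auto
  finally show ?thesis using False by (simp add: skor_fun_outside)
qed

lemma norm_skorokhod_leI: "(\<And>t. t \<in> {0..1} \<Longrightarrow> \<bar>skor_fun w t\<bar> \<le> B) \<Longrightarrow> norm w \<le> B"
  unfolding norm_skorokhod_def by (intro cSUP_least) auto

instance
proof
  fix v w :: skorokhod and c :: real
  show "dist v w = norm (v - w)" by (fact dist_skorokhod_def)
  show "sgn w = inverse (norm w) *\<^sub>R w" by (fact sgn_skorokhod_def)
  show "uniformity = (INF e\<in>{0<..}. principal {(v, w :: skorokhod). dist v w < e})"
    by (fact uniformity_skorokhod_def)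
  show "open U \<longleftrightarrow> (\<forall>w\<in>U. \<forall>\<^sub>F (w', v) in uniformity. w' = w \<longrightarrow> v \<in> U)" for U :: "skorokhod set"
    by (fact open_skorokhod_def)
  show "norm w = 0 \<longleftrightarrow> w = 0"
  proof
    assume "norm w = 0"
    then show "w = 0" using skor_fun_le_norm[of w] by (intro skor_fun_eqI) simp
  next
    assume "w = 0"
    then show "norm w = 0" by (simp add: norm_skorokhod_def)
  qed
  show "norm (v + w) \<le> norm v + norm w"
  proof (rule norm_skorokhod_leI)
    fix t
    show "\<bar>skor_fun (v + w) t\<bar> \<le> norm v + norm w"
      using skor_fun_le_norm[of v t] skor_fun_le_norm[of w t] by simp
  qed
  have le: "norm (c *\<^sub>R w) \<le> \<bar>c\<bar> * norm w" for c :: real and w :: skorokhod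
    by (rule norm_skorokhod_leI) (simp add: abs_mult mult_left_mono skor_fun_le_norm)
  show "norm (c *\<^sub>R w) = \<bar>c\<bar> * norm w"
  proof (cases "c = 0")
    case True
    then show ?thesis by (simp add: norm_skorokhod_def)
  next
    case False
    have "norm w = norm (inverse c *\<^sub>R c *\<^sub>R w)" using False by simp
    also have "\<dots> \<le> inverse \<bar>c\<bar> * norm (c *\<^sub>R w)" using le[of "inverse c" "c *\<^sub>R w"] by simp
    finally have "\<bar>c\<bar> * norm w \<le> norm (c *\<^sub>R w)" using False by (simp add: field_simps)
    then show ?thesis using le[of c w] by simp
  qed
qed

end

lemma floor_mult_eventually_right:
  fixes m t :: real
  assumes "0 \<le> m"
  shows "\<forall>\<^sub>F u in at_right t. \<lfloor>m * u\<rfloor> = \<lfloor>m * t\<rfloor>"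
proof (cases "m = 0")
  case False
  with assms have m: "m > 0" by simp
  have "\<lfloor>m * u\<rfloor> = \<lfloor>m * t\<rfloor>" if "t < u" "u < (\<lfloor>m * t\<rfloor> + 1) / m" for u
  proof -
    have "m * t \<le> m * u" "m * u < \<lfloor>m * t\<rfloor> + 1" using that m by (auto simp: field_simps)
    then show ?thesis by linarith
  qed
  moreover have "t < (\<lfloor>m * t\<rfloor> + 1) / m" using m by (simp add: field_simps) linarith
  ultimately show ?thesis unfolding eventually_at_right_field by blast
qed simp

lemma floor_mult_eventually_left:
  fixes m t :: real
  assumes "0 < m"
  shows "\<forall>\<^sub>F u in at_left t. \<lfloor>m * u\<rfloor> = \<lceil>m * t\<rceil> - 1"
proof -
  have "\<lfloor>m * u\<rfloor> = \<lceil>m * t\<rceil> - 1" if "(\<lceil>m * t\<rceil> - 1) / m < u" "u < t" for u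
  proof -
    have "m * u < m * t" "\<lceil>m * t\<rceil> - 1 < m * u" using that assms by (auto simp: field_simps)
    then show ?thesis by linarith
  qed
  moreover have "(\<lceil>m * t\<rceil> - 1) / m < t" using assms by (simp add: field_simps) linarith
  ultimately show ?thesis unfolding eventually_at_left_field by blast
qed

lift_definition partial_sum_path :: "nat \<Rightarrow> (nat \<Rightarrow> real) \<Rightarrow> skorokhod" is
  "\<lambda>n a t. if t \<in> {0..1} then \<Sum>i\<in>{1..nat \<lfloor>real n * t\<rfloor>}. a i else 0"
proof -
  fix n :: nat and a :: "nat \<Rightarrow> real"
  let ?f = "\<lambda>t::real. if t \<in> {0..1} then \<Sum>i\<in>{1..nat \<lfloor>real n * t\<rfloor>}. a i else 0"
  have "cadlag_on_unit ?f"
    unfolding cadlag_on_unit_def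
  proof (intro conjI ballI)
    fix t :: real assume t: "t \<in> {0..<1}"
    have "\<forall>\<^sub>F u in at_right t. u \<in> {t<..<1}"
      using t by (intro eventually_at_right_real) auto
    moreover have "\<forall>\<^sub>F u in at_right t. \<lfloor>real n * u\<rfloor> = \<lfloor>real n * t\<rfloor>"
      by (rule floor_mult_eventually_right) simp
    ultimately have "\<forall>\<^sub>F u in at_right t. ?f u = ?f t"
      by eventually_elim (use t in auto)
    then show "(?f \<longlongrightarrow> ?f t) (at_right t)" by (rule tendsto_eventually)
  next
    fix t :: real assume t: "t \<in> {0<..1}"
    have inside: "\<forall>\<^sub>F u in at_left t. u \<in> {0<..<t}"
      using t by (intro eventually_at_left_real) auto
    show "\<exists>l. (?f \<longlongrightarrow> l) (at_left t)"
    proof (cases "n = 0")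
      case True
      then have "?f = (\<lambda>_. 0)" by auto
      then show ?thesis by (metis tendsto_const)
    next
      case False
      then have "\<forall>\<^sub>F u in at_left t. \<lfloor>real n * u\<rfloor> = \<lceil>real n * t\<rceil> - 1"
        by (intro floor_mult_eventually_left) simp
      with inside have "\<forall>\<^sub>F u in at_left t. ?f u = (\<Sum>i\<in>{1..nat (\<lceil>real n * t\<rceil> - 1)}. a i)"
        by eventually_elim (use t in auto)
      then show ?thesis by (blast intro: tendsto_eventually)
    qed
  qed
  then show "cadlag_on_unit ?f \<and> (\<forall>t. t \<notin> {0..1} \<longrightarrow> ?f t = 0)" by simp
qed

lemma skor_fun_partial_sum_path:
  "t \<in> {0..1} \<Longrightarrow> skor_fun (partial_sum_path n a) t = (\<Sum>i\<in>{1..nat \<lfloor>real n * t\<rfloor>}. a i)"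
  by transfer simp


section \<open>Classes of test functions\<close>

text \<open>Both derivatives are only meaningful where the function is differentiable.\<close>

definition frechet1 :: "(skorokhod \<Rightarrow> real) \<Rightarrow> skorokhod \<Rightarrow> skorokhod \<Rightarrow>\<^sub>L real" where
  "frechet1 f w = Blinfun (frechet_derivative f (at w))"

definition frechet2 :: "(skorokhod \<Rightarrow> real) \<Rightarrow> skorokhod \<Rightarrow> skorokhod \<Rightarrow>\<^sub>L skorokhod \<Rightarrow>\<^sub>L real" where
  "frechet2 f w = Blinfun (frechet_derivative (frechet1 f) (at w))"

definition twice_frechet_differentiable :: "(skorokhod \<Rightarrow> real) \<Rightarrow> bool" where
  "twice_frechet_differentiable f \<longleftrightarrow>
     (\<forall>w. f differentiable (at w)) \<and> (\<forall>w. frechet1 f differentiable (at w))"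

text \<open>The norm of a multilinear form \<open>B\<close> only involves its diagonal \<open>q h = B[h, \<dots>, h]\<close>.\<close>

definition diag_norm :: "(skorokhod \<Rightarrow> real) \<Rightarrow> real" where
  "diag_norm q = (SUP h\<in>{h. norm h = 1}. \<bar>q h\<bar>)"

definition linear_form_norm :: "(skorokhod \<Rightarrow>\<^sub>L real) \<Rightarrow> real" where
  "linear_form_norm A = diag_norm (\<lambda>h. blinfun_apply A h)"

definition bilinear_form_norm :: "(skorokhod \<Rightarrow>\<^sub>L skorokhod \<Rightarrow>\<^sub>L real) \<Rightarrow> real" where
  "bilinear_form_norm B = diag_norm (\<lambda>h. blinfun_apply (blinfun_apply B h) h)"

text \<open>The suprema are taken over nonempty bounded sets, so that they are not junk values.\<close>

lemma unit_sphere_skorokhod_nonempty: "{h :: skorokhod. norm h = 1} \<noteq> {}"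
proof -
  define w where "w = partial_sum_path 1 (\<lambda>_. 1)"
  have "skor_fun w 1 = 1" by (simp add: w_def skor_fun_partial_sum_path)
  then have "w \<noteq> 0" by auto
  then have "norm (sgn w) = 1" by (simp add: norm_sgn)
  then show ?thesis by blast
qed

lemma bdd_above_linear_form:
  fixes A :: "skorokhod \<Rightarrow>\<^sub>L real"
  shows "bdd_above ((\<lambda>h. \<bar>blinfun_apply A h\<bar>) ` {h :: skorokhod. norm h = 1})"
proof (rule bdd_aboveI2)
  fix h :: skorokhod assume "h \<in> {h. norm h = 1}"
  then show "\<bar>blinfun_apply A h\<bar> \<le> norm A" using norm_blinfun[of A h] by simp
qed

lemma bdd_above_bilinear_form:
  fixes B :: "skorokhod \<Rightarrow>\<^sub>L skorokhod \<Rightarrow>\<^sub>L real"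
  shows "bdd_above ((\<lambda>h. \<bar>blinfun_apply (blinfun_apply B h) h\<bar>) ` {h :: skorokhod. norm h = 1})"
proof (rule bdd_aboveI2)
  fix h :: skorokhod assume "h \<in> {h. norm h = 1}"
  then show "\<bar>blinfun_apply (blinfun_apply B h) h\<bar> \<le> norm B"
    using norm_blinfun[of "blinfun_apply B h" h] norm_blinfun[of B h] by simp
qed

text \<open>Suprema that may be infinite are taken in \<^typ>\<open>ennreal\<close>.\<close>

definition growth_norm :: "(skorokhod \<Rightarrow> real) \<Rightarrow> ennreal" where
  "growth_norm f = (SUP w. ennreal (\<bar>f w\<bar> / (1 + norm w ^ 3)))"

definition class_M :: "(skorokhod \<Rightarrow> real) set" where
  "class_M = {f. continuous_on UNIV f \<and> growth_norm f < \<infinity> \<and> twice_frechet_differentiable f \<and>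
     (\<exists>k. \<forall>w h. bilinear_form_norm (frechet2 f (w + h) - frechet2 f w) \<le> k * norm h)}"

definition norm_M1 :: "(skorokhod \<Rightarrow> real) \<Rightarrow> ennreal" where
  "norm_M1 g = growth_norm g
     + (SUP w. ennreal (linear_form_norm (frechet1 g w)))
     + (SUP w. ennreal (bilinear_form_norm (frechet2 g w)))
     + (SUP (w, h)\<in>UNIV \<times> - {0}.
          ennreal (bilinear_form_norm (frechet2 g (w + h) - frechet2 g w) / norm h))"

definition class_M1 :: "(skorokhod \<Rightarrow> real) set" where
  "class_M1 = {g \<in> class_M. norm_M1 g < \<infinity>}"


section \<open>Random elements\<close>

text \<open>The library's \<^const>\<open>prob_space.indep_var\<close> requires both variables to have the same type.\<close>

definition indep_elements ::
    "'a measure \<Rightarrow> 'b measure \<Rightarrow> ('a \<Rightarrow> 'b) \<Rightarrow> 'c measure \<Rightarrow> ('a \<Rightarrow> 'c) \<Rightarrow> bool" where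
  "indep_elements M S U T V \<longleftrightarrow> U \<in> measurable M S \<and> V \<in> measurable M T \<and>
     prob_space.indep_set M (sets (vimage_algebra (space M) U S)) (sets (vimage_algebra (space M) V T))"

abbreviation index_square :: "nat \<Rightarrow> (nat \<times> nat) set" where
  "index_square n \<equiv> {1..n} \<times> {1..n}"

definition array_space :: "nat \<Rightarrow> (nat \<times> nat \<Rightarrow> real) measure" where
  "array_space n = Pi\<^sub>M (index_square n) (\<lambda>_. borel)"

definition array :: "nat \<Rightarrow> (nat \<Rightarrow> nat \<Rightarrow> 'a \<Rightarrow> real) \<Rightarrow> 'a \<Rightarrow> nat \<times> nat \<Rightarrow> real" where
  "array n X \<omega> = (\<lambda>(i, j)\<in>index_square n. X i j \<omega>)"

definition permutation_space :: "nat \<Rightarrow> (nat \<Rightarrow> nat) measure" where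
  "permutation_space n = uniform_count_measure {p. p permutes {1..n}}"

end

theory Submission
  imports Defs
begin

text \<open>Since \<open>D\<close> has the same covariance as the summands \<open>X i (\<pi> i)\<close> of \<open>Y\<close>, the two laws are compared by a
  form of Stein's method. Along \<open>cos t * Y + sin t * D\<close>, with independent copies of \<open>Y\<close> and \<open>D\<close>, the derivative of
  the expectation of \<open>g\<close> splits into \<open>E Dg[Y]\<close> and \<open>E Dg[D]\<close>. Each of them equals the same contraction of \<open>E D\<^sup>2g\<close> with
  the covariance, up to a third-order error, so the leading terms cancel and the errors integrate to a third.

  For \<open>Y\<close> the identity comes from exchangeability: the values of \<open>\<pi>\<close> at \<open>i\<close> and \<open>j\<close> are exchanged, the average over
  \<open>j\<close> of \<open>X i (\<pi> j)\<close> is centred, and \<open>Dg\<close> is expanded around the sum without the rows \<open>i\<close> and \<open>j\<close>.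
  For \<open>D\<close> it comes from Gaussian integration by parts given \<open>X''\<close>, followed by leaving out one or two
  entries of \<open>X''\<close>.\<close>

section \<open>Functions with a Lipschitz second derivative\<close>

text \<open>Neither side need be Gaussian: given \<open>X''\<close> the process D is, but its
  conditional covariance is random. Hence both satisfy Stein's identity only up to an error, and
  they are compared with each other instead of with a third process. The weights are cos t and sin t
  because their squares add up to 1: the rescaled identities yield cos t and sin t times the same
  contraction H, and - sin t cos t H + cos t sin t H = 0. The rest is bounded by multiples of sin t
  cos^2 t and cos t sin^2 t, each of integral 1/3 over [0, pi/2]; this third pays for crude
  estimates of the remainders.

  Two obstacles shape the proof. The norm of a form sees only its diagonal, so Lipschitz bounds for
  D^2 g in two different directions cost a factor 2 by polarization; the expansions are arranged so
  that only mixed terms pay it. And after the exchange, the means of the entries still depend on the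
  same permutation as the point at which D^2 g is taken. Independence of the array cannot remove
  this; further transpositions decouple them.\<close>

lemma polarization_bound:
  fixes B :: "'v::real_normed_vector \<Rightarrow> 'v \<Rightarrow> real"
  assumes lin: "\<And>x. linear (B x)" and sym: "\<And>x y. B x y = B y x"
    and diag: "\<And>x. \<bar>B x x\<bar> \<le> c * (norm x)\<^sup>2"
  shows "\<bar>B x y\<bar> \<le> 2 * c * norm x * norm y"
proof (cases "x = 0 \<or> y = 0")
  case True
  then show ?thesis
    using linear_0[OF lin] sym[of x y] by auto
next
  case False
  define u v where "u = sgn x" and "v = sgn y"
  have norms: "norm u = 1" "norm v = 1" using False by (auto simp: u_def v_def norm_sgn)
  have c: "c \<ge> 0" using diag[of u] norms by simp
  \<comment> \<open>For unit vectors, \<open>4 * B u v\<close> is the difference of the diagonal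
    values at \<open>u + v\<close> and \<open>u - v\<close>. Both vectors have norm at most 2, so
    each value is at most \<open>4 * c\<close> in modulus, which leaves
    \<open>8 * c / 4\<close>.\<close>
  have 1: "B (u + v) (u + v) = B u u + 2 * B u v + B v v"
    by (simp add: linear_add[OF lin] sym[of "u + v"]) (simp add: sym[of v u])
  have 2: "B (u - v) (u - v) = B u u - 2 * B u v + B v v"
    by (simp add: linear_diff[OF lin] sym[of "u - v"]) (simp add: sym[of v u])
  have "norm (u + v) \<le> 2" "norm (u - v) \<le> 2"
    using norm_triangle_ineq[of u v] norm_triangle_ineq4[of u v] norms by auto
  then have "(norm (u + v))\<^sup>2 \<le> 2\<^sup>2" "(norm (u - v))\<^sup>2 \<le> 2\<^sup>2"
    by (intro power_mono; simp)+
  then have "c * (norm (u + v))\<^sup>2 \<le> c * 4" "c * (norm (u - v))\<^sup>2 \<le> c * 4"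
    using c by (auto intro!: mult_left_mono)
  then have *: "\<bar>B u v\<bar> \<le> 2 * c"
    using diag[of "u + v"] diag[of "u - v"] 1 2 by linarith
  have "x = norm x *\<^sub>R u" "y = norm y *\<^sub>R v" using False by (simp_all add: u_def v_def sgn_div_norm)
  then have "B x y = norm x * norm y * B u v"
    by (metis linear_scale[OF lin] sym real_scaleR_def mult.assoc)
  then have "\<bar>B x y\<bar> = norm x * norm y * \<bar>B u v\<bar>" by (simp add: abs_mult)
  also have "\<dots> \<le> norm x * norm y * (2 * c)" by (intro mult_left_mono *) auto
  finally show ?thesis by (simp add: mult_ac)
qed

text \<open>\<open>F1\<close> and \<open>F2\<close> stand for Dg and D^2 g. Working with the pair
  alone makes the class visibly closed under the rescaling below. \<open>K\<close> serves
  integrability, while \<open>L\<close> is the constant that reaches the error bound. The Taylor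
  estimate is an axiom of its own because it holds with \<open>L / 2\<close> in mixed directions,
  whereas integrating the polarized Lipschitz bound would give twice that.\<close>

locale lipschitz_hessian =
  fixes F1 :: "'v::real_normed_vector \<Rightarrow> 'v \<Rightarrow> real"
    and F2 :: "'v \<Rightarrow> 'v \<Rightarrow> 'v \<Rightarrow> real"
    and K L :: real
  assumes F1_linear: "linear (F1 w)"
    and F2_linear: "linear (F2 w x)"
    and F2_sym: "F2 w x y = F2 w y x"
    and K_nonneg: "K \<ge> 0" and L_nonneg: "L \<ge> 0"
    and F1_bound: "\<bar>F1 w x\<bar> \<le> K * norm x"
    and F2_diag_bound: "\<bar>F2 w x x\<bar> \<le> K * (norm x)\<^sup>2"
    and F1_taylor: "\<bar>F1 (w + h) x - F1 w x - F2 w x h\<bar> \<le> L / 2 * (norm h)\<^sup>2 * norm x"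
    and F2_diag_lipschitz: "\<bar>F2 (w + h) x x - F2 w x x\<bar> \<le> L * norm h * (norm x)\<^sup>2"
begin

lemma F2_linear_left: "linear (\<lambda>x. F2 w x y)"
  using F2_linear[of w y] by (simp add: F2_sym[of w _ y])

lemma F2_bound: "\<bar>F2 w x y\<bar> \<le> 2 * K * norm x * norm y"
  by (rule polarization_bound[of "F2 w"]) (auto simp: F2_linear F2_diag_bound intro: F2_sym)

lemma F2_lipschitz: "\<bar>F2 v x y - F2 w x y\<bar> \<le> 2 * (L * norm (v - w)) * norm x * norm y"
proof (rule polarization_bound[of "\<lambda>x y. F2 v x y - F2 w x y"])
  show "\<bar>F2 v x x - F2 w x x\<bar> \<le> L * norm (v - w) * (norm x)\<^sup>2" for x
    using F2_diag_lipschitz[of w "v - w" x] by simp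
  show "F2 v x y - F2 w x y = F2 v y x - F2 w y x" for x y
    by (metis F2_sym)
qed (auto simp: linear_compose_sub F2_linear)

lemma F2_diag_lipschitz': "\<bar>F2 v x x - F2 w x x\<bar> \<le> L * norm (v - w) * (norm x)\<^sup>2"
  using F2_diag_lipschitz[of w "v - w" x] by simp

lemma F2_continuous: "continuous_on UNIV (\<lambda>w. F2 w x y)"
proof -
  define c where "c = 2 * L * norm x * norm y"
  have "c-lipschitz_on UNIV (\<lambda>w. F2 w x y)"
  proof (rule lipschitz_onI)
    show "dist (F2 v x y) (F2 w x y) \<le> c * dist v w" for v w
      using F2_lipschitz[of v x y w] by (simp add: c_def dist_norm mult_ac)
  qed (simp add: c_def L_nonneg)
  then show ?thesis by (rule lipschitz_on_continuous_on)
qed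

text \<open>The Taylor remainder is quadratic in the increment, so it is itself a statement of
  differentiability along lines.\<close>

lemma F1_has_derivative_line:
  "((\<lambda>t. F1 (w + t *\<^sub>R a) x) has_real_derivative F2 (w + t *\<^sub>R a) x a) (at t)"
  unfolding has_field_derivative_def
proof (rule has_derivativeI_sandwich[of 1])
  let ?D = "F2 (w + t *\<^sub>R a) x a"
  let ?C = "L / 2 * (norm a)\<^sup>2 * norm x"
  show "bounded_linear ((*) ?D)" by (rule bounded_linear_mult_right)
  show "((\<lambda>u. ?C * \<bar>u - t\<bar>) \<longlongrightarrow> 0) (at t)" by (auto intro!: tendsto_eq_intros)
  fix u assume "u \<noteq> t"
  have eq: "w + t *\<^sub>R a + (u - t) *\<^sub>R a = w + u *\<^sub>R a" by (simp add: algebra_simps)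
  have "\<bar>F1 (w + u *\<^sub>R a) x - F1 (w + t *\<^sub>R a) x - (u - t) * ?D\<bar> \<le> ?C * \<bar>u - t\<bar>\<^sup>2"
    using F1_taylor[of "w + t *\<^sub>R a" "(u - t) *\<^sub>R a" x] unfolding eq
    by (simp add: linear_scale[OF F2_linear] power_mult_distrib mult_ac)
  then have "\<bar>F1 (w + u *\<^sub>R a) x - F1 (w + t *\<^sub>R a) x - ?D * (u - t)\<bar> \<le> ?C * \<bar>u - t\<bar> * \<bar>u - t\<bar>"
    by (simp add: power2_eq_square mult_ac abs_mult_self_eq)
  then show "norm (F1 (w + u *\<^sub>R a) x - F1 (w + t *\<^sub>R a) x - ?D * (u - t)) / norm (u - t)
      \<le> ?C * \<bar>u - t\<bar>"
    using \<open>u \<noteq> t\<close> by (simp add: divide_le_eq)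
qed simp

lemma F1_continuous: "continuous_on UNIV (\<lambda>w. F1 w x)"
proof -
  have "\<bar>F1 v x - F1 w x\<bar> \<le> 2 * K * norm x * norm (v - w)" for v w
  proof -
    define f where "f t = F1 (w + t *\<^sub>R (v - w)) x" for t
    have "\<exists>z. 0 < z \<and> z < 1 \<and> f 1 - f 0 = (1 - 0) * F2 (w + z *\<^sub>R (v - w)) x (v - w)"
      unfolding f_def by (rule MVT2) (auto intro: F1_has_derivative_line)
    then show ?thesis using F2_bound[of _ x "v - w"] by (auto simp: f_def)
  qed
  then have "(2 * K * norm x)-lipschitz_on UNIV (\<lambda>w. F1 w x)"
    by (intro lipschitz_onI) (auto simp: dist_norm K_nonneg)
  then show ?thesis by (rule lipschitz_on_continuous_on)
qed

text \<open>These are the derivatives of w \<mapsto> g (\<alpha> w + v). The third power of \<alpha>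
  in the Lipschitz constant later becomes cos^3 t or sin^3 t; \<open>K\<close> survives unchanged
  because \<alpha> \<le> 1.\<close>

lemma rescale:
  assumes "0 \<le> \<alpha>" "\<alpha> \<le> 1"
  shows "lipschitz_hessian (\<lambda>w x. \<alpha> * F1 (\<alpha> *\<^sub>R w + v) x) (\<lambda>w x y. \<alpha>\<^sup>2 * F2 (\<alpha> *\<^sub>R w + v) x y) K (\<alpha> ^ 3 * L)"
proof (rule lipschitz_hessian.intro)
  fix w x y h
  show "linear (\<lambda>x. \<alpha> * F1 (\<alpha> *\<^sub>R w + v) x)" "linear (\<lambda>y. \<alpha>\<^sup>2 * F2 (\<alpha> *\<^sub>R w + v) x y)"
    using F1_linear F2_linear by (auto intro!: linearI simp: linear_add linear_scale algebra_simps)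
  show "\<alpha>\<^sup>2 * F2 (\<alpha> *\<^sub>R w + v) x y = \<alpha>\<^sup>2 * F2 (\<alpha> *\<^sub>R w + v) y x"
    by (simp add: F2_sym[of _ x y])
  have 1: "\<alpha> * \<bar>t\<bar> \<le> \<bar>t\<bar>" "\<alpha>\<^sup>2 * \<bar>t\<bar> \<le> \<bar>t\<bar>" for t
    using assms by (auto intro: mult_left_le_one_le power_le_one)
  show "\<bar>\<alpha> * F1 (\<alpha> *\<^sub>R w + v) x\<bar> \<le> K * norm x"
    using F1_bound[of "\<alpha> *\<^sub>R w + v" x] 1[of "F1 (\<alpha> *\<^sub>R w + v) x"] assms by (simp add: abs_mult)
  show "\<bar>\<alpha>\<^sup>2 * F2 (\<alpha> *\<^sub>R w + v) x x\<bar> \<le> K * (norm x)\<^sup>2"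
    using F2_diag_bound[of "\<alpha> *\<^sub>R w + v" x] 1[of "F2 (\<alpha> *\<^sub>R w + v) x x"] by (simp add: abs_mult)
  have eq: "\<alpha> *\<^sub>R (w + h) + v = (\<alpha> *\<^sub>R w + v) + \<alpha> *\<^sub>R h" by (simp add: algebra_simps)
  let ?w = "\<alpha> *\<^sub>R w + v"
  have "\<alpha> * \<bar>F1 (?w + \<alpha> *\<^sub>R h) x - F1 ?w x - F2 ?w x (\<alpha> *\<^sub>R h)\<bar> \<le> \<alpha> * (L / 2 * (norm (\<alpha> *\<^sub>R h))\<^sup>2 * norm x)"
    by (intro mult_left_mono F1_taylor assms)
  also have "\<alpha> * \<bar>F1 (?w + \<alpha> *\<^sub>R h) x - F1 ?w x - F2 ?w x (\<alpha> *\<^sub>R h)\<bar>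
      = \<bar>\<alpha> * (F1 (?w + \<alpha> *\<^sub>R h) x - F1 ?w x - F2 ?w x (\<alpha> *\<^sub>R h))\<bar>"
    using assms by (simp add: abs_mult)
  finally show "\<bar>\<alpha> * F1 (\<alpha> *\<^sub>R (w + h) + v) x - \<alpha> * F1 ?w x - \<alpha>\<^sup>2 * F2 ?w x h\<bar>
      \<le> \<alpha> ^ 3 * L / 2 * (norm h)\<^sup>2 * norm x"
    using assms unfolding eq
    by (simp add: linear_scale[OF F2_linear] power_mult_distrib algebra_simps power2_eq_square power3_eq_cube)
  have "\<alpha>\<^sup>2 * \<bar>F2 (?w + \<alpha> *\<^sub>R h) x x - F2 ?w x x\<bar> \<le> \<alpha>\<^sup>2 * (L * norm (\<alpha> *\<^sub>R h) * (norm x)\<^sup>2)"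
    by (intro mult_left_mono F2_diag_lipschitz) auto
  also have "\<alpha>\<^sup>2 * \<bar>F2 (?w + \<alpha> *\<^sub>R h) x x - F2 ?w x x\<bar> = \<bar>\<alpha>\<^sup>2 * (F2 (?w + \<alpha> *\<^sub>R h) x x - F2 ?w x x)\<bar>"
    by (simp add: abs_mult)
  finally show "\<bar>\<alpha>\<^sup>2 * F2 (\<alpha> *\<^sub>R (w + h) + v) x x - \<alpha>\<^sup>2 * F2 ?w x x\<bar> \<le> \<alpha> ^ 3 * L * norm h * (norm x)\<^sup>2"
    using assms unfolding eq by (simp add: algebra_simps power2_eq_square power3_eq_cube)
  show "0 \<le> K" "0 \<le> \<alpha> ^ 3 * L" using K_nonneg L_nonneg assms by auto
qed

end

lemma has_real_derivative_along_line:
  fixes f :: "'v::real_normed_vector \<Rightarrow> real"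
  assumes "(f has_derivative D) (at (v + t *\<^sub>R h))"
  shows "((\<lambda>t. f (v + t *\<^sub>R h)) has_real_derivative D h) (at t)"
proof -
  have "((\<lambda>t. f (v + t *\<^sub>R h)) has_derivative (\<lambda>s. D (s *\<^sub>R h))) (at t)"
    by (rule has_derivative_compose[of "\<lambda>t. v + t *\<^sub>R h" "\<lambda>s. s *\<^sub>R h" t UNIV f D, OF _ assms])
      (auto intro!: derivative_eq_intros)
  moreover have "D (s *\<^sub>R h) = D h * s" for s
    using linear_scale[OF has_derivative_linear[OF assms], of s h] by simp
  ultimately show ?thesis by (simp add: has_field_derivative_def)
qed

text \<open>The function t \<mapsto> f (w + d + t h) - f (w + t h), with derivatives
  \<open>q 0\<close>, \<open>q 1\<close>, \<open>q 2\<close>, is expanded to second order. Its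
  second derivative is an increment of the form evaluated at the pair (h, h), so the diagonal
  Lipschitz condition is enough and no polarization occurs.\<close>

lemma second_order_increment_bound:
  fixes f :: "'v::real_normed_vector \<Rightarrow> real" and f1 :: "'v \<Rightarrow> 'v \<Rightarrow> real" and f2 :: "'v \<Rightarrow> 'v \<Rightarrow> 'v \<Rightarrow> real"
  assumes f1: "\<And>w. (f has_derivative f1 w) (at w)"
    and f2: "\<And>w x. ((\<lambda>w. f1 w x) has_derivative (\<lambda>h. f2 w h x)) (at w)"
    and lip: "\<And>w h x. \<bar>f2 (w + h) x x - f2 w x x\<bar> \<le> L * norm h * (norm x)\<^sup>2"
  shows "\<bar>(f (w + d + h) - f (w + d) - f1 (w + d) h) - (f (w + h) - f w - f1 w h)\<bar>
      \<le> L / 2 * (norm h)\<^sup>2 * norm d"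
proof -
  note line1 = has_real_derivative_along_line[OF f1] and line2 = has_real_derivative_along_line[OF f2]
  define q :: "nat \<Rightarrow> real \<Rightarrow> real" where
    "q m t = (if m = 0 then f (w + d + t *\<^sub>R h) - f (w + t *\<^sub>R h)
      else if m = 1 then f1 (w + d + t *\<^sub>R h) h - f1 (w + t *\<^sub>R h) h
      else f2 (w + d + t *\<^sub>R h) h h - f2 (w + t *\<^sub>R h) h h)" for m t
  have "\<exists>t. 0 < t \<and> t < 1 \<and> q 0 1 = (\<Sum>m<2. q m 0 / fact m * 1 ^ m) + q 2 t / fact 2 * 1 ^ 2"
    by (rule Maclaurin) (auto simp: q_def less_2_cases_iff intro!: derivative_intros line1 line2)
  then obtain t where t: "q 0 1 = q 0 0 + q 1 0 + q 2 t / 2"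
    by (auto simp: lessThan_Suc numeral_2_eq_2)
  have "\<bar>q 2 t\<bar> \<le> L * norm d * (norm h)\<^sup>2"
    using lip[of "w + t *\<^sub>R h" d h] by (simp add: q_def algebra_simps)
  then have "\<bar>q 0 1 - q 0 0 - q 1 0\<bar> \<le> L * norm d * (norm h)\<^sup>2 / 2" using t by simp
  then show ?thesis by (simp add: q_def algebra_simps)
qed

text \<open>The mixed Taylor term is read as a derivative in the direction x, namely that of p v = f
  (v + h) - f v - f1 v h at w. By the preceding bound p is Lipschitz with constant
  \<open>L / 2 * (norm h)\<^sup>2\<close>, which bounds its derivative without loss. Symmetry of the
  second derivative then comes from the same estimate.\<close>

lemma lipschitz_hessianI:
  fixes f :: "'v::real_normed_vector \<Rightarrow> real" and f1 :: "'v \<Rightarrow> 'v \<Rightarrow> real" and f2 :: "'v \<Rightarrow> 'v \<Rightarrow> 'v \<Rightarrow> real"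
  assumes f1: "\<And>w. (f has_derivative f1 w) (at w)"
    and f2: "\<And>w x. ((\<lambda>w. f1 w x) has_derivative (\<lambda>h. f2 w h x)) (at w)"
    and f2_linear: "\<And>w x. linear (f2 w x)"
    and K: "\<And>w x. \<bar>f1 w x\<bar> \<le> K * norm x" "\<And>w x. \<bar>f2 w x x\<bar> \<le> K * (norm x)\<^sup>2" "K \<ge> 0"
    and L: "\<And>w h x. \<bar>f2 (w + h) x x - f2 w x x\<bar> \<le> L * norm h * (norm x)\<^sup>2" "L \<ge> 0"
  shows "lipschitz_hessian f1 f2 K L"
proof -
  have lin1: "linear (f1 w)" for w
    using has_derivative_linear f1 by blast
  have tay: "\<bar>f1 (w + h) x - f1 w x - f2 w x h\<bar> \<le> L / 2 * (norm h)\<^sup>2 * norm x" for w h x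
  proof -
    define p where "p v = f (v + h) - f v - f1 v h" for v
    define C where "C = L / 2 * (norm h)\<^sup>2 * norm x"
    have "(p has_derivative (\<lambda>x. f1 (w + h) x - f1 w x - f2 w x h)) (at w)"
      unfolding p_def
      by (intro has_derivative_diff f1 f2 has_derivative_compose[of "\<lambda>v. v + h" "\<lambda>x. x" _ _ f])
        (auto intro!: derivative_eq_intros)
    then have "((\<lambda>t. p (w + t *\<^sub>R x)) has_real_derivative (f1 (w + h) x - f1 w x - f2 w x h)) (at 0)"
      by (intro has_real_derivative_along_line) simp
    then have lim: "((\<lambda>t. (p (w + t *\<^sub>R x) - p w) / t) \<longlongrightarrow> f1 (w + h) x - f1 w x - f2 w x h) (at 0)"
      by (simp add: has_field_derivative_iff)
    have "\<bar>(p (w + t *\<^sub>R x) - p w) / t\<bar> \<le> C" if "t \<noteq> 0" for t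
    proof -
      have "\<bar>p (w + t *\<^sub>R x) - p w\<bar> \<le> L / 2 * (norm h)\<^sup>2 * norm (t *\<^sub>R x)"
        using second_order_increment_bound[of f f1 f2 L w "t *\<^sub>R x" h, OF f1 f2 L(1)] by (simp add: p_def algebra_simps)
      then show ?thesis using that by (simp add: C_def divide_le_eq mult_ac)
    qed
    then have "\<forall>\<^sub>F t in at 0. \<bar>(p (w + t *\<^sub>R x) - p w) / t\<bar> \<le> C"
      by (auto simp: eventually_at_filter)
    then show ?thesis
      unfolding C_def[symmetric] by (intro tendsto_upperbound[OF tendsto_rabs[OF lim]]) auto
  qed
  have sym: "f2 w x y = f2 w y x" for w x y
  proof -
    text \<open>Both forms are the derivative of \<open>t \<mapsto> f1 (w + t y) x\<close> at \<open>0\<close>.\<close>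
    have 1: "((\<lambda>t. f1 (w + t *\<^sub>R y) x) has_real_derivative f2 w y x) (at 0)"
      using has_real_derivative_along_line[of "\<lambda>w. f1 w x" "\<lambda>h. f2 w h x" w 0 y] f2[of x w] by simp
    have "((\<lambda>t. (f1 (w + t *\<^sub>R y) x - f1 w x) / t - f2 w x y) \<longlongrightarrow> 0) (at 0)"
    proof (rule Lim_null_comparison)
      let ?C = "L / 2 * (norm y)\<^sup>2 * norm x"
      have "\<bar>(f1 (w + t *\<^sub>R y) x - f1 w x) / t - f2 w x y\<bar> \<le> ?C * \<bar>t\<bar>" if "t \<noteq> 0" for t
      proof -
        have "f2 w x (t *\<^sub>R y) = t * f2 w x y" by (simp add: linear_scale[OF f2_linear])
        then have "\<bar>f1 (w + t *\<^sub>R y) x - f1 w x - t * f2 w x y\<bar> \<le> ?C * t\<^sup>2"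
          using tay[of w "t *\<^sub>R y" x] by (simp add: power_mult_distrib mult_ac)
        moreover have "(f1 (w + t *\<^sub>R y) x - f1 w x) / t - f2 w x y = (f1 (w + t *\<^sub>R y) x - f1 w x - t * f2 w x y) / t"
          using that by (simp add: field_simps)
        ultimately show ?thesis using that by (simp add: divide_le_eq power2_eq_square abs_mult_self_eq mult_ac)
      qed
      then show "\<forall>\<^sub>F t in at 0. norm ((f1 (w + t *\<^sub>R y) x - f1 w x) / t - f2 w x y) \<le> ?C * \<bar>t\<bar>"
        by (auto simp: eventually_at_filter)
      show "((\<lambda>t. ?C * \<bar>t\<bar>) \<longlongrightarrow> 0) (at 0)" by (auto intro!: tendsto_eq_intros)
    qed
    then have "((\<lambda>t. f1 (w + t *\<^sub>R y) x) has_real_derivative f2 w x y) (at 0)"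
      by (simp add: has_field_derivative_iff LIM_zero_iff)
    with 1 show ?thesis by (metis DERIV_unique)
  qed
  show ?thesis
    using lin1 f2_linear sym K(3) L(2) K(1,2) tay L(1) by (rule lipschitz_hessian.intro)
qed

section \<open>From the norm of a test function to the Lipschitz condition\<close>

lemma diag_norm_upper:
  assumes "bdd_above ((\<lambda>h. \<bar>q h\<bar>) ` {h. norm h = 1})" "norm h = 1"
  shows "\<bar>q h\<bar> \<le> diag_norm q"
  unfolding diag_norm_def using assms by (intro cSUP_upper) auto

lemma linear_form_norm_upper: "\<bar>blinfun_apply A h\<bar> \<le> linear_form_norm A * norm h"
proof (cases "h = 0")
  case False
  then have "\<bar>blinfun_apply A (sgn h)\<bar> \<le> linear_form_norm A"
    unfolding linear_form_norm_def by (intro diag_norm_upper bdd_above_linear_form) (simp add: norm_sgn)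
  with False show ?thesis
    by (simp add: sgn_div_norm blinfun.scaleR_right abs_mult divide_simps)
qed simp

lemma bilinear_form_norm_upper:
  "\<bar>blinfun_apply (blinfun_apply B h) h\<bar> \<le> bilinear_form_norm B * (norm h)\<^sup>2"
proof (cases "h = 0")
  case False
  then have "\<bar>blinfun_apply (blinfun_apply B (sgn h)) (sgn h)\<bar> \<le> bilinear_form_norm B"
    unfolding bilinear_form_norm_def
    by (intro diag_norm_upper[of "\<lambda>h. blinfun_apply (blinfun_apply B h) h"] bdd_above_bilinear_form) (simp add: norm_sgn)
  with False show ?thesis
    by (simp add: sgn_div_norm blinfun.scaleR_right blinfun.scaleR_left abs_mult divide_simps power2_eq_square)
qed simp

lemma le_enn2realI: "ennreal x \<le> y \<Longrightarrow> y < \<infinity> \<Longrightarrow> x \<le> enn2real y"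
  by (cases y) (auto simp: ennreal_le_iff2)

lemma frechet1_has_derivative:
  assumes "twice_frechet_differentiable g"
  shows "(g has_derivative blinfun_apply (frechet1 g w)) (at w)"
proof -
  have "(g has_derivative frechet_derivative g (at w)) (at w)"
    using assms unfolding twice_frechet_differentiable_def frechet_derivative_works by blast
  then show ?thesis
    by (simp add: frechet1_def bounded_linear_Blinfun_apply has_derivative_bounded_linear)
qed

lemma frechet2_has_derivative:
  assumes "twice_frechet_differentiable g"
  shows "((\<lambda>w. blinfun_apply (frechet1 g w) x) has_derivative (\<lambda>h. blinfun_apply (blinfun_apply (frechet2 g w) h) x)) (at w)"
proof -
  have "(frechet1 g has_derivative frechet_derivative (frechet1 g) (at w)) (at w)"
    using assms unfolding twice_frechet_differentiable_def frechet_derivative_works by blast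
  then have "(frechet1 g has_derivative blinfun_apply (frechet2 g w)) (at w)"
    by (simp add: frechet2_def bounded_linear_Blinfun_apply has_derivative_bounded_linear)
  then show ?thesis
    by (rule bounded_linear.has_derivative[OF blinfun.bounded_linear_left])
qed

text \<open>Each of the suprema in \<open>norm_M1\<close> is at most their sum, so the whole norm
  can serve as both constants. Its finiteness is essential when passing to the reals, since
  \<open>enn2real\<close> sends infinity to 0.\<close>

lemma class_M1_lipschitz_hessian:
  assumes "g \<in> class_M1"
  shows "lipschitz_hessian (\<lambda>w. blinfun_apply (frechet1 g w))
    (\<lambda>w x. blinfun_apply (blinfun_apply (frechet2 g w) x)) (enn2real (norm_M1 g)) (enn2real (norm_M1 g))"
proof -
  let ?N = "enn2real (norm_M1 g)"
  have fin: "norm_M1 g < \<infinity>" and diff: "twice_frechet_differentiable g"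
    using assms by (auto simp: class_M1_def class_M_def)
  have "ennreal (linear_form_norm (frechet1 g w)) \<le> norm_M1 g" for w
  proof -
    have "ennreal (linear_form_norm (frechet1 g w)) \<le> (SUP w. ennreal (linear_form_norm (frechet1 g w)))"
      by (rule SUP_upper) simp
    also have "\<dots> \<le> norm_M1 g"
      unfolding norm_M1_def by (intro add_increasing2 add_increasing) auto
    finally show ?thesis .
  qed
  then have 1: "linear_form_norm (frechet1 g w) \<le> ?N" for w
    using fin le_enn2realI by blast
  have "ennreal (bilinear_form_norm (frechet2 g w)) \<le> norm_M1 g" for w
  proof -
    have "ennreal (bilinear_form_norm (frechet2 g w)) \<le> (SUP w. ennreal (bilinear_form_norm (frechet2 g w)))"
      by (rule SUP_upper) simp
    also have "\<dots> \<le> norm_M1 g"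
      unfolding norm_M1_def by (intro add_increasing2 add_increasing) auto
    finally show ?thesis .
  qed
  then have 2: "bilinear_form_norm (frechet2 g w) \<le> ?N" for w
    using fin le_enn2realI by blast
  have "ennreal (bilinear_form_norm (frechet2 g (w + h) - frechet2 g w) / norm h) \<le> norm_M1 g" if "h \<noteq> 0" for w h
  proof -
    have "ennreal (bilinear_form_norm (frechet2 g (w + h) - frechet2 g w) / norm h)
        \<le> (SUP (w, h)\<in>UNIV \<times> - {0}. ennreal (bilinear_form_norm (frechet2 g (w + h) - frechet2 g w) / norm h))"
      using that by (intro SUP_upper2[of "(w, h)"]) auto
    also have "\<dots> \<le> norm_M1 g"
      unfolding norm_M1_def by (intro add_increasing) auto
    finally show ?thesis .
  qed
  then have 3: "bilinear_form_norm (frechet2 g (w + h) - frechet2 g w) / norm h \<le> ?N" if "h \<noteq> 0" for w h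
    using fin le_enn2realI that by blast
  show ?thesis
  proof (rule lipschitz_hessianI[of g])
    fix w x h
    show "(g has_derivative blinfun_apply (frechet1 g w)) (at w)"
      "((\<lambda>w. blinfun_apply (frechet1 g w) x) has_derivative (\<lambda>h. blinfun_apply (blinfun_apply (frechet2 g w) h) x)) (at w)"
      using frechet1_has_derivative frechet2_has_derivative diff by blast+
    show "linear (blinfun_apply (blinfun_apply (frechet2 g w) x))"
      by (intro bounded_linear.linear blinfun.bounded_linear_right)
    show "\<bar>blinfun_apply (frechet1 g w) x\<bar> \<le> ?N * norm x"
      by (rule order_trans[OF linear_form_norm_upper mult_right_mono[OF 1]]) simp
    show "\<bar>blinfun_apply (blinfun_apply (frechet2 g w) x) x\<bar> \<le> ?N * (norm x)\<^sup>2"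
      by (rule order_trans[OF bilinear_form_norm_upper mult_right_mono[OF 2]]) simp
    have "bilinear_form_norm (frechet2 g (w + h) - frechet2 g w) \<le> ?N * norm h" if "h \<noteq> 0"
      using 3[OF that, of w] that by (simp add: divide_le_eq)
    then show "\<bar>blinfun_apply (blinfun_apply (frechet2 g (w + h)) x) x - blinfun_apply (blinfun_apply (frechet2 g w) x) x\<bar>
        \<le> ?N * norm h * (norm x)\<^sup>2"
      using order_trans[OF bilinear_form_norm_upper[of "frechet2 g (w + h) - frechet2 g w" x] mult_right_mono]
      by (cases "h = 0") (auto simp: blinfun.diff_left)
  qed auto
qed

text \<open>The Skorokhod space is not separable in the supremum norm, so sums of random paths are
  awkward as random elements of it. With finitely many fixed directions everything factors through
  the real coefficients: x \<mapsto> G (sum of the x i e i) is continuous on a countable product of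
  lines, whose Borel sets are generated by the coordinates.\<close>

lemma borel_measurable_continuous_sum:
  fixes e :: "'i::countable \<Rightarrow> 'v::real_normed_vector" and G :: "'v \<Rightarrow> real"
  assumes G: "continuous_on UNIV G" and a: "\<And>i. i \<in> I \<Longrightarrow> a i \<in> borel_measurable M"
  shows "(\<lambda>\<omega>. G (\<Sum>i\<in>I. a i \<omega> *\<^sub>R e i)) \<in> borel_measurable M"
proof -
  define b where "b i = (if i \<in> I then a i else (\<lambda>_. 0))" for i
  have "(\<lambda>\<omega> i. b i \<omega>) \<in> M \<rightarrow>\<^sub>M borel"
    by (intro measurable_coordinatewise_then_product) (auto simp: b_def a)
  moreover have "(\<lambda>x. G (\<Sum>i\<in>I. x i *\<^sub>R e i)) \<in> borel_measurable borel"
    by (intro borel_measurable_continuous_onI continuous_on_compose2[OF G] continuous_intros) auto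
  ultimately have "(\<lambda>\<omega>. G (\<Sum>i\<in>I. b i \<omega> *\<^sub>R e i)) \<in> borel_measurable M"
    by (rule measurable_compose)
  also have "(\<lambda>\<omega>. G (\<Sum>i\<in>I. b i \<omega> *\<^sub>R e i)) = (\<lambda>\<omega>. G (\<Sum>i\<in>I. a i \<omega> *\<^sub>R e i))"
    by (simp add: b_def cong: sum.cong)
  finally show ?thesis .
qed

lemma (in prob_space) integral_split:
  fixes X :: "'i \<Rightarrow> 'a \<Rightarrow> real" and u v :: "('i \<Rightarrow> real) \<Rightarrow> real"
  assumes ind: "indep_vars (\<lambda>_. borel) X I" and AB: "A \<inter> B = {}" "A \<subseteq> I" "B \<subseteq> I"
    and u: "u \<in> borel_measurable (Pi\<^sub>M A (\<lambda>_. borel))" and v: "v \<in> borel_measurable (Pi\<^sub>M B (\<lambda>_. borel))"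
    and int: "integrable M (\<lambda>\<omega>. u (\<lambda>i\<in>A. X i \<omega>))" "integrable M (\<lambda>\<omega>. v (\<lambda>i\<in>B. X i \<omega>))"
  shows "(\<integral>\<omega>. u (\<lambda>i\<in>A. X i \<omega>) * v (\<lambda>i\<in>B. X i \<omega>) \<partial>M)
      = (\<integral>\<omega>. u (\<lambda>i\<in>A. X i \<omega>) \<partial>M) * (\<integral>\<omega>. v (\<lambda>i\<in>B. X i \<omega>) \<partial>M)"
    and "integrable M (\<lambda>\<omega>. u (\<lambda>i\<in>A. X i \<omega>) * v (\<lambda>i\<in>B. X i \<omega>))"
proof -
  have "indep_var borel (u \<circ> (\<lambda>\<omega>. \<lambda>i\<in>A. X i \<omega>)) borel (v \<circ> (\<lambda>\<omega>. \<lambda>i\<in>B. X i \<omega>))"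
    by (rule indep_var_compose[OF indep_var_restrict[OF ind AB] u v])
  then show "(\<integral>\<omega>. u (\<lambda>i\<in>A. X i \<omega>) * v (\<lambda>i\<in>B. X i \<omega>) \<partial>M)
      = (\<integral>\<omega>. u (\<lambda>i\<in>A. X i \<omega>) \<partial>M) * (\<integral>\<omega>. v (\<lambda>i\<in>B. X i \<omega>) \<partial>M)"
    "integrable M (\<lambda>\<omega>. u (\<lambda>i\<in>A. X i \<omega>) * v (\<lambda>i\<in>B. X i \<omega>))"
    using indep_var_lebesgue_integral indep_var_integrable int by (auto simp: o_def)
qed

section \<open>Averages over permutations\<close>

abbreviation swap :: "'i \<Rightarrow> 'i \<Rightarrow> 'i \<Rightarrow> 'i" where
  "swap \<equiv> Transposition.transpose"

text \<open>A uniform permutation is averaged as a finite sum, so that exchangeability becomes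
  invariance of this sum under composition with a transposition.\<close>

definition perm_mean :: "'i set \<Rightarrow> (('i \<Rightarrow> 'i) \<Rightarrow> real) \<Rightarrow> real" where
  "perm_mean S f = (\<Sum>p | p permutes S. f p) / fact (card S)"

lemma perm_mean_add: "perm_mean S (\<lambda>p. f p + g p) = perm_mean S f + perm_mean S g"
  by (simp add: perm_mean_def sum.distrib add_divide_distrib)

lemma perm_mean_diff: "perm_mean S (\<lambda>p. f p - g p) = perm_mean S f - perm_mean S g"
  by (simp add: perm_mean_def sum_subtractf diff_divide_distrib)

lemma perm_mean_minus: "perm_mean S (\<lambda>p. - f p) = - perm_mean S f"
  by (simp add: perm_mean_def sum_negf)

lemma perm_mean_sum: "perm_mean S (\<lambda>p. \<Sum>i\<in>I. f i p) = (\<Sum>i\<in>I. perm_mean S (f i))"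
  by (simp add: perm_mean_def sum.swap[of _ I] sum_divide_distrib)

lemma perm_mean_cmult: "perm_mean S (\<lambda>p. c * f p) = c * perm_mean S f"
  by (simp add: perm_mean_def sum_distrib_left)

lemma perm_mean_const: "finite S \<Longrightarrow> perm_mean S (\<lambda>_. c) = c"
  by (simp add: perm_mean_def card_permutations)

lemma perm_mean_cong: "(\<And>p. p permutes S \<Longrightarrow> f p = g p) \<Longrightarrow> perm_mean S f = perm_mean S g"
  by (simp add: perm_mean_def)

lemma perm_mean_mono: "(\<And>p. p permutes S \<Longrightarrow> f p \<le> g p) \<Longrightarrow> perm_mean S f \<le> perm_mean S g"
  unfolding perm_mean_def by (intro divide_right_mono sum_mono) auto

lemma perm_mean_abs_le: "(\<And>p. p permutes S \<Longrightarrow> \<bar>f p\<bar> \<le> g p) \<Longrightarrow> \<bar>perm_mean S f\<bar> \<le> perm_mean S g"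
  unfolding abs_le_iff perm_mean_minus[symmetric] by (auto intro!: perm_mean_mono)

lemma perm_mean_transpose:
  assumes "i \<in> S" "j \<in> S"
  shows "perm_mean S f = perm_mean S (\<lambda>p. f (p \<circ> swap i j))"
  unfolding perm_mean_def
  by (subst sum_permutations_compose_right[OF permutes_swap_id[OF assms]]) (rule refl)

text \<open>The transpositions (j j') leave \<open>\<Phi> p\<close> fixed, so p j and p j' can be
  exchanged without changing the mean: seen from what \<open>\<Phi> p\<close> depends on, p j is
  uniform over the values of p on \<open>U\<close>. This takes the place of conditioning on part of
  the permutation.\<close>

lemma card_mult_perm_mean:
  assumes "finite S" "U \<subseteq> S" "j \<in> U"
    and inv: "\<And>p j' l. p permutes S \<Longrightarrow> j' \<in> U \<Longrightarrow> \<Phi> (p \<circ> swap j j') l = \<Phi> p l"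
  shows "real (card U) * perm_mean S (\<lambda>p. \<Phi> p (p j)) = perm_mean S (\<lambda>p. \<Sum>j'\<in>U. \<Phi> p (p j'))"
proof -
  have "perm_mean S (\<lambda>p. \<Phi> p (p j)) = perm_mean S (\<lambda>p. \<Phi> p (p j'))" if "j' \<in> U" for j'
    by (subst perm_mean_transpose[of j S j']) (use assms that in \<open>auto intro!: perm_mean_cong\<close>)
  then have "(\<Sum>j'\<in>U. perm_mean S (\<lambda>p. \<Phi> p (p j))) = (\<Sum>j'\<in>U. perm_mean S (\<lambda>p. \<Phi> p (p j')))"
    by (intro sum.cong) auto
  then show ?thesis by (simp add: perm_mean_sum)
qed

lemma sum_permutes: "p permutes S \<Longrightarrow> (\<Sum>i\<in>S. f (p i)) = (\<Sum>i\<in>S. f i)"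
  using sum.permute[of p S f] by (simp add: o_def)

lemma perm_mean_point:
  assumes "finite S" "i \<in> S"
  shows "perm_mean S (\<lambda>p. \<phi> (p i)) = (\<Sum>k\<in>S. \<phi> k) / card S"
proof -
  have "real (card S) * perm_mean S (\<lambda>p. \<phi> (p i)) = perm_mean S (\<lambda>p. \<Sum>i\<in>S. \<phi> (p i))"
    using assms by (intro card_mult_perm_mean[of S S i "\<lambda>_. \<phi>"]) auto
  also have "\<dots> = (\<Sum>k\<in>S. \<phi> k)"
    using assms by (simp add: sum_permutes perm_mean_const cong: perm_mean_cong)
  finally have "real (card S) * perm_mean S (\<lambda>p. \<phi> (p i)) = sum \<phi> S" .
  moreover have "card S > 0" using assms by (auto simp: card_gt_0_iff)
  ultimately show ?thesis by (simp add: field_simps)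
qed

text \<open>The sum over \<open>U\<close> misses the values that p takes outside \<open>U\<close>.
  Since \<open>\<Phi>\<close> is nonnegative they may be added, which removes every restriction on
  the index l.\<close>

lemma perm_mean_step_le:
  assumes "finite S" "U \<subseteq> S" "j \<in> U"
    and inv: "\<And>p j' l. p permutes S \<Longrightarrow> j' \<in> U \<Longrightarrow> \<Phi> (p \<circ> swap j j') l = \<Phi> p l"
    and nonneg: "\<And>p l. \<Phi> p l \<ge> 0"
  shows "perm_mean S (\<lambda>p. \<Phi> p (p j)) \<le> perm_mean S (\<lambda>p. \<Sum>l\<in>S. \<Phi> p l) / card U"
proof -
  have "card U > 0" using assms(1-3) finite_subset by (auto simp: card_gt_0_iff)
  moreover have "perm_mean S (\<lambda>p. \<Sum>j'\<in>U. \<Phi> p (p j')) \<le> perm_mean S (\<lambda>p. \<Sum>l\<in>S. \<Phi> p l)"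
  proof (rule perm_mean_mono)
    fix p assume p: "p permutes S"
    have "(\<Sum>j'\<in>U. \<Phi> p (p j')) \<le> (\<Sum>j'\<in>S. \<Phi> p (p j'))"
      using assms by (intro sum_mono2) auto
    then show "(\<Sum>j'\<in>U. \<Phi> p (p j')) \<le> (\<Sum>l\<in>S. \<Phi> p l)" by (simp add: sum_permutes[OF p])
  qed
  ultimately show ?thesis
    using card_mult_perm_mean[OF assms(1-3), of \<Phi>] inv by (simp add: field_simps)
qed

text \<open>In the exact mean k and l are distinct. Freezing p i and exchanging j with the points
  other than i gives the factor 1 / (n - 1), n being the cardinality of \<open>S\<close>; the
  diagonal k = l is added for free.\<close>

lemma perm_mean_two_le:
  fixes \<phi> :: "'i \<Rightarrow> 'i \<Rightarrow> real"
  assumes "finite S" "i \<in> S" "j \<in> S" "i \<noteq> j" and nonneg: "\<And>k l. \<phi> k l \<ge> 0"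
  shows "perm_mean S (\<lambda>p. \<phi> (p i) (p j)) \<le> (\<Sum>k\<in>S. \<Sum>l\<in>S. \<phi> k l) / (real (card S) * (real (card S) - 1))"
proof -
  have "card S \<ge> 1" using assms by (metis One_nat_def Suc_leI card_gt_0_iff empty_iff)
  then have c: "real (card (S - {i})) = real (card S) - 1" using assms by simp
  have "perm_mean S (\<lambda>p. \<phi> (p i) (p j)) \<le> perm_mean S (\<lambda>p. \<Sum>l\<in>S. \<phi> (p i) l) / card (S - {i})"
    by (rule perm_mean_step_le[of S "S - {i}" j "\<lambda>p. \<phi> (p i)"]) (use assms in \<open>auto simp: transpose_apply_other\<close>)
  also have "\<dots> = (\<Sum>k\<in>S. \<Sum>l\<in>S. \<phi> k l) / (real (card S) * (real (card S) - 1))"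
    unfolding c using assms by (subst perm_mean_point) auto
  finally show ?thesis .
qed

lemma perm_mean_three_le:
  fixes \<phi> :: "'i \<Rightarrow> 'i \<Rightarrow> 'i \<Rightarrow> real"
  assumes "finite S" "i \<in> S" "j \<in> S" "r \<in> S" "i \<noteq> j" "r \<noteq> i" "r \<noteq> j" and nonneg: "\<And>k l m. \<phi> k l m \<ge> 0"
  shows "perm_mean S (\<lambda>p. \<phi> (p i) (p j) (p r))
    \<le> (\<Sum>k\<in>S. \<Sum>l\<in>S. \<Sum>m\<in>S. \<phi> k l m) / (real (card S) * (real (card S) - 1) * (real (card S) - 2))"
proof -
  have "card S \<ge> card {i, j, r}" using assms by (intro card_mono) auto
  then have c: "card S \<ge> 3" using assms by auto
  then have c': "real (card (S - {i, j})) = real (card S) - 2" using assms by (simp add: card_Diff_subset)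
  have "perm_mean S (\<lambda>p. \<phi> (p i) (p j) (p r)) \<le> perm_mean S (\<lambda>p. \<Sum>m\<in>S. \<phi> (p i) (p j) m) / card (S - {i, j})"
    by (rule perm_mean_step_le[of S "S - {i, j}" r "\<lambda>p. \<phi> (p i) (p j)"]) (use assms in \<open>auto simp: transpose_apply_other\<close>)
  also have "\<dots> \<le> ((\<Sum>k\<in>S. \<Sum>l\<in>S. \<Sum>m\<in>S. \<phi> k l m) / (real (card S) * (real (card S) - 1))) / card (S - {i, j})"
    using assms by (intro divide_right_mono perm_mean_two_le sum_nonneg) auto
  finally show ?thesis unfolding c' by (simp add: mult_ac)
qed

text \<open>Decoupling of two rows from the remaining ones. The factor \<open>c j (p i)\<close> is averaged over the values of
  \<open>p\<close> by composing \<open>p\<close> with transpositions \<open>(i r)\<close>, which produces \<open>- c j (p j)\<close> since row \<open>j\<close> sums to \<open>0\<close>;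
  then \<open>c i (p j) * c j (p j)\<close> is averaged with transpositions \<open>(j r)\<close>.\<close>

lemma perm_mean_decouple:
  fixes c \<eta> :: "'i \<Rightarrow> 'i \<Rightarrow> real" and T :: "('i \<Rightarrow> 'i) \<Rightarrow> real"
  assumes S: "finite S" "i \<in> S" "j \<in> S" "i \<noteq> j" and row: "(\<Sum>l\<in>S. c j l) = 0"
    and T_inv: "\<And>p. p permutes S \<Longrightarrow> T (p \<circ> swap i j) = T p"
    and T_i: "\<And>p r. p permutes S \<Longrightarrow> r \<in> S - {i, j} \<Longrightarrow> \<bar>T (p \<circ> swap i r) - T p\<bar> \<le> b * (\<eta> r (p r) + \<eta> r (p i))"
    and T_j: "\<And>p r. p permutes S \<Longrightarrow> r \<in> S - {i, j} \<Longrightarrow> \<bar>T (p \<circ> swap j r) - T p\<bar> \<le> b * (\<eta> r (p r) + \<eta> r (p j))"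
  shows "\<bar>perm_mean S (\<lambda>p. c i (p j) * (c j (p i) - c j (p j)) * T p)
        + (\<Sum>k\<in>S. c i k * c j k) / (real (card S) - 1) * perm_mean S T\<bar>
      \<le> b / (real (card S) - 1) *
        ((\<Sum>r\<in>S - {i, j}. perm_mean S (\<lambda>p. \<bar>c i (p j)\<bar> * \<bar>c j (p r)\<bar> * (\<eta> r (p r) + \<eta> r (p i))))
       + (\<Sum>r\<in>S - {i, j}. perm_mean S (\<lambda>p. \<bar>c i (p r)\<bar> * \<bar>c j (p r)\<bar> * (\<eta> r (p r) + \<eta> r (p j)))))"
proof -
  define n where "n = real (card S)"
  have "card S \<ge> card {i, j}" using S by (intro card_mono) auto
  then have n: "n \<ge> 2" using S by (simp add: n_def)
  define A where "A = perm_mean S (\<lambda>p. c i (p j) * c j (p i) * T p)"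
  define V where "V = perm_mean S (\<lambda>p. c i (p j) * c j (p j) * T p)"
  define E1 where "E1 = (\<Sum>r\<in>S - {i, j}. perm_mean S (\<lambda>p. c i (p j) * c j (p r) * (T (p \<circ> swap i r) - T p)))"
  define E2 where "E2 = (\<Sum>r\<in>S - {i, j}. perm_mean S (\<lambda>p. c i (p r) * c j (p r) * (T (p \<circ> swap j r) - T p)))"
  have "(n - 1) * A = (\<Sum>r\<in>S - {j}. A)"
    using S n by (simp add: n_def of_nat_diff)
  also have "\<dots> = (\<Sum>r\<in>S - {j}. perm_mean S (\<lambda>p. c i (p j) * c j (p r) * T (p \<circ> swap i r)))"
  proof (rule sum.cong)
    fix r assume "r \<in> S - {j}"
    then show "A = perm_mean S (\<lambda>p. c i (p j) * c j (p r) * T (p \<circ> swap i r))"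
      unfolding A_def using S by (subst perm_mean_transpose[of i S r]) (auto simp: transpose_apply_other)
  qed simp
  also have "\<dots> = (\<Sum>r\<in>S - {j}. perm_mean S (\<lambda>p. c i (p j) * c j (p r) * T p))
      + (\<Sum>r\<in>S - {j}. perm_mean S (\<lambda>p. c i (p j) * c j (p r) * (T (p \<circ> swap i r) - T p)))"
    by (simp add: perm_mean_diff right_diff_distrib sum_subtractf)
  also have "(\<Sum>r\<in>S - {j}. perm_mean S (\<lambda>p. c i (p j) * c j (p r) * (T (p \<circ> swap i r) - T p))) = E1"
    unfolding E1_def using S by (intro sum.mono_neutral_right) (auto simp: perm_mean_const)
  also have "(\<Sum>r\<in>S - {j}. perm_mean S (\<lambda>p. c i (p j) * c j (p r) * T p)) = - V"
  proof -
    have "(\<Sum>r\<in>S - {j}. c j (p r)) = - c j (p j)" if "p permutes S" for p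
      using sum_permutes[OF that, of "c j"] row S by (simp add: sum_diff1)
    then have "perm_mean S (\<lambda>p. c i (p j) * (\<Sum>r\<in>S - {j}. c j (p r)) * T p) = perm_mean S (\<lambda>p. c i (p j) * - c j (p j) * T p)"
      by (intro perm_mean_cong) simp
    then show ?thesis
      by (simp add: V_def perm_mean_minus perm_mean_sum sum_distrib_left sum_distrib_right)
  qed
  finally have A: "(n - 1) * A = - V + E1" .
  have "n * V = (\<Sum>r\<in>S. V)" by (simp add: n_def)
  also have "\<dots> = (\<Sum>r\<in>S. perm_mean S (\<lambda>p. c i (p r) * c j (p r) * T (p \<circ> swap j r)))"
  proof (rule sum.cong)
    fix r assume "r \<in> S"
    then show "V = perm_mean S (\<lambda>p. c i (p r) * c j (p r) * T (p \<circ> swap j r))"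
      unfolding V_def using S by (subst perm_mean_transpose[of j S r]) auto
  qed simp
  also have "\<dots> = (\<Sum>r\<in>S. perm_mean S (\<lambda>p. c i (p r) * c j (p r) * T p))
      + (\<Sum>r\<in>S. perm_mean S (\<lambda>p. c i (p r) * c j (p r) * (T (p \<circ> swap j r) - T p)))"
    by (simp add: perm_mean_diff right_diff_distrib sum_subtractf)
  also have "(\<Sum>r\<in>S. perm_mean S (\<lambda>p. c i (p r) * c j (p r) * (T (p \<circ> swap j r) - T p))) = E2"
  proof -
    have "perm_mean S (\<lambda>p. c i (p r) * c j (p r) * (T (p \<circ> swap j r) - T p)) = 0" if "r \<in> {i, j}" for r
    proof -
      have "T (p \<circ> swap j r) - T p = 0" if "p permutes S" for p
        using \<open>r \<in> {i, j}\<close> T_inv[OF that] by (auto simp: transpose_commute[of j i])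
      then have "perm_mean S (\<lambda>p. c i (p r) * c j (p r) * (T (p \<circ> swap j r) - T p)) = perm_mean S (\<lambda>p. 0)"
        by (intro perm_mean_cong) simp
      then show ?thesis using S by (simp add: perm_mean_const)
    qed
    then show ?thesis
      unfolding E2_def using S by (intro sum.mono_neutral_right) auto
  qed
  also have "(\<Sum>r\<in>S. perm_mean S (\<lambda>p. c i (p r) * c j (p r) * T p)) = (\<Sum>k\<in>S. c i k * c j k) * perm_mean S T"
  proof -
    have "perm_mean S (\<lambda>p. (\<Sum>r\<in>S. c i (p r) * c j (p r)) * T p) = perm_mean S (\<lambda>p. (\<Sum>k\<in>S. c i k * c j k) * T p)"
      by (intro perm_mean_cong) (simp add: sum_permutes[of _ S "\<lambda>k. c i k * c j k"])
    then show ?thesis by (simp add: perm_mean_cmult perm_mean_sum sum_distrib_right)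
  qed
  finally have V: "n * V = (\<Sum>k\<in>S. c i k * c j k) * perm_mean S T + E2" .
  have "perm_mean S (\<lambda>p. c i (p j) * (c j (p i) - c j (p j)) * T p) = A - V"
    unfolding A_def V_def by (simp add: perm_mean_diff algebra_simps)
  \<comment> \<open>Eliminating \<open>A\<close> turns A - V into (E1 - n V) / (n - 1), and n V is
    exactly what the second averaging computes. Both error sums therefore carry the same factor 1 /
    (n - 1).\<close>
  moreover have "(A - V) + (\<Sum>k\<in>S. c i k * c j k) / (n - 1) * perm_mean S T = (E1 - E2) / (n - 1)"
    using A V n by (simp add: field_simps)
  ultimately have "perm_mean S (\<lambda>p. c i (p j) * (c j (p i) - c j (p j)) * T p)
      + (\<Sum>k\<in>S. c i k * c j k) / (n - 1) * perm_mean S T = (E1 - E2) / (n - 1)" by simp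
  moreover have "\<bar>E1\<bar> \<le> b * (\<Sum>r\<in>S - {i, j}. perm_mean S (\<lambda>p. \<bar>c i (p j)\<bar> * \<bar>c j (p r)\<bar> * (\<eta> r (p r) + \<eta> r (p i))))"
    (is "_ \<le> b * ?P1")
    unfolding E1_def sum_distrib_left perm_mean_cmult[symmetric]
    by (intro order_trans[OF sum_abs] sum_mono perm_mean_abs_le)
      (use T_i in \<open>auto simp: abs_mult mult.left_commute[of b] intro!: mult_left_mono\<close>)
  moreover have "\<bar>E2\<bar> \<le> b * (\<Sum>r\<in>S - {i, j}. perm_mean S (\<lambda>p. \<bar>c i (p r)\<bar> * \<bar>c j (p r)\<bar> * (\<eta> r (p r) + \<eta> r (p j))))"
    (is "_ \<le> b * ?P2")
    unfolding E2_def sum_distrib_left perm_mean_cmult[symmetric]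
    by (intro order_trans[OF sum_abs] sum_mono perm_mean_abs_le)
      (use T_j in \<open>auto simp: abs_mult mult.left_commute[of b] intro!: mult_left_mono\<close>)
  ultimately have "\<bar>E1 - E2\<bar> \<le> b * (?P1 + ?P2)"
    and eq: "perm_mean S (\<lambda>p. c i (p j) * (c j (p i) - c j (p j)) * T p)
      + (\<Sum>k\<in>S. c i k * c j k) / (n - 1) * perm_mean S T = (E1 - E2) / (n - 1)"
    by (auto simp: distrib_left)
  then have "\<bar>(E1 - E2) / (n - 1)\<bar> \<le> b * (?P1 + ?P2) / (n - 1)"
    using n by (simp add: abs_divide divide_right_mono)
  then show ?thesis
    unfolding n_def[symmetric] eq by simp
qed

section \<open>Expansion of the permuted sum\<close>

lemma (in lipschitz_hessian) diagonal_expansion: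
  assumes x: "norm x \<le> \<epsilon>"
  shows "\<bar>a * (F1 (w + a *\<^sub>R x) x - F1 w x) - a\<^sup>2 * F2 w x x\<bar> \<le> L * \<epsilon> ^ 3 * (\<bar>a\<bar> ^ 3 / 2)"
proof -
  have "\<epsilon> \<ge> 0" using x norm_ge_zero order_trans by blast
  have "\<bar>F1 (w + a *\<^sub>R x) x - F1 w x - F2 w x (a *\<^sub>R x)\<bar> \<le> L / 2 * (norm (a *\<^sub>R x))\<^sup>2 * norm x"
    by (rule F1_taylor)
  also have "\<dots> = L / 2 * a\<^sup>2 * norm x ^ 3"
    by (simp add: power_mult_distrib power2_eq_square power3_eq_cube)
  also have "\<dots> \<le> L / 2 * a\<^sup>2 * \<epsilon> ^ 3"
    using x L_nonneg by (intro mult_left_mono power_mono) auto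
  finally have "\<bar>a\<bar> * \<bar>F1 (w + a *\<^sub>R x) x - F1 w x - F2 w x (a *\<^sub>R x)\<bar> \<le> \<bar>a\<bar> * (L / 2 * a\<^sup>2 * \<epsilon> ^ 3)"
    by (rule mult_left_mono) simp
  also have "\<bar>a\<bar> * \<bar>F1 (w + a *\<^sub>R x) x - F1 w x - F2 w x (a *\<^sub>R x)\<bar>
      = \<bar>a * (F1 (w + a *\<^sub>R x) x - F1 w x) - a\<^sup>2 * F2 w x x\<bar>"
    by (simp add: abs_mult[symmetric] linear_scale[OF F2_linear] algebra_simps power2_eq_square)
  finally show ?thesis by (simp add: power3_eq_cube power2_eq_square abs_mult_self_eq mult_ac)
qed

text \<open>In the application w omits rows i and j, the numbers a and b are the entries of these
  rows after the exchange, and c is the old entry of row j. The square term is taken at w + c y, the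
  sum without row i, because this point is the same for all j, so that the squares of row i can
  later be collected over j; moving it there costs the last summand. The mixed term stays at w,
  which is independent of both rows.\<close>

lemma (in lipschitz_hessian) off_diagonal_expansion:
  assumes x: "norm x \<le> \<epsilon>" and y: "norm y \<le> \<epsilon>"
  shows "\<bar>a * (F1 (w + a *\<^sub>R x + b *\<^sub>R y) x - F1 (w + c *\<^sub>R y) x)
        - (a\<^sup>2 * F2 (w + c *\<^sub>R y) x x + a * (b - c) * F2 w x y)\<bar>
      \<le> L * \<epsilon> ^ 3 * (\<bar>a\<bar> ^ 3 / 2 + a\<^sup>2 * \<bar>b\<bar> + \<bar>a\<bar> * b\<^sup>2 / 2 + \<bar>a\<bar> * c\<^sup>2 / 2 + a\<^sup>2 * \<bar>c\<bar>)"
proof -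
  have \<epsilon>: "\<epsilon> \<ge> 0" using x norm_ge_zero order_trans by blast
  have *: "\<bar>F1 (w + h) x - F1 w x - F2 w x h\<bar> \<le> L * \<epsilon> ^ 3 * (s\<^sup>2 / 2)" if "norm h \<le> s * \<epsilon>" for h s
  proof -
    have "\<bar>F1 (w + h) x - F1 w x - F2 w x h\<bar> \<le> L / 2 * (norm h)\<^sup>2 * norm x"
      by (rule F1_taylor)
    also have "\<dots> \<le> L / 2 * (s * \<epsilon>)\<^sup>2 * \<epsilon>"
      using that x L_nonneg by (intro mult_mono mult_left_mono power_mono) auto
    finally show ?thesis by (simp add: power2_eq_square power3_eq_cube mult_ac)
  qed
  have "norm (a *\<^sub>R x + b *\<^sub>R y) \<le> \<bar>a\<bar> * norm x + \<bar>b\<bar> * norm y"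
    using norm_triangle_ineq[of "a *\<^sub>R x" "b *\<^sub>R y"] by simp
  also have "\<dots> \<le> (\<bar>a\<bar> + \<bar>b\<bar>) * \<epsilon>"
    unfolding distrib_right using x y by (intro add_mono mult_left_mono) auto
  finally have 1: "\<bar>F1 (w + (a *\<^sub>R x + b *\<^sub>R y)) x - F1 w x - F2 w x (a *\<^sub>R x + b *\<^sub>R y)\<bar> \<le> L * \<epsilon> ^ 3 * ((\<bar>a\<bar> + \<bar>b\<bar>)\<^sup>2 / 2)"
    by (rule *)
  have 2: "\<bar>F1 (w + c *\<^sub>R y) x - F1 w x - F2 w x (c *\<^sub>R y)\<bar> \<le> L * \<epsilon> ^ 3 * (\<bar>c\<bar>\<^sup>2 / 2)"
    using y by (intro *) (simp add: mult_left_mono)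
  have "\<bar>F2 (w + c *\<^sub>R y) x x - F2 w x x\<bar> \<le> L * norm (c *\<^sub>R y) * (norm x)\<^sup>2"
    by (rule F2_diag_lipschitz)
  also have "\<dots> \<le> L * (\<bar>c\<bar> * \<epsilon>) * \<epsilon>\<^sup>2"
    using x y \<epsilon> L_nonneg by (intro mult_mono power_mono) (auto intro: mult_left_mono)
  finally have 3: "\<bar>F2 (w + c *\<^sub>R y) x x - F2 w x x\<bar> \<le> L * \<epsilon> ^ 3 * \<bar>c\<bar>"
    by (simp add: power2_eq_square power3_eq_cube mult_ac)
  define u where "u = F1 (w + (a *\<^sub>R x + b *\<^sub>R y)) x - F1 w x - F2 w x (a *\<^sub>R x + b *\<^sub>R y)"
  define v where "v = F1 (w + c *\<^sub>R y) x - F1 w x - F2 w x (c *\<^sub>R y)"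
  define z where "z = F2 (w + c *\<^sub>R y) x x - F2 w x x"
  have "a * (F1 (w + a *\<^sub>R x + b *\<^sub>R y) x - F1 (w + c *\<^sub>R y) x)
        - (a\<^sup>2 * F2 (w + c *\<^sub>R y) x x + a * (b - c) * F2 w x y) = a * u - a * v - a\<^sup>2 * z"
    by (simp add: u_def v_def z_def linear_add[OF F2_linear] linear_scale[OF F2_linear] algebra_simps power2_eq_square)
  also have "\<bar>\<dots>\<bar> \<le> \<bar>a\<bar> * \<bar>u\<bar> + \<bar>a\<bar> * \<bar>v\<bar> + a\<^sup>2 * \<bar>z\<bar>"
  proof -
    have "\<bar>a * u - a * v - a\<^sup>2 * z\<bar> \<le> \<bar>a * u\<bar> + \<bar>a * v\<bar> + \<bar>a\<^sup>2 * z\<bar>" by linarith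
    then show ?thesis by (simp add: abs_mult)
  qed
  also have "\<dots> \<le> \<bar>a\<bar> * (L * \<epsilon> ^ 3 * ((\<bar>a\<bar> + \<bar>b\<bar>)\<^sup>2 / 2)) + \<bar>a\<bar> * (L * \<epsilon> ^ 3 * (\<bar>c\<bar>\<^sup>2 / 2)) + a\<^sup>2 * (L * \<epsilon> ^ 3 * \<bar>c\<bar>)"
    using 1 2 3 unfolding u_def v_def z_def by (intro add_mono mult_left_mono) auto
  also have "\<dots> = L * \<epsilon> ^ 3 * (\<bar>a\<bar> * (\<bar>a\<bar> + \<bar>b\<bar>)\<^sup>2 / 2 + \<bar>a\<bar> * c\<^sup>2 / 2 + a\<^sup>2 * \<bar>c\<bar>)"
    by (simp add: algebra_simps)
  also have "\<bar>a\<bar> * (\<bar>a\<bar> + \<bar>b\<bar>)\<^sup>2 / 2 = \<bar>a\<bar> ^ 3 / 2 + \<bar>a\<bar>\<^sup>2 * \<bar>b\<bar> + \<bar>a\<bar> * \<bar>b\<bar>\<^sup>2 / 2"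
    by (simp only: power2_eq_square power3_eq_cube) (simp add: field_simps)
  finally show ?thesis by simp
qed

section \<open>Independent arrays and their moments\<close>

locale random_array = prob_space +
  fixes X :: "nat \<Rightarrow> nat \<Rightarrow> 'a \<Rightarrow> real" and S :: "nat set"
  assumes finite_S: "finite S" and card_S: "card S \<ge> 2"
    and X_indep: "indep_vars (\<lambda>_. borel) (\<lambda>(i, j). X i j) (S \<times> S)"
    and X_third_moment: "\<And>i j. i \<in> S \<Longrightarrow> j \<in> S \<Longrightarrow> integrable M (\<lambda>\<omega>. \<bar>X i j \<omega>\<bar> ^ 3)"
begin

definition "mean i k = (\<integral>\<omega>. X i k \<omega> \<partial>M)"
definition "moment r i k = (\<integral>\<omega>. \<bar>X i k \<omega>\<bar> ^ r \<partial>M)"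

lemma moment_nonneg: "moment r i k \<ge> 0"
  unfolding moment_def by (intro Bochner_Integration.integral_nonneg) auto

lemma abs_mean_le: "\<bar>mean i k\<bar> \<le> moment 1 i k"
  unfolding mean_def moment_def by (simp add: integral_abs_bound)

lemma X_measurable: "i \<in> S \<Longrightarrow> k \<in> S \<Longrightarrow> X i k \<in> borel_measurable M"
proof -
  assume ik: "i \<in> S" "k \<in> S"
  have "\<forall>q\<in>S \<times> S. (case q of (i, k) \<Rightarrow> X i k) \<in> borel_measurable M"
    using X_indep unfolding indep_vars_def by (rule conjunct1)
  from bspec[OF this, of "(i, k)"] ik show ?thesis by simp
qed

lemma abs_power_le:
  fixes x :: real
  assumes "r \<le> 3"
  shows "\<bar>x\<bar> ^ r \<le> 1 + \<bar>x\<bar> ^ 3"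
proof (cases "\<bar>x\<bar> \<le> 1")
  case True
  then show ?thesis using power_le_one[of "\<bar>x\<bar>" r] by (simp add: add_increasing2)
next
  case False
  then show ?thesis using power_increasing[OF assms, of "\<bar>x\<bar>"] by linarith
qed

lemma integrable_moment: 
  assumes "i \<in> S" "k \<in> S" "r \<le> 3"
  shows "integrable M (\<lambda>\<omega>. \<bar>X i k \<omega>\<bar> ^ r)"
proof (rule Bochner_Integration.integrable_bound)
  show "integrable M (\<lambda>\<omega>. 1 + \<bar>X i k \<omega>\<bar> ^ 3)"
    by (intro Bochner_Integration.integrable_add X_third_moment assms integrable_const)
  show "(\<lambda>\<omega>. \<bar>X i k \<omega>\<bar> ^ r) \<in> borel_measurable M"
    by (intro borel_measurable_power borel_measurable_abs X_measurable assms)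
  show "AE \<omega> in M. norm (\<bar>X i k \<omega>\<bar> ^ r) \<le> norm (1 + \<bar>X i k \<omega>\<bar> ^ 3)"
    using abs_power_le[OF assms(3)] by (intro AE_I2) (simp add: abs_of_nonneg)
qed

lemma integrable_X: 
  assumes "i \<in> S" "k \<in> S"
  shows "integrable M (X i k)"
proof (rule integrable_abs_cancel)
  show "integrable M (\<lambda>\<omega>. \<bar>X i k \<omega>\<bar>)" using integrable_moment[OF assms, of 1] by simp
qed (rule X_measurable[OF assms])

lemma split_rows:
  fixes u v :: "(nat \<times> nat \<Rightarrow> real) \<Rightarrow> real" and U V :: "'a \<Rightarrow> real"
  assumes AB: "A \<inter> B = {}" "A \<subseteq> S \<times> S" "B \<subseteq> S \<times> S"
    and u: "u \<in> borel_measurable (Pi\<^sub>M A (\<lambda>_. borel))" and v: "v \<in> borel_measurable (Pi\<^sub>M B (\<lambda>_. borel))"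
    and U: "\<And>\<omega>. U \<omega> = u (\<lambda>(i, k)\<in>A. X i k \<omega>)" and V: "\<And>\<omega>. V \<omega> = v (\<lambda>(i, k)\<in>B. X i k \<omega>)"
    and int: "integrable M U" "integrable M V"
  shows "(\<integral>\<omega>. U \<omega> * V \<omega> \<partial>M) = (\<integral>\<omega>. U \<omega> \<partial>M) * (\<integral>\<omega>. V \<omega> \<partial>M)" (is ?A)
    and "integrable M (\<lambda>\<omega>. U \<omega> * V \<omega>)" (is ?B)
proof -
  have eq: "(\<lambda>(i, k)\<in>C. X i k \<omega>) = (\<lambda>q\<in>C. (case q of (i, k) \<Rightarrow> X i k) \<omega>)" for C \<omega>
    by (auto simp: fun_eq_iff restrict_def)
  have "U = (\<lambda>\<omega>. u (\<lambda>q\<in>A. (case q of (i, k) \<Rightarrow> X i k) \<omega>))"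
    by (rule ext) (rule U[unfolded eq])
  moreover have "V = (\<lambda>\<omega>. v (\<lambda>q\<in>B. (case q of (i, k) \<Rightarrow> X i k) \<omega>))"
    by (rule ext) (rule V[unfolded eq])
  ultimately show ?A ?B
    using integral_split[OF X_indep AB u v] int by auto
qed

lemma moment_mult:
  assumes "i \<in> S" "k \<in> S" "j \<in> S" "l \<in> S" "(i, k) \<noteq> (j, l)" "q \<le> 3" "r \<le> 3"
  shows "(\<integral>\<omega>. \<bar>X i k \<omega>\<bar> ^ q * \<bar>X j l \<omega>\<bar> ^ r \<partial>M) = moment q i k * moment r j l" (is ?A)
    and "integrable M (\<lambda>\<omega>. \<bar>X i k \<omega>\<bar> ^ q * \<bar>X j l \<omega>\<bar> ^ r)" (is ?B)
proof -
  have "(\<lambda>x. \<bar>x (i, k)\<bar> ^ q :: real) \<in> borel_measurable (Pi\<^sub>M {(i, k)} (\<lambda>_. borel))"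
    "(\<lambda>x. \<bar>x (j, l)\<bar> ^ r :: real) \<in> borel_measurable (Pi\<^sub>M {(j, l)} (\<lambda>_. borel))"
    by (auto intro!: borel_measurable_power borel_measurable_abs measurable_component_singleton)
  note * = split_rows[OF _ _ _ this, of "\<lambda>\<omega>. \<bar>X i k \<omega>\<bar> ^ q" "\<lambda>\<omega>. \<bar>X j l \<omega>\<bar> ^ r"]
  show ?A ?B
    using assms * by (auto simp: moment_def integrable_moment)
qed

lemma mean_mult:
  assumes "i \<in> S" "k \<in> S" "j \<in> S" "l \<in> S" "(i, k) \<noteq> (j, l)"
  shows "(\<integral>\<omega>. X i k \<omega> * X j l \<omega> \<partial>M) = mean i k * mean j l" (is ?A)
    and "integrable M (\<lambda>\<omega>. X i k \<omega> * X j l \<omega>)" (is ?B)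
proof -
  have "(\<lambda>x. x (i, k) :: real) \<in> borel_measurable (Pi\<^sub>M {(i, k)} (\<lambda>_. borel))"
    "(\<lambda>x. x (j, l) :: real) \<in> borel_measurable (Pi\<^sub>M {(j, l)} (\<lambda>_. borel))"
    by (auto intro!: measurable_component_singleton)
  note * = split_rows[OF _ _ _ this, of "X i k" "X j l"]
  show ?A ?B
    using assms * by (auto simp: mean_def integrable_X)
qed

end

text \<open>The directions \<open>e i\<close> will be unit step paths divided by s, and \<epsilon>
  will be 1 / s. Every third-order remainder then carries \<epsilon>^3, the source of s^3 in the
  denominator of the bound.\<close>

locale array_expansion = random_array M X S + lipschitz_hessian F1 F2 K L
  for M :: "'a measure" and X S and F1 :: "'v::real_normed_vector \<Rightarrow> 'v \<Rightarrow> real" and F2 K L +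
  fixes e :: "nat \<Rightarrow> 'v" and \<epsilon> :: real
  assumes e_norm: "\<And>i. norm (e i) \<le> \<epsilon>"
begin

lemma \<epsilon>_nonneg: "\<epsilon> \<ge> 0"
  using e_norm norm_ge_zero order_trans by blast

lemma F2_e_bound: "\<bar>F2 w (e i) (e j)\<bar> \<le> 2 * K * \<epsilon>\<^sup>2"
proof -
  have "2 * K * norm (e i) * norm (e j) \<le> 2 * K * \<epsilon> * \<epsilon>"
    using e_norm K_nonneg \<epsilon>_nonneg by (intro mult_mono) auto
  then show ?thesis using F2_bound[of w "e i" "e j"] by (simp add: power2_eq_square mult.assoc)
qed

lemma F1_e_bound: "\<bar>F1 w (e i)\<bar> \<le> K * \<epsilon>"
  using F1_bound[of w "e i"] mult_left_mono[OF e_norm K_nonneg] order_trans by blast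

lemma F2_e_lipschitz: "\<bar>F2 v (e i) (e j) - F2 w (e i) (e j)\<bar> \<le> 2 * L * \<epsilon>\<^sup>2 * norm (v - w)"
proof -
  have "2 * (L * norm (v - w)) * norm (e i) * norm (e j) \<le> 2 * (L * norm (v - w)) * \<epsilon> * \<epsilon>"
    using e_norm L_nonneg \<epsilon>_nonneg by (intro mult_mono) auto
  then show ?thesis using F2_lipschitz[of v "e i" "e j" w] by (simp add: power2_eq_square mult_ac)
qed

lemma F2_e_diag_lipschitz: "\<bar>F2 v (e i) (e i) - F2 w (e i) (e i)\<bar> \<le> L * \<epsilon>\<^sup>2 * norm (v - w)"
proof -
  have "L * norm (v - w) * (norm (e i))\<^sup>2 \<le> L * norm (v - w) * \<epsilon>\<^sup>2"
    using e_norm L_nonneg by (intro mult_left_mono power_mono) auto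
  then show ?thesis using F2_diag_lipschitz'[of v "e i" w] by (simp add: mult_ac)
qed

text \<open>The rows in \<open>A\<close> are left out, so that \<open>W A p\<close> is independent of them.\<close>

definition W :: "nat set \<Rightarrow> (nat \<Rightarrow> nat) \<Rightarrow> 'a \<Rightarrow> 'v" where
  "W A p \<omega> = (\<Sum>m\<in>S - A. X m (p m) \<omega> *\<^sub>R e m)"

lemma permutes_memb: "p permutes S \<Longrightarrow> m \<in> S \<Longrightarrow> p m \<in> S"
  by (simp add: permutes_in_image)

lemma W_measurable:
  assumes "p permutes S" "continuous_on UNIV G"
  shows "(\<lambda>\<omega>. G (W A p \<omega>) :: real) \<in> borel_measurable M"
  unfolding W_def using assms by (intro borel_measurable_continuous_sum) (auto intro: X_measurable permutes_memb)

lemma F2_W_measurable [measurable]: "p permutes S \<Longrightarrow> (\<lambda>\<omega>. F2 (W A p \<omega>) x y) \<in> borel_measurable M"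
  by (rule W_measurable[where G = "\<lambda>w. F2 w x y"]) (auto intro: F2_continuous)

lemma F1_W_measurable [measurable]: "p permutes S \<Longrightarrow> (\<lambda>\<omega>. F1 (W A p \<omega>) x) \<in> borel_measurable M"
  by (rule W_measurable[where G = "\<lambda>w. F1 w x"]) (auto intro: F1_continuous)

lemma F2_W_integrable: "p permutes S \<Longrightarrow> integrable M (\<lambda>\<omega>. F2 (W A p \<omega>) (e i) (e j))"
  by (rule integrable_const_bound[of _ "2 * K * \<epsilon>\<^sup>2"]) (auto intro!: F2_e_bound F2_W_measurable)

lemma integral_mult_bounded:
  assumes "integrable M U" "f \<in> borel_measurable M" "\<And>\<omega>. \<bar>f \<omega>\<bar> \<le> C"
  shows "integrable M (\<lambda>\<omega>. U \<omega> * f \<omega> :: real)"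
proof (rule Bochner_Integration.integrable_bound)
  show "integrable M (\<lambda>\<omega>. C * U \<omega>)" using assms by simp
  show "AE \<omega> in M. norm (U \<omega> * f \<omega>) \<le> norm (C * U \<omega>)"
    using assms(3) by (intro AE_I2) (auto simp: abs_mult mult.commute[of C] intro!: mult_left_mono order_trans[OF assms(3) abs_ge_self])
qed (use assms in measurable)

text \<open>With p fixed, \<open>U\<close> is a function of entries in the rows \<open>R\<close>,
  whatever their columns, and these rows are missing from the point \<open>W R p\<close>; hence the
  expectation factors.\<close>

lemma W_split:
  fixes u :: "(nat \<times> nat \<Rightarrow> real) \<Rightarrow> real" and U :: "'a \<Rightarrow> real" and G :: "'v \<Rightarrow> real"
  assumes p: "p permutes S" and A: "A \<subseteq> R \<times> S" "R \<subseteq> S"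
    and u: "u \<in> borel_measurable (Pi\<^sub>M A (\<lambda>_. borel))"
    and U: "\<And>\<omega>. U \<omega> = u (\<lambda>(i, k)\<in>A. X i k \<omega>)" and int: "integrable M U"
    and G: "continuous_on UNIV G" and G_bound: "\<And>w. \<bar>G w\<bar> \<le> C"
  shows "(\<integral>\<omega>. U \<omega> * G (W R p \<omega>) \<partial>M) = (\<integral>\<omega>. U \<omega> \<partial>M) * (\<integral>\<omega>. G (W R p \<omega>) \<partial>M)"
proof (rule split_rows(1))
  let ?v = "\<lambda>x. G (\<Sum>m\<in>S - R. x (m, p m) *\<^sub>R e m)"
  show "A \<inter> (S - R) \<times> S = {}" "A \<subseteq> S \<times> S" "(S - R) \<times> S \<subseteq> S \<times> S" using A by auto
  show "?v \<in> borel_measurable (Pi\<^sub>M ((S - R) \<times> S) (\<lambda>_. borel))"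
    using permutes_memb[OF p] G by (intro borel_measurable_continuous_sum) (auto intro!: measurable_component_singleton)
  show "G (W R p \<omega>) = ?v (\<lambda>(i, k)\<in>(S - R) \<times> S. X i k \<omega>)" for \<omega>
    using permutes_memb[OF p] by (auto simp: W_def intro!: arg_cong[where f = G] sum.cong)
  show "integrable M (\<lambda>\<omega>. G (W R p \<omega>))"
    using W_measurable[OF p G] G_bound by (intro integrable_const_bound[of _ C]) auto
qed (fact u U int)+

end

lemma abs_integral_diff_le:
  fixes U V C :: "'a \<Rightarrow> real"
  assumes "integrable M U" "integrable M V" "integrable M C" "\<And>\<omega>. \<bar>U \<omega> - V \<omega>\<bar> \<le> C \<omega>"
  shows "\<bar>(\<integral>\<omega>. U \<omega> \<partial>M) - (\<integral>\<omega>. V \<omega> \<partial>M)\<bar> \<le> (\<integral>\<omega>. C \<omega> \<partial>M)"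
proof -
  have "\<bar>(\<integral>\<omega>. U \<omega> \<partial>M) - (\<integral>\<omega>. V \<omega> \<partial>M)\<bar> = \<bar>\<integral>\<omega>. U \<omega> - V \<omega> \<partial>M\<bar>"
    using assms by simp
  also have "\<dots> \<le> (\<integral>\<omega>. \<bar>U \<omega> - V \<omega>\<bar> \<partial>M)" by (rule integral_abs_bound)
  also have "\<dots> \<le> (\<integral>\<omega>. C \<omega> \<partial>M)" using assms by (intro integral_mono) auto
  finally show ?thesis .
qed

context random_array
begin

text \<open>When the means sum to 0 in every row, this is the covariance of X i (\<pi> i) and X j
  (\<pi> j). For i \<noteq> j the columns k and l are distinct and uniform; the sum over all pairs
  vanishes with the row sums, and minus the diagonal k = l remains.\<close>

definition "covariance i j = (if i = j then (\<Sum>k\<in>S. moment 2 i k) / card S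
  else - (\<Sum>k\<in>S. mean i k * mean j k) / (card S * (card S - 1)))"

text \<open>The expectation of the remainder in \<open>off_diagonal_expansion\<close>.\<close>

definition "swap_error i j p = moment 3 i (p j) / 2 + moment 2 i (p j) * moment 1 j (p i)
  + moment 1 i (p j) * moment 2 j (p i) / 2 + moment 1 i (p j) * moment 2 j (p j) / 2
  + moment 2 i (p j) * moment 1 j (p j)"

text \<open>The right side of \<open>perm_mean_decouple\<close> for the means, with the first
  absolute moments as \<eta> and the factor b / (n - 1) taken out.\<close>

definition "decouple_error i j =
  (\<Sum>r\<in>S - {i, j}. perm_mean S (\<lambda>p. \<bar>mean i (p j)\<bar> * \<bar>mean j (p r)\<bar> * (moment 1 r (p r) + moment 1 r (p i))))
  + (\<Sum>r\<in>S - {i, j}. perm_mean S (\<lambda>p. \<bar>mean i (p r)\<bar> * \<bar>mean j (p r)\<bar> * (moment 1 r (p r) + moment 1 r (p j))))"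

text \<open>Measured in units of L \<epsilon>^3, the parts come from the Taylor expansion, from
  putting row i back into the point of the diagonal term, from decoupling, and from putting rows i
  and j back into the points of the mixed terms. The factors 2 in the last two parts are due to
  polarization.\<close>

definition "row_error i =
  perm_mean S (\<lambda>p. moment 3 i (p i) / 2 + (\<Sum>j\<in>S - {i}. swap_error i j p))
  + (\<Sum>k\<in>S. moment 2 i k) * perm_mean S (\<lambda>p. moment 1 i (p i))
  + (\<Sum>j\<in>S - {i}. 2 / (real (card S) - 1) * decouple_error i j
      + \<bar>\<Sum>k\<in>S. mean i k * mean j k\<bar> / (real (card S) - 1)
        * (2 * perm_mean S (\<lambda>p. moment 1 i (p i) + moment 1 j (p j))))"

end

section \<open>Exchanging two rows of the permuted sum\<close>

context array_expansion
begin

lemma permutes_swap: "p permutes S \<Longrightarrow> i \<in> S \<Longrightarrow> j \<in> S \<Longrightarrow> (p \<circ> swap i j) permutes S"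
  by (intro permutes_compose permutes_swap_id)

lemma W_cong: "(\<And>m. m \<in> S - A \<Longrightarrow> p m = q m) \<Longrightarrow> W A p \<omega> = W A q \<omega>"
  unfolding W_def by (rule sum.cong) auto

lemma W_insert: "i \<in> S \<Longrightarrow> i \<notin> A \<Longrightarrow> W A p \<omega> = W (insert i A) p \<omega> + X i (p i) \<omega> *\<^sub>R e i"
proof -
  assume "i \<in> S" "i \<notin> A"
  moreover have "S - A - {i} = S - insert i A" by auto
  ultimately show ?thesis
    using sum.remove[of "S - A" i "\<lambda>m. X m (p m) \<omega> *\<^sub>R e m"] finite_S by (simp add: W_def add.commute)
qed

lemma W_swap:
  assumes "i \<in> S" "j \<in> S" "i \<noteq> j"
  shows "W {} (p \<circ> swap i j) \<omega> = W {i, j} p \<omega> + X i (p j) \<omega> *\<^sub>R e i + X j (p i) \<omega> *\<^sub>R e j"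
proof -
  define q where "q = p \<circ> swap i j"
  have q: "q i = p j" "q j = p i" by (simp_all add: q_def)
  have "W {} q \<omega> = W {j, i} q \<omega> + X j (q j) \<omega> *\<^sub>R e j + X i (q i) \<omega> *\<^sub>R e i"
    using W_insert[of i "{}" q \<omega>] W_insert[of j "{i}" q \<omega>] assms by simp
  also have "W {j, i} q \<omega> = W {i, j} p \<omega>"
    unfolding insert_commute[of j] by (rule W_cong) (auto simp: q_def transpose_apply_other)
  finally show ?thesis by (simp add: q add_ac flip: q_def)
qed

definition "T A p i j = (\<integral>\<omega>. F2 (W A p \<omega>) (e i) (e j) \<partial>M)"

lemma T_diff:
  assumes "p permutes S" "q permutes S" "integrable M D" "\<And>\<omega>. norm (W A p \<omega> - W B q \<omega>) \<le> \<epsilon> * D \<omega>"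
  shows "\<bar>T A p i j - T B q i j\<bar> \<le> 2 * L * \<epsilon> ^ 3 * (\<integral>\<omega>. D \<omega> \<partial>M)"
proof -
  have "\<bar>T A p i j - T B q i j\<bar> \<le> (\<integral>\<omega>. 2 * L * \<epsilon> ^ 3 * D \<omega> \<partial>M)"
    unfolding T_def
  proof (rule abs_integral_diff_le)
    fix \<omega>
    have "2 * L * \<epsilon>\<^sup>2 * norm (W A p \<omega> - W B q \<omega>) \<le> 2 * L * \<epsilon>\<^sup>2 * (\<epsilon> * D \<omega>)"
      using assms(4) L_nonneg by (intro mult_left_mono) auto
    then show "\<bar>F2 (W A p \<omega>) (e i) (e j) - F2 (W B q \<omega>) (e i) (e j)\<bar> \<le> 2 * L * \<epsilon> ^ 3 * D \<omega>"
      using F2_e_lipschitz[of "W A p \<omega>" i j "W B q \<omega>"] by (simp add: power2_eq_square power3_eq_cube mult_ac)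
  qed (use assms F2_W_integrable in auto)
  then show ?thesis by simp
qed

text \<open>For equal directions the diagonal Lipschitz bound applies directly, which saves the
  factor 2 of \<open>T_diff\<close>.\<close>

lemma T_diag_diff:
  assumes "p permutes S" "q permutes S" "integrable M D" "\<And>\<omega>. norm (W A p \<omega> - W B q \<omega>) \<le> \<epsilon> * D \<omega>"
  shows "\<bar>T A p i i - T B q i i\<bar> \<le> L * \<epsilon> ^ 3 * (\<integral>\<omega>. D \<omega> \<partial>M)"
proof -
  have "\<bar>T A p i i - T B q i i\<bar> \<le> (\<integral>\<omega>. L * \<epsilon> ^ 3 * D \<omega> \<partial>M)"
    unfolding T_def
  proof (rule abs_integral_diff_le)
    fix \<omega>
    have "L * \<epsilon>\<^sup>2 * norm (W A p \<omega> - W B q \<omega>) \<le> L * \<epsilon>\<^sup>2 * (\<epsilon> * D \<omega>)"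
      using assms(4) L_nonneg by (intro mult_left_mono) auto
    then show "\<bar>F2 (W A p \<omega>) (e i) (e i) - F2 (W B q \<omega>) (e i) (e i)\<bar> \<le> L * \<epsilon> ^ 3 * D \<omega>"
      using F2_e_diag_lipschitz[of "W A p \<omega>" i "W B q \<omega>"] by (simp add: power2_eq_square power3_eq_cube mult_ac)
  qed (use assms F2_W_integrable in auto)
  then show ?thesis by simp
qed

lemma norm_scaled_e: "norm (a *\<^sub>R e i) \<le> \<epsilon> * \<bar>a\<bar>"
  using mult_left_mono[OF e_norm, of "\<bar>a\<bar>" i] by (simp add: mult.commute)

lemma norm_scaled_e2: "norm (a *\<^sub>R e i + b *\<^sub>R e j) \<le> \<epsilon> * (\<bar>a\<bar> + \<bar>b\<bar>)"
  using norm_triangle_ineq[of "a *\<^sub>R e i" "b *\<^sub>R e j"] norm_scaled_e[of a i] norm_scaled_e[of b j]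
  by (simp add: distrib_left)

lemma integrable_abs_X: "i \<in> S \<Longrightarrow> k \<in> S \<Longrightarrow> integrable M (\<lambda>\<omega>. \<bar>X i k \<omega>\<bar>)"
  using integrable_moment[of i k 1] by simp

lemma integral_abs_X: "(\<integral>\<omega>. \<bar>X i k \<omega>\<bar> \<partial>M) = moment 1 i k"
  by (simp add: moment_def)

lemma T_insert_diag:
  assumes "p permutes S" "i \<in> S"
  shows "\<bar>T {i} p i i - T {} p i i\<bar> \<le> L * \<epsilon> ^ 3 * moment 1 i (p i)"
  unfolding integral_abs_X[symmetric]
proof (rule T_diag_diff)
  show "norm (W {i} p \<omega> - W {} p \<omega>) \<le> \<epsilon> * \<bar>X i (p i) \<omega>\<bar>" for \<omega>
    using norm_scaled_e[of "X i (p i) \<omega>" i] assms W_insert[of i "{}" p \<omega>] by simp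
qed (use assms permutes_memb integrable_abs_X in auto)

lemma T_insert2:
  assumes "p permutes S" "i \<in> S" "j \<in> S" "i \<noteq> j"
  shows "\<bar>T {i, j} p i j - T {} p i j\<bar> \<le> 2 * L * \<epsilon> ^ 3 * (moment 1 i (p i) + moment 1 j (p j))"
proof -
  have "\<bar>T {i, j} p i j - T {} p i j\<bar> \<le> 2 * L * \<epsilon> ^ 3 * (\<integral>\<omega>. \<bar>X i (p i) \<omega>\<bar> + \<bar>X j (p j) \<omega>\<bar> \<partial>M)"
  proof (rule T_diff)
    fix \<omega>
    have "W {} p \<omega> = W {i, j} p \<omega> + (X i (p i) \<omega> *\<^sub>R e i + X j (p j) \<omega> *\<^sub>R e j)"
      using W_insert[of i "{}" p \<omega>] W_insert[of j "{i}" p \<omega>] assms by (simp add: insert_commute add_ac)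
    then have "W {} p \<omega> - W {i, j} p \<omega> = X i (p i) \<omega> *\<^sub>R e i + X j (p j) \<omega> *\<^sub>R e j" by simp
    then show "norm (W {i, j} p \<omega> - W {} p \<omega>) \<le> \<epsilon> * (\<bar>X i (p i) \<omega>\<bar> + \<bar>X j (p j) \<omega>\<bar>)"
      by (metis norm_minus_commute norm_scaled_e2)
  qed (use assms permutes_memb integrable_abs_X in auto)
  then show ?thesis
    using assms permutes_memb integrable_abs_X by (simp add: integral_abs_X)
qed

text \<open>Row i is absent from \<open>W A\<close>, so the transposition shows in row r only, whose
  entry moves from column p r to column p i.\<close>

lemma T_swap_outside:
  assumes "p permutes S" "i \<in> A" "i \<in> S" "r \<in> S" "r \<notin> A"
  shows "\<bar>T A (p \<circ> swap i r) j l - T A p j l\<bar> \<le> 2 * L * \<epsilon> ^ 3 * (moment 1 r (p r) + moment 1 r (p i))"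
proof -
  have "\<bar>T A (p \<circ> swap i r) j l - T A p j l\<bar> \<le> 2 * L * \<epsilon> ^ 3 * (\<integral>\<omega>. \<bar>X r (p r) \<omega>\<bar> + \<bar>X r (p i) \<omega>\<bar> \<partial>M)"
  proof (rule T_diff)
    fix \<omega>
    have eq: "W (insert r A) (p \<circ> swap i r) \<omega> = W (insert r A) p \<omega>"
    proof (rule W_cong)
      fix m assume "m \<in> S - insert r A"
      then have "m \<noteq> i" "m \<noteq> r" using assms by auto
      then show "(p \<circ> swap i r) m = p m" by (simp add: transpose_apply_other)
    qed
    have "W A (p \<circ> swap i r) \<omega> - W A p \<omega> = (X r (p i) \<omega> - X r (p r) \<omega>) *\<^sub>R e r"
      using assms W_insert[of r A p \<omega>] W_insert[of r A "p \<circ> swap i r" \<omega>] by (simp add: eq scaleR_diff_left)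
    then show "norm (W A (p \<circ> swap i r) \<omega> - W A p \<omega>) \<le> \<epsilon> * (\<bar>X r (p r) \<omega>\<bar> + \<bar>X r (p i) \<omega>\<bar>)"
      using order_trans[OF norm_scaled_e mult_left_mono[OF _ \<epsilon>_nonneg]] abs_triangle_ineq4[of "X r (p i) \<omega>" "X r (p r) \<omega>"]
      by (simp add: add.commute)
  qed (use assms permutes_memb integrable_abs_X permutes_swap in auto)
  then show ?thesis
    using assms permutes_memb integrable_abs_X by (simp add: integral_abs_X)
qed

lemma diag_term:
  assumes p: "p permutes S" and "i \<in> S" "k \<in> S"
  shows "(\<integral>\<omega>. (X i k \<omega>)\<^sup>2 * F2 (W {i} p \<omega>) (e i) (e i) \<partial>M) = moment 2 i k * T {i} p i i"
    and "integrable M (\<lambda>\<omega>. (X i k \<omega>)\<^sup>2 * F2 (W {i} p \<omega>) (e i) (e i))"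
proof -
  have int: "integrable M (\<lambda>\<omega>. (X i k \<omega>)\<^sup>2)" using integrable_moment[of i k 2] assms by simp
  have "(\<integral>\<omega>. (X i k \<omega>)\<^sup>2 * F2 (W {i} p \<omega>) (e i) (e i) \<partial>M) = (\<integral>\<omega>. (X i k \<omega>)\<^sup>2 \<partial>M) * (\<integral>\<omega>. F2 (W {i} p \<omega>) (e i) (e i) \<partial>M)"
    by (rule W_split[of p "{(i, k)}" "{i}" "\<lambda>x. (x (i, k))\<^sup>2"])
      (use assms int F2_continuous F2_e_bound in
        \<open>auto intro!: borel_measurable_power measurable_component_singleton\<close>)
  then show "(\<integral>\<omega>. (X i k \<omega>)\<^sup>2 * F2 (W {i} p \<omega>) (e i) (e i) \<partial>M) = moment 2 i k * T {i} p i i"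
    by (simp add: moment_def T_def)
  show "integrable M (\<lambda>\<omega>. (X i k \<omega>)\<^sup>2 * F2 (W {i} p \<omega>) (e i) (e i))"
    by (rule integral_mult_bounded[OF int F2_W_measurable[OF p] F2_e_bound])
qed

lemma off_diag_term:
  assumes p: "p permutes S" and ij: "i \<in> S" "j \<in> S" "i \<noteq> j" and kl: "k \<in> S" "l \<in> S"
  shows "(\<integral>\<omega>. X i k \<omega> * (X j l \<omega> - X j k \<omega>) * F2 (W {i, j} p \<omega>) (e i) (e j) \<partial>M)
      = mean i k * (mean j l - mean j k) * T {i, j} p i j"
    and "integrable M (\<lambda>\<omega>. X i k \<omega> * (X j l \<omega> - X j k \<omega>) * F2 (W {i, j} p \<omega>) (e i) (e j))"
proof -
  have int: "integrable M (\<lambda>\<omega>. X i k \<omega> * (X j l \<omega> - X j k \<omega>))"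
    using mean_mult(2)[of i k j l] mean_mult(2)[of i k j k] assms by (simp add: right_diff_distrib)
  have eq: "(\<integral>\<omega>. X i k \<omega> * (X j l \<omega> - X j k \<omega>) \<partial>M) = mean i k * (mean j l - mean j k)"
    using mean_mult[of i k j l] mean_mult[of i k j k] assms by (simp add: right_diff_distrib)
  have "(\<integral>\<omega>. X i k \<omega> * (X j l \<omega> - X j k \<omega>) * F2 (W {i, j} p \<omega>) (e i) (e j) \<partial>M)
      = (\<integral>\<omega>. X i k \<omega> * (X j l \<omega> - X j k \<omega>) \<partial>M) * (\<integral>\<omega>. F2 (W {i, j} p \<omega>) (e i) (e j) \<partial>M)"
    by (rule W_split[of p "{(i, k), (j, l), (j, k)}" "{i, j}" "\<lambda>x. x (i, k) * (x (j, l) - x (j, k))"])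
      (use assms int F2_continuous F2_e_bound in
        \<open>auto intro!: borel_measurable_times borel_measurable_diff measurable_component_singleton\<close>)
  then show "(\<integral>\<omega>. X i k \<omega> * (X j l \<omega> - X j k \<omega>) * F2 (W {i, j} p \<omega>) (e i) (e j) \<partial>M)
      = mean i k * (mean j l - mean j k) * T {i, j} p i j"
    by (simp add: eq T_def)
  show "integrable M (\<lambda>\<omega>. X i k \<omega> * (X j l \<omega> - X j k \<omega>) * F2 (W {i, j} p \<omega>) (e i) (e j))"
    by (rule integral_mult_bounded[OF int F2_W_measurable[OF p] F2_e_bound])
qed

lemma X_F1_integrable:
  "q permutes S \<Longrightarrow> i \<in> S \<Longrightarrow> k \<in> S \<Longrightarrow> integrable M (\<lambda>\<omega>. X i k \<omega> * F1 (W A q \<omega>) (e i))"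
  by (rule integral_mult_bounded[OF integrable_X F1_W_measurable F1_e_bound])

text \<open>The subtracted integral is a control term. Its point omits row i and does not depend on
  j, so by independence its sum over j is a multiple of the sum of the means of row i; when that sum
  is 0, the control terms cancel out of the total.\<close>

definition "increment i j p = (\<integral>\<omega>. X i (p j) \<omega> * F1 (W {} (p \<circ> swap i j) \<omega>) (e i) \<partial>M)
    - (\<integral>\<omega>. X i (p j) \<omega> * F1 (W {i} p \<omega>) (e i) \<partial>M)"

lemma increment_same:
  assumes p: "p permutes S" and i: "i \<in> S"
  shows "\<bar>increment i i p - moment 2 i (p i) * T {i} p i i\<bar> \<le> L * \<epsilon> ^ 3 * (moment 3 i (p i) / 2)"
proof -
  have pi: "p i \<in> S" using p i by (rule permutes_memb)
  have "\<bar>increment i i p - moment 2 i (p i) * T {i} p i i\<bar>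
      = \<bar>(\<integral>\<omega>. X i (p i) \<omega> * F1 (W {} p \<omega>) (e i) - X i (p i) \<omega> * F1 (W {i} p \<omega>) (e i) \<partial>M)
          - (\<integral>\<omega>. (X i (p i) \<omega>)\<^sup>2 * F2 (W {i} p \<omega>) (e i) (e i) \<partial>M)\<bar>"
    using p i pi by (simp add: increment_def diag_term X_F1_integrable)
  also have "\<dots> \<le> (\<integral>\<omega>. L * \<epsilon> ^ 3 * (\<bar>X i (p i) \<omega>\<bar> ^ 3 / 2) \<partial>M)"
  proof (rule abs_integral_diff_le)
    show "\<bar>X i (p i) \<omega> * F1 (W {} p \<omega>) (e i) - X i (p i) \<omega> * F1 (W {i} p \<omega>) (e i)
        - (X i (p i) \<omega>)\<^sup>2 * F2 (W {i} p \<omega>) (e i) (e i)\<bar> \<le> L * \<epsilon> ^ 3 * (\<bar>X i (p i) \<omega>\<bar> ^ 3 / 2)" for \<omega>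
      using diagonal_expansion[OF e_norm, of "X i (p i) \<omega>" "W {i} p \<omega>" i] i
      using W_insert[of i "{}" p \<omega>] by (simp add: right_diff_distrib)
  qed (use p i pi in \<open>auto intro!: X_F1_integrable diag_term integrable_moment\<close>)
  finally show ?thesis by (simp add: moment_def)
qed

lemma increment_other:
  assumes p: "p permutes S" and ij: "i \<in> S" "j \<in> S" "i \<noteq> j"
  shows "\<bar>increment i j p - (moment 2 i (p j) * T {i} p i i
      + mean i (p j) * (mean j (p i) - mean j (p j)) * T {i, j} p i j)\<bar> \<le> L * \<epsilon> ^ 3 * swap_error i j p"
proof -
  have pS: "p i \<in> S" "p j \<in> S" "(p \<circ> swap i j) permutes S" using p ij permutes_memb permutes_swap by auto
  let ?a = "X i (p j)" and ?b = "X j (p i)" and ?c = "X j (p j)"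
  let ?U = "\<lambda>\<omega>. ?a \<omega> * F1 (W {} (p \<circ> swap i j) \<omega>) (e i) - ?a \<omega> * F1 (W {i} p \<omega>) (e i)"
  let ?V = "\<lambda>\<omega>. (?a \<omega>)\<^sup>2 * F2 (W {i} p \<omega>) (e i) (e i) + ?a \<omega> * (?b \<omega> - ?c \<omega>) * F2 (W {i, j} p \<omega>) (e i) (e j)"
  let ?C = "\<lambda>\<omega>. \<bar>?a \<omega>\<bar> ^ 3 / 2 + \<bar>?a \<omega>\<bar> ^ 2 * \<bar>?b \<omega>\<bar> ^ 1 + \<bar>?a \<omega>\<bar> ^ 1 * \<bar>?b \<omega>\<bar> ^ 2 / 2
      + \<bar>?a \<omega>\<bar> ^ 1 * \<bar>?c \<omega>\<bar> ^ 2 / 2 + \<bar>?a \<omega>\<bar> ^ 2 * \<bar>?c \<omega>\<bar> ^ 1"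
  have ne: "(i, p j) \<noteq> (j, p i)" "(i, p j) \<noteq> (j, p j)" using ij by auto
  note ab = moment_mult[OF ij(1) pS(2) ij(2) pS(1) ne(1)] and ac = moment_mult[OF ij(1) pS(2) ij(2) pS(2) ne(2)]
  have C: "integrable M ?C" "(\<integral>\<omega>. ?C \<omega> \<partial>M) = swap_error i j p"
  proof -
    have 1: "integrable M (\<lambda>\<omega>. \<bar>?a \<omega>\<bar> ^ 3)" "integrable M (\<lambda>\<omega>. \<bar>?a \<omega>\<bar> ^ 2 * \<bar>?b \<omega>\<bar> ^ 1)"
      "integrable M (\<lambda>\<omega>. \<bar>?a \<omega>\<bar> ^ 1 * \<bar>?b \<omega>\<bar> ^ 2)" "integrable M (\<lambda>\<omega>. \<bar>?a \<omega>\<bar> ^ 1 * \<bar>?c \<omega>\<bar> ^ 2)"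
      "integrable M (\<lambda>\<omega>. \<bar>?a \<omega>\<bar> ^ 2 * \<bar>?c \<omega>\<bar> ^ 1)"
      by (intro ab(2) ac(2) X_third_moment ij pS; simp)+
    have 2: "(\<integral>\<omega>. \<bar>?a \<omega>\<bar> ^ 2 * \<bar>?b \<omega>\<bar> ^ 1 \<partial>M) = moment 2 i (p j) * moment 1 j (p i)"
      "(\<integral>\<omega>. \<bar>?a \<omega>\<bar> ^ 1 * \<bar>?b \<omega>\<bar> ^ 2 \<partial>M) = moment 1 i (p j) * moment 2 j (p i)"
      "(\<integral>\<omega>. \<bar>?a \<omega>\<bar> ^ 1 * \<bar>?c \<omega>\<bar> ^ 2 \<partial>M) = moment 1 i (p j) * moment 2 j (p j)"
      "(\<integral>\<omega>. \<bar>?a \<omega>\<bar> ^ 2 * \<bar>?c \<omega>\<bar> ^ 1 \<partial>M) = moment 2 i (p j) * moment 1 j (p j)"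
      by (intro ab(1) ac(1); simp)+
    have 3: "(\<integral>\<omega>. \<bar>?a \<omega>\<bar> ^ 3 \<partial>M) = moment 3 i (p j)" by (simp add: moment_def)
    show "integrable M ?C" by (intro Bochner_Integration.integrable_add Bochner_Integration.integrable_divide 1)
    show "(\<integral>\<omega>. ?C \<omega> \<partial>M) = swap_error i j p"
      unfolding swap_error_def 2[symmetric] 3[symmetric]
      using 1 by (simp del: power_one_right)
  qed
  have "\<bar>increment i j p - (moment 2 i (p j) * T {i} p i i
      + mean i (p j) * (mean j (p i) - mean j (p j)) * T {i, j} p i j)\<bar> = \<bar>(\<integral>\<omega>. ?U \<omega> \<partial>M) - (\<integral>\<omega>. ?V \<omega> \<partial>M)\<bar>"
    using p ij pS by (simp add: increment_def diag_term off_diag_term X_F1_integrable)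
  also have "\<dots> \<le> (\<integral>\<omega>. L * \<epsilon> ^ 3 * ?C \<omega> \<partial>M)"
  proof (rule abs_integral_diff_le)
    fix \<omega>
    have "W {i} p \<omega> = W {i, j} p \<omega> + ?c \<omega> *\<^sub>R e j"
      using W_insert[of j "{i}" p \<omega>] ij by (simp add: insert_commute)
    then show "\<bar>?U \<omega> - ?V \<omega>\<bar> \<le> L * \<epsilon> ^ 3 * ?C \<omega>"
      using off_diagonal_expansion[OF e_norm e_norm, of "?a \<omega>" "W {i, j} p \<omega>" i "?b \<omega>" j "?c \<omega>"] ij
      by (simp add: W_swap right_diff_distrib)
  qed (use p ij pS C in \<open>auto intro!: X_F1_integrable diag_term off_diag_term\<close>)
  finally show ?thesis using C by simp
qed

lemma perm_mean_diff_le: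
  assumes "\<And>p. p permutes S \<Longrightarrow> \<bar>f p - g p\<bar> \<le> b * h p"
  shows "\<bar>perm_mean S f - perm_mean S g\<bar> \<le> b * perm_mean S h"
  unfolding perm_mean_diff[symmetric] perm_mean_cmult[symmetric] using assms by (rule perm_mean_abs_le)

text \<open>The estimates \<open>1\<close>, \<open>2\<close> and \<open>4\<close> in the proof match
  the three summands of \<open>row_error\<close>: exchange with Taylor expansion, return of row i to
  the diagonal term, and decoupling with return of rows i and j. All points are brought back to the
  full sum \<open>W {}\<close>, since the contraction must have one and the same form for both
  processes.\<close>

lemma row_expansion:
  assumes i: "i \<in> S" and rows: "\<And>j. j \<in> S \<Longrightarrow> (\<Sum>k\<in>S. mean j k) = 0"
  shows "\<bar>card S * perm_mean S (\<lambda>p. \<integral>\<omega>. X i (p i) \<omega> * F1 (W {} p \<omega>) (e i) \<partial>M)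
      - ((\<Sum>k\<in>S. moment 2 i k) * perm_mean S (\<lambda>p. T {} p i i)
        - (\<Sum>j\<in>S - {i}. (\<Sum>k\<in>S. mean i k * mean j k) / (real (card S) - 1) * perm_mean S (\<lambda>p. T {} p i j)))\<bar>
    \<le> L * \<epsilon> ^ 3 * row_error i"
proof -
  define n where "n = real (card S)"
  have n: "n \<ge> 2" using card_S by (simp add: n_def)
  define b where "b = L * \<epsilon> ^ 3"
  have b: "b \<ge> 0" by (simp add: b_def L_nonneg \<epsilon>_nonneg)
  define M2 where "M2 = (\<Sum>k\<in>S. moment 2 i k)"
  have M2: "M2 \<ge> 0" by (simp add: M2_def sum_nonneg moment_nonneg)
  define v where "v j = (\<Sum>k\<in>S. mean i k * mean j k)" for j
  define Q where "Q = perm_mean S (\<lambda>p. \<integral>\<omega>. X i (p i) \<omega> * F1 (W {} p \<omega>) (e i) \<partial>M)"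
  define f where "f j p = mean i (p j) * (mean j (p i) - mean j (p j)) * T {i, j} p i j" for j p
  define I where "I p = M2 * T {i} p i i + (\<Sum>j\<in>S - {i}. f j p)" for p
  \<comment> \<open>The mean over p is invariant under composition with (i j). Using all n of these
    transpositions, the identity included, makes the entry of row i run through the whole row, which
    the centring needs.\<close>
  have "n * Q = (\<Sum>j\<in>S. Q)" by (simp add: n_def)
  also have "\<dots> = (\<Sum>j\<in>S. perm_mean S (\<lambda>p. \<integral>\<omega>. X i (p j) \<omega> * F1 (W {} (p \<circ> swap i j) \<omega>) (e i) \<partial>M))"
  proof (rule sum.cong)
    fix j assume "j \<in> S"
    then show "Q = perm_mean S (\<lambda>p. \<integral>\<omega>. X i (p j) \<omega> * F1 (W {} (p \<circ> swap i j) \<omega>) (e i) \<partial>M)"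
      unfolding Q_def using i by (subst perm_mean_transpose[of i S j]) auto
  qed simp
  also have "\<dots> = perm_mean S (\<lambda>p. \<Sum>j\<in>S. \<integral>\<omega>. X i (p j) \<omega> * F1 (W {} (p \<circ> swap i j) \<omega>) (e i) \<partial>M)"
    by (simp add: perm_mean_sum)
  also have "\<dots> = perm_mean S (\<lambda>p. \<Sum>j\<in>S. increment i j p)"
  proof (rule perm_mean_cong)
    fix p assume p: "p permutes S"
    have "(\<integral>\<omega>. X i (p j) \<omega> * F1 (W {i} p \<omega>) (e i) \<partial>M) = mean i (p j) * (\<integral>\<omega>. F1 (W {i} p \<omega>) (e i) \<partial>M)" if "j \<in> S" for j
      unfolding mean_def
      by (rule W_split[of p "{(i, p j)}" "{i}" "\<lambda>x. x (i, p j)"])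
        (use p i that permutes_memb[OF p] integrable_X F1_continuous F1_e_bound in
          \<open>auto intro!: measurable_component_singleton\<close>)
    then have "(\<Sum>j\<in>S. \<integral>\<omega>. X i (p j) \<omega> * F1 (W {i} p \<omega>) (e i) \<partial>M) = (\<Sum>j\<in>S. mean i (p j)) * (\<integral>\<omega>. F1 (W {i} p \<omega>) (e i) \<partial>M)"
      by (simp add: sum_distrib_right)
    also have "(\<Sum>j\<in>S. mean i (p j)) = 0" using sum_permutes[OF p, of "mean i"] rows[OF i] by simp
    finally show "(\<Sum>j\<in>S. \<integral>\<omega>. X i (p j) \<omega> * F1 (W {} (p \<circ> swap i j) \<omega>) (e i) \<partial>M) = (\<Sum>j\<in>S. increment i j p)"
      by (simp add: increment_def sum_subtractf)
  qed
  finally have Q: "n * Q = perm_mean S (\<lambda>p. \<Sum>j\<in>S. increment i j p)" .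
  have 1: "\<bar>n * Q - perm_mean S I\<bar> \<le> b * perm_mean S (\<lambda>p. moment 3 i (p i) / 2 + (\<Sum>j\<in>S - {i}. swap_error i j p))"
    unfolding Q
  proof (rule perm_mean_diff_le)
    fix p assume p: "p permutes S"
    have "M2 = (\<Sum>j\<in>S. moment 2 i (p j))" by (simp add: M2_def sum_permutes[OF p])
    also have "\<dots> = moment 2 i (p i) + (\<Sum>j\<in>S - {i}. moment 2 i (p j))"
      using finite_S i by (rule sum.remove)
    finally have "I p = moment 2 i (p i) * T {i} p i i + (\<Sum>j\<in>S - {i}. moment 2 i (p j) * T {i} p i i + f j p)"
      by (simp only: I_def sum.distrib distrib_right sum_distrib_right add.assoc)
    moreover have "(\<Sum>j\<in>S. increment i j p) = increment i i p + (\<Sum>j\<in>S - {i}. increment i j p)"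
      using finite_S i by (rule sum.remove)
    ultimately have eq: "(\<Sum>j\<in>S. increment i j p) - I p = (increment i i p - moment 2 i (p i) * T {i} p i i)
        + (\<Sum>j\<in>S - {i}. increment i j p - (moment 2 i (p j) * T {i} p i i + f j p))"
      by (simp only: sum_subtractf)
    have "\<bar>\<Sum>j\<in>S - {i}. increment i j p - (moment 2 i (p j) * T {i} p i i + f j p)\<bar> \<le> (\<Sum>j\<in>S - {i}. b * swap_error i j p)"
      using increment_other[OF p i] unfolding b_def f_def by (intro order_trans[OF sum_abs] sum_mono) auto
    moreover have "\<bar>increment i i p - moment 2 i (p i) * T {i} p i i\<bar> \<le> b * (moment 3 i (p i) / 2)"
      using increment_same[OF p i] by (simp only: b_def)
    ultimately show "\<bar>(\<Sum>j\<in>S. increment i j p) - I p\<bar> \<le> b * (moment 3 i (p i) / 2 + (\<Sum>j\<in>S - {i}. swap_error i j p))"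
      unfolding eq distrib_left sum_distrib_left by linarith
  qed
  have I: "perm_mean S I = M2 * perm_mean S (\<lambda>p. T {i} p i i) + (\<Sum>j\<in>S - {i}. perm_mean S (f j))"
    by (simp add: I_def[abs_def] perm_mean_add perm_mean_cmult perm_mean_sum)
  have "\<bar>perm_mean S (\<lambda>p. T {i} p i i) - perm_mean S (\<lambda>p. T {} p i i)\<bar> \<le> b * perm_mean S (\<lambda>p. moment 1 i (p i))"
    unfolding b_def using T_insert_diag i by (intro perm_mean_diff_le)
  then have "M2 * \<bar>perm_mean S (\<lambda>p. T {i} p i i) - perm_mean S (\<lambda>p. T {} p i i)\<bar> \<le> M2 * (b * perm_mean S (\<lambda>p. moment 1 i (p i)))"
    using M2 by (rule mult_left_mono)
  then have 2: "\<bar>M2 * perm_mean S (\<lambda>p. T {i} p i i) - M2 * perm_mean S (\<lambda>p. T {} p i i)\<bar> \<le> b * (M2 * perm_mean S (\<lambda>p. moment 1 i (p i)))"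
    using M2 by (simp add: right_diff_distrib[symmetric] abs_mult mult.left_commute)
  \<comment> \<open>Rows i and j stay absent while decoupling takes place: then exchanging p i and p
    j does not move the point, and a transposition with a third row r changes one summand of it
    only. They are put back afterwards.\<close>
  have 3: "\<bar>perm_mean S (f j) + v j / (n - 1) * perm_mean S (\<lambda>p. T {} p i j)\<bar>
      \<le> b * (2 / (n - 1) * decouple_error i j + \<bar>v j\<bar> / (n - 1) * (2 * perm_mean S (\<lambda>p. moment 1 i (p i) + moment 1 j (p j))))"
    if j: "j \<in> S - {i}" for j
  proof -
    have "\<bar>perm_mean S (f j) + v j / (n - 1) * perm_mean S (\<lambda>p. T {i, j} p i j)\<bar> \<le> 2 * b / (n - 1) * decouple_error i j"
      unfolding f_def[abs_def] v_def n_def decouple_error_def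
    proof (rule perm_mean_decouple[where c = mean and \<eta> = "moment 1" and T = "\<lambda>p. T {i, j} p i j" and b = "2 * b"])
      show "T {i, j} (p \<circ> swap i j) i j = T {i, j} p i j" for p
      proof -
        have "W {i, j} (p \<circ> swap i j) \<omega> = W {i, j} p \<omega>" for \<omega>
          by (rule W_cong) (auto simp: transpose_apply_other)
        then show ?thesis by (simp add: T_def)
      qed
      show "\<bar>T {i, j} (p \<circ> swap i r) i j - T {i, j} p i j\<bar> \<le> 2 * b * (moment 1 r (p r) + moment 1 r (p i))"
        if "p permutes S" "r \<in> S - {i, j}" for p r
        using T_swap_outside[of p i "{i, j}" r i j] that i by (simp add: b_def mult_ac)
      show "\<bar>T {i, j} (p \<circ> swap j r) i j - T {i, j} p i j\<bar> \<le> 2 * b * (moment 1 r (p r) + moment 1 r (p j))"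
        if "p permutes S" "r \<in> S - {i, j}" for p r
        using T_swap_outside[of p j "{i, j}" r i j] that i j by (simp add: b_def mult_ac)
    qed (use finite_S i j rows in auto)
    moreover have "\<bar>v j / (n - 1) * perm_mean S (\<lambda>p. T {i, j} p i j) - v j / (n - 1) * perm_mean S (\<lambda>p. T {} p i j)\<bar>
        \<le> \<bar>v j\<bar> / (n - 1) * (2 * b * perm_mean S (\<lambda>p. moment 1 i (p i) + moment 1 j (p j)))"
    proof -
      have "\<bar>perm_mean S (\<lambda>p. T {i, j} p i j) - perm_mean S (\<lambda>p. T {} p i j)\<bar>
          \<le> 2 * b * perm_mean S (\<lambda>p. moment 1 i (p i) + moment 1 j (p j))"
        using T_insert2[of _ i j] i j by (intro perm_mean_diff_le) (auto simp: b_def mult_ac)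
      then have "\<bar>v j / (n - 1)\<bar> * \<bar>perm_mean S (\<lambda>p. T {i, j} p i j) - perm_mean S (\<lambda>p. T {} p i j)\<bar>
          \<le> \<bar>v j / (n - 1)\<bar> * (2 * b * perm_mean S (\<lambda>p. moment 1 i (p i) + moment 1 j (p j)))"
        by (rule mult_left_mono) simp
      moreover have "\<bar>v j / (n - 1)\<bar> = \<bar>v j\<bar> / (n - 1)" using n by (simp add: abs_divide)
      ultimately show ?thesis unfolding right_diff_distrib[symmetric] abs_mult by (simp only:)
    qed
    ultimately have "\<bar>perm_mean S (f j) + v j / (n - 1) * perm_mean S (\<lambda>p. T {} p i j)\<bar>
      \<le> 2 * b / (n - 1) * decouple_error i j + \<bar>v j\<bar> / (n - 1) * (2 * b * perm_mean S (\<lambda>p. moment 1 i (p i) + moment 1 j (p j)))"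
      by linarith
    then show ?thesis by (simp add: algebra_simps)
  qed
  have 4: "\<bar>(\<Sum>j\<in>S - {i}. perm_mean S (f j)) + (\<Sum>j\<in>S - {i}. v j / (n - 1) * perm_mean S (\<lambda>p. T {} p i j))\<bar>
     \<le> b * (\<Sum>j\<in>S - {i}. 2 / (n - 1) * decouple_error i j + \<bar>v j\<bar> / (n - 1) * (2 * perm_mean S (\<lambda>p. moment 1 i (p i) + moment 1 j (p j))))"
    unfolding sum.distrib[symmetric] sum_distrib_left by (intro order_trans[OF sum_abs] sum_mono 3)
  show ?thesis
    using 1 2 4
    unfolding I n_def[symmetric] b_def[symmetric] Q_def[symmetric] M2_def[symmetric] v_def[symmetric] row_error_def
      distrib_left[of b]
    by linarith
qed

lemma F1_sum: "F1 w (\<Sum>i\<in>A. a i *\<^sub>R e i) = (\<Sum>i\<in>A. a i * F1 w (e i))"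
  by (simp add: linear_sum[OF F1_linear] linear_scale[OF F1_linear])

lemma permutation_expansion:
  assumes rows: "\<And>j. j \<in> S \<Longrightarrow> (\<Sum>k\<in>S. mean j k) = 0"
  shows "\<bar>perm_mean S (\<lambda>p. \<integral>\<omega>. F1 (W {} p \<omega>) (W {} p \<omega>) \<partial>M)
      - (\<Sum>i\<in>S. \<Sum>j\<in>S. covariance i j * perm_mean S (\<lambda>p. \<integral>\<omega>. F2 (W {} p \<omega>) (e i) (e j) \<partial>M))\<bar>
    \<le> L * \<epsilon> ^ 3 * ((\<Sum>i\<in>S. row_error i) / card S)"
proof -
  define n where "n = real (card S)"
  have n: "n \<ge> 2" using card_S by (simp add: n_def)
  define Q where "Q i = perm_mean S (\<lambda>p. \<integral>\<omega>. X i (p i) \<omega> * F1 (W {} p \<omega>) (e i) \<partial>M)" for i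
  define R where "R i = (\<Sum>j\<in>S. covariance i j * perm_mean S (\<lambda>p. T {} p i j))" for i
  have Q: "perm_mean S (\<lambda>p. \<integral>\<omega>. F1 (W {} p \<omega>) (W {} p \<omega>) \<partial>M) = (\<Sum>i\<in>S. Q i)"
    unfolding Q_def perm_mean_sum[symmetric]
  proof (rule perm_mean_cong)
    fix p assume p: "p permutes S"
    have "F1 (W {} p \<omega>) (W {} p \<omega>) = (\<Sum>i\<in>S. X i (p i) \<omega> * F1 (W {} p \<omega>) (e i))" for \<omega>
      by (subst (2) W_def) (simp add: F1_sum)
    then show "(\<integral>\<omega>. F1 (W {} p \<omega>) (W {} p \<omega>) \<partial>M) = (\<Sum>i\<in>S. \<integral>\<omega>. X i (p i) \<omega> * F1 (W {} p \<omega>) (e i) \<partial>M)"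
      using X_F1_integrable[OF p] permutes_memb[OF p] by simp
  qed
  have "\<bar>Q i - R i\<bar> \<le> L * \<epsilon> ^ 3 * row_error i / n" if i: "i \<in> S" for i
  proof -
    \<comment> \<open>The coefficients of the row expansion become those of
      \<open>covariance\<close> after division by n.\<close>
    have "n * R i = (\<Sum>k\<in>S. moment 2 i k) * perm_mean S (\<lambda>p. T {} p i i)
        - (\<Sum>j\<in>S - {i}. (\<Sum>k\<in>S. mean i k * mean j k) / (n - 1) * perm_mean S (\<lambda>p. T {} p i j))"
    proof -
      have "n * (covariance i j * t) = - ((\<Sum>k\<in>S. mean i k * mean j k) / (n - 1) * t)" if "j \<in> S - {i}" for j t
        using that n card_S by (simp add: covariance_def n_def of_nat_diff)
      moreover have "n * (covariance i i * t) = (\<Sum>k\<in>S. moment 2 i k) * t" for t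
        using n by (simp add: covariance_def n_def)
      ultimately show ?thesis
        unfolding R_def sum.remove[OF finite_S i] by (simp add: distrib_left sum_distrib_left sum_negf)
    qed
    then have "\<bar>n * (Q i - R i)\<bar> \<le> L * \<epsilon> ^ 3 * row_error i"
      using row_expansion[OF i rows] by (simp add: Q_def n_def right_diff_distrib)
    moreover have "\<bar>n * (Q i - R i)\<bar> = n * \<bar>Q i - R i\<bar>" using n by (simp add: abs_mult)
    ultimately show ?thesis using n by (simp add: pos_le_divide_eq mult.commute)
  qed
  then have "\<bar>\<Sum>i\<in>S. Q i - R i\<bar> \<le> (\<Sum>i\<in>S. L * \<epsilon> ^ 3 * row_error i / n)"
    by (intro order_trans[OF sum_abs] sum_mono) auto
  also have "\<dots> = L * \<epsilon> ^ 3 * ((\<Sum>i\<in>S. row_error i) / n)"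
    by (simp add: sum_divide_distrib[symmetric] sum_distrib_left)
  finally show ?thesis
    unfolding Q by (simp add: R_def T_def n_def sum_subtractf)
qed

end

section \<open>Sums of moments and the total error of the permuted sum\<close>

context random_array
begin

text \<open>The eight sums from here on correspond to summands of the final bound, each taken over
  the indices that occur in it. The five-fold sum of the bound supplies a further factor n for every
  index that is missing.\<close>

definition "sA = (\<Sum>i\<in>S. \<Sum>k\<in>S. moment 3 i k)"
definition "sB = (\<Sum>i\<in>S. \<Sum>k\<in>S. \<Sum>l\<in>S. moment 2 i k * moment 1 i l)"
definition "sC = (\<Sum>i\<in>S. \<Sum>j\<in>S. \<Sum>k\<in>S. \<Sum>l\<in>S. moment 2 i k * moment 1 j l)"
definition "sD = (\<Sum>i\<in>S. \<Sum>j\<in>S. \<Sum>k\<in>S. moment 2 i k * moment 1 j k)"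
definition "sE = (\<Sum>i\<in>S. \<Sum>j\<in>S. \<Sum>k\<in>S. \<Sum>l\<in>S. moment 1 i k * moment 1 i l * moment 1 j l)"
definition "sG = (\<Sum>i\<in>S. \<Sum>j\<in>S. \<Sum>k\<in>S. \<Sum>l\<in>S. \<Sum>u\<in>S. moment 1 i k * moment 1 j l * moment 1 i u)"
definition "sK = (\<Sum>i\<in>S. \<Sum>j\<in>S. \<Sum>k\<in>S. \<Sum>l\<in>S. \<Sum>u\<in>S. moment 1 u k * moment 1 i k * moment 1 j l)"
definition "sM = (\<Sum>i\<in>S. \<Sum>j\<in>S. \<Sum>k\<in>S. \<Sum>u\<in>S. moment 1 u k * moment 1 i k * moment 1 j k)"

lemma sC_swap: "(\<Sum>i\<in>S. \<Sum>j\<in>S. \<Sum>k\<in>S. \<Sum>l\<in>S. moment 1 i k * moment 2 j l) = sC"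
  unfolding sC_def sum.cartesian_product
  by (rule sum.reindex_bij_witness[of _ "\<lambda>(i, j, k, l). (j, i, l, k)" "\<lambda>(i, j, k, l). (j, i, l, k)"]) auto

lemma sD_swap: "(\<Sum>i\<in>S. \<Sum>j\<in>S. \<Sum>k\<in>S. moment 1 i k * moment 2 j k) = sD"
  unfolding sD_def sum.cartesian_product
  by (rule sum.reindex_bij_witness[of _ "\<lambda>(i, j, k). (j, i, k)" "\<lambda>(i, j, k). (j, i, k)"]) auto

lemma sK_swap1: "(\<Sum>i\<in>S. \<Sum>j\<in>S. \<Sum>r\<in>S. \<Sum>k\<in>S. \<Sum>l\<in>S. moment 1 i k * moment 1 j l * moment 1 r l) = sK"
  unfolding sK_def sum.cartesian_product
  by (rule sum.reindex_bij_witness[of _ "\<lambda>(i, j, k, l, u). (j, i, u, l, k)" "\<lambda>(i, j, r, k, l). (j, i, l, k, r)"]) auto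

lemma sK_swap2: "(\<Sum>i\<in>S. \<Sum>j\<in>S. \<Sum>r\<in>S. \<Sum>k\<in>S. \<Sum>m\<in>S. moment 1 i k * moment 1 j k * moment 1 r m) = sK"
  unfolding sK_def sum.cartesian_product
  by (rule sum.reindex_bij_witness[of _ "\<lambda>(i, j, k, l, u). (i, u, j, k, l)" "\<lambda>(i, j, r, k, m). (i, r, k, m, j)"]) auto

lemma sM_swap: "(\<Sum>i\<in>S. \<Sum>j\<in>S. \<Sum>r\<in>S. \<Sum>k\<in>S. moment 1 i k * moment 1 j k * moment 1 r k) = sM"
  unfolding sM_def sum.cartesian_product
  by (rule sum.reindex_bij_witness[of _ "\<lambda>(i, j, k, u). (i, j, u, k)" "\<lambda>(i, j, r, k). (i, j, k, r)"]) auto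

lemma sE_swap1: "(\<Sum>i\<in>S. \<Sum>j\<in>S. \<Sum>k\<in>S. \<Sum>l\<in>S. moment 1 i k * moment 1 j k * moment 1 i l) = sE"
  unfolding sE_def sum.cartesian_product
  by (rule sum.reindex_bij_witness[of _ "\<lambda>(i, j, k, l). (i, j, l, k)" "\<lambda>(i, j, k, l). (i, j, l, k)"]) auto

lemma sE_swap2: "(\<Sum>i\<in>S. \<Sum>j\<in>S. \<Sum>k\<in>S. \<Sum>l\<in>S. moment 1 i k * moment 1 j k * moment 1 j l) = sE"
  unfolding sE_def sum.cartesian_product
  by (rule sum.reindex_bij_witness[of _ "\<lambda>(i, j, k, l). (j, i, l, k)" "\<lambda>(i, j, k, l). (j, i, l, k)"]) auto

text \<open>Three unrelated entries have six free indices, one more than the sums of the final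
  bound. In terms of the row totals R i, the left side is the cube of their sum and
  \<open>sG\<close> is the product of the sum of the squares of R i with the sum of R i;
  Cauchy-Schwarz compares them at the cost of a factor n.\<close>

lemma cube_le_sG:
  "(\<Sum>i\<in>S. \<Sum>j\<in>S. \<Sum>r\<in>S. \<Sum>k\<in>S. \<Sum>l\<in>S. \<Sum>m\<in>S. moment 1 i k * moment 1 j l * moment 1 r m) \<le> card S * sG"
proof -
  define R where "R i = (\<Sum>k\<in>S. moment 1 i k)" for i
  define t where "t = (\<Sum>i\<in>S. R i)"
  have "t \<ge> 0" by (simp add: t_def R_def sum_nonneg moment_nonneg)
  have "(\<Sum>i\<in>S. \<Sum>j\<in>S. \<Sum>r\<in>S. \<Sum>k\<in>S. \<Sum>l\<in>S. \<Sum>m\<in>S. moment 1 i k * moment 1 j l * moment 1 r m)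
      = (\<Sum>i\<in>S. \<Sum>j\<in>S. \<Sum>r\<in>S. R i * R j * R r)"
    unfolding R_def by (simp only: sum_distrib_left[symmetric] sum_distrib_right[symmetric])
  also have "\<dots> = t * t * t"
    unfolding t_def by (simp only: sum_distrib_left[symmetric] sum_distrib_right[symmetric])
  also have "\<dots> = t\<^sup>2 * t" by (simp add: power2_eq_square)
  also have "\<dots> \<le> ((\<Sum>i\<in>S. (R i)\<^sup>2) * card S) * t"
    unfolding t_def[of] using \<open>t \<ge> 0\<close> t_def
    by (intro mult_right_mono sum_squared_le_sum_of_squares) auto
  also have "(\<Sum>i\<in>S. (R i)\<^sup>2) * t = sG"
  proof -
    have "sG = (\<Sum>i\<in>S. \<Sum>j\<in>S. R i * R j * R i)"
      unfolding sG_def R_def by (simp only: sum_distrib_left[symmetric] sum_distrib_right[symmetric])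
    also have "\<dots> = (\<Sum>i\<in>S. R i * t * R i)"
      unfolding t_def by (simp only: sum_distrib_left[symmetric] sum_distrib_right[symmetric])
    finally show ?thesis by (simp add: sum_distrib_left power2_eq_square mult_ac)
  qed
  then have "((\<Sum>i\<in>S. (R i)\<^sup>2) * card S) * t = card S * sG" by (simp add: mult_ac)
  finally show ?thesis .
qed

lemma perm_mean_abs_mean_le:
  assumes "\<And>p. p permutes S \<Longrightarrow> h p \<ge> 0"
  shows "perm_mean S (\<lambda>p. \<bar>mean i (f p)\<bar> * \<bar>mean j (g p)\<bar> * h p)
    \<le> perm_mean S (\<lambda>p. moment 1 i (f p) * moment 1 j (g p) * h p)"
  using assms abs_mean_le moment_nonneg by (intro perm_mean_mono mult_mono mult_right_mono) auto

lemma decouple_error_le: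
  assumes ij: "i \<in> S" "j \<in> S" "i \<noteq> j"
  defines "n \<equiv> real (card S)"
  shows "decouple_error i j \<le>
    (\<Sum>r\<in>S. (\<Sum>k\<in>S. \<Sum>l\<in>S. moment 1 i k * moment 1 j l * moment 1 r l)) / (n * (n - 1))
    + 3 * (\<Sum>r\<in>S. (\<Sum>k\<in>S. \<Sum>l\<in>S. \<Sum>m\<in>S. moment 1 i k * moment 1 j l * moment 1 r m)) / (n * n * (n - 1))
    + (\<Sum>r\<in>S. (\<Sum>k\<in>S. moment 1 i k * moment 1 j k * moment 1 r k)) / n
    + (\<Sum>r\<in>S. (\<Sum>k\<in>S. \<Sum>m\<in>S. moment 1 i k * moment 1 j k * moment 1 r m)) / (n * (n - 1))"
proof -
  have n: "n \<ge> 2" using card_S by (simp add: n_def)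
  have nn: "moment 1 a b * moment 1 c d * moment 1 e f \<ge> 0" for a b c d e f
    by (intro mult_nonneg_nonneg moment_nonneg)
  have 1: "perm_mean S (\<lambda>p. \<bar>mean i (p j)\<bar> * \<bar>mean j (p r)\<bar> * (moment 1 r (p r) + moment 1 r (p i)))
      \<le> (\<Sum>k\<in>S. \<Sum>l\<in>S. moment 1 i k * moment 1 j l * moment 1 r l) / (n * (n - 1))
        + 3 * (\<Sum>k\<in>S. \<Sum>l\<in>S. \<Sum>m\<in>S. moment 1 i k * moment 1 j l * moment 1 r m) / (n * n * (n - 1))"
    if r: "r \<in> S - {i, j}" for r
  proof -
    have "perm_mean S (\<lambda>p. \<bar>mean i (p j)\<bar> * \<bar>mean j (p r)\<bar> * (moment 1 r (p r) + moment 1 r (p i)))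
        \<le> perm_mean S (\<lambda>p. moment 1 i (p j) * moment 1 j (p r) * (moment 1 r (p r) + moment 1 r (p i)))"
      by (rule perm_mean_abs_mean_le) (simp add: moment_nonneg)
    also have "\<dots> = perm_mean S (\<lambda>p. moment 1 i (p j) * moment 1 j (p r) * moment 1 r (p r))
        + perm_mean S (\<lambda>p. moment 1 i (p j) * moment 1 j (p r) * moment 1 r (p i))"
      by (simp only: distrib_left perm_mean_add)
    also have "perm_mean S (\<lambda>p. moment 1 i (p j) * moment 1 j (p r) * moment 1 r (p r))
        \<le> (\<Sum>k\<in>S. \<Sum>l\<in>S. moment 1 i k * moment 1 j l * moment 1 r l) / (n * (n - 1))"
      unfolding n_def using r ij finite_S nn
      by (intro perm_mean_two_le[where \<phi> = "\<lambda>k l. moment 1 i k * moment 1 j l * moment 1 r l"]) auto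
    also have "perm_mean S (\<lambda>p. moment 1 i (p j) * moment 1 j (p r) * moment 1 r (p i))
        \<le> (\<Sum>k\<in>S. \<Sum>l\<in>S. \<Sum>m\<in>S. moment 1 i k * moment 1 j l * moment 1 r m) / (n * (n - 1) * (n - 2))"
      unfolding n_def using r ij finite_S nn
      by (intro perm_mean_three_le[where \<phi> = "\<lambda>k l m. moment 1 i k * moment 1 j l * moment 1 r m"]) auto
    \<comment> \<open>The distinct indices i, j, r force n \<ge> 3, hence n - 2 \<ge> n / 3; for n =
      2 there is no such r. The denominator thus gains a full factor n, which will absorb the one of
      \<open>cube_le_sG\<close>.\<close>
    also have "\<dots> \<le> (\<Sum>k\<in>S. \<Sum>l\<in>S. \<Sum>m\<in>S. moment 1 i k * moment 1 j l * moment 1 r m) / (n * n * (n - 1) / 3)"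
    proof (rule divide_left_mono)
      have "card {i, j, r} \<le> card S" using r ij finite_S by (intro card_mono) auto
      then have n3: "n \<ge> 3" using r ij by (auto simp: n_def)
      have "n * (n - 1) * (n / 3) \<le> n * (n - 1) * (n - 2)" using n3 by (intro mult_left_mono) auto
      then show "n * n * (n - 1) / 3 \<le> n * (n - 1) * (n - 2)" by (simp add: mult_ac)
      show "0 < n * (n - 1) * (n - 2) * (n * n * (n - 1) / 3)" using n3 by simp
    qed (intro sum_nonneg nn)
    finally show ?thesis by (simp add: mult.commute[of 3])
  qed
  have 2: "perm_mean S (\<lambda>p. \<bar>mean i (p r)\<bar> * \<bar>mean j (p r)\<bar> * (moment 1 r (p r) + moment 1 r (p j)))
      \<le> (\<Sum>k\<in>S. moment 1 i k * moment 1 j k * moment 1 r k) / n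
        + (\<Sum>k\<in>S. \<Sum>m\<in>S. moment 1 i k * moment 1 j k * moment 1 r m) / (n * (n - 1))"
    if r: "r \<in> S - {i, j}" for r
  proof -
    have "perm_mean S (\<lambda>p. \<bar>mean i (p r)\<bar> * \<bar>mean j (p r)\<bar> * (moment 1 r (p r) + moment 1 r (p j)))
        \<le> perm_mean S (\<lambda>p. moment 1 i (p r) * moment 1 j (p r) * (moment 1 r (p r) + moment 1 r (p j)))"
      by (rule perm_mean_abs_mean_le) (simp add: moment_nonneg)
    also have "\<dots> = perm_mean S (\<lambda>p. moment 1 i (p r) * moment 1 j (p r) * moment 1 r (p r))
        + perm_mean S (\<lambda>p. moment 1 i (p r) * moment 1 j (p r) * moment 1 r (p j))"
      by (simp only: distrib_left perm_mean_add)
    also have "perm_mean S (\<lambda>p. moment 1 i (p r) * moment 1 j (p r) * moment 1 r (p r))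
        = (\<Sum>k\<in>S. moment 1 i k * moment 1 j k * moment 1 r k) / n"
      unfolding n_def using r finite_S
      by (intro perm_mean_point[where \<phi> = "\<lambda>k. moment 1 i k * moment 1 j k * moment 1 r k"]) auto
    also have "perm_mean S (\<lambda>p. moment 1 i (p r) * moment 1 j (p r) * moment 1 r (p j))
        \<le> (\<Sum>k\<in>S. \<Sum>m\<in>S. moment 1 i k * moment 1 j k * moment 1 r m) / (n * (n - 1))"
      unfolding n_def using r ij finite_S nn
      by (intro perm_mean_two_le[where \<phi> = "\<lambda>k m. moment 1 i k * moment 1 j k * moment 1 r m"]) auto
    finally show ?thesis by simp
  qed
  have mono: "(\<Sum>r\<in>S - {i, j}. f r) \<le> (\<Sum>r\<in>S. f r)" if "\<And>r. f r \<ge> 0" for f :: "nat \<Rightarrow> real"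
    using finite_S that by (intro sum_mono2) auto
  have "decouple_error i j \<le>
    (\<Sum>r\<in>S - {i, j}. (\<Sum>k\<in>S. \<Sum>l\<in>S. moment 1 i k * moment 1 j l * moment 1 r l) / (n * (n - 1))
        + 3 * (\<Sum>k\<in>S. \<Sum>l\<in>S. \<Sum>m\<in>S. moment 1 i k * moment 1 j l * moment 1 r m) / (n * n * (n - 1)))
    + (\<Sum>r\<in>S - {i, j}. (\<Sum>k\<in>S. moment 1 i k * moment 1 j k * moment 1 r k) / n
        + (\<Sum>k\<in>S. \<Sum>m\<in>S. moment 1 i k * moment 1 j k * moment 1 r m) / (n * (n - 1)))"
    unfolding decouple_error_def by (intro add_mono sum_mono 1 2)
  also have "\<dots> \<le>
    (\<Sum>r\<in>S. (\<Sum>k\<in>S. \<Sum>l\<in>S. moment 1 i k * moment 1 j l * moment 1 r l) / (n * (n - 1))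
        + 3 * (\<Sum>k\<in>S. \<Sum>l\<in>S. \<Sum>m\<in>S. moment 1 i k * moment 1 j l * moment 1 r m) / (n * n * (n - 1)))
    + (\<Sum>r\<in>S. (\<Sum>k\<in>S. moment 1 i k * moment 1 j k * moment 1 r k) / n
        + (\<Sum>k\<in>S. \<Sum>m\<in>S. moment 1 i k * moment 1 j k * moment 1 r m) / (n * (n - 1)))"
    using n by (intro add_mono mono add_nonneg_nonneg divide_nonneg_nonneg mult_nonneg_nonneg sum_nonneg moment_nonneg) auto
  finally show ?thesis
    by (simp add: sum.distrib sum_divide_distrib sum_distrib_left)
qed

lemma sum_off_diagonal_le:
  fixes f :: "nat \<Rightarrow> nat \<Rightarrow> real"
  assumes "\<And>i j. i \<in> S \<Longrightarrow> j \<in> S \<Longrightarrow> i \<noteq> j \<Longrightarrow> g i j \<le> f i j" "\<And>i j. f i j \<ge> 0"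
  shows "(\<Sum>i\<in>S. \<Sum>j\<in>S - {i}. g i j) \<le> (\<Sum>i\<in>S. \<Sum>j\<in>S. f i j)"
proof (rule sum_mono)
  fix i assume "i \<in> S"
  then have "(\<Sum>j\<in>S - {i}. g i j) \<le> (\<Sum>j\<in>S - {i}. f i j)"
    using assms by (intro sum_mono) auto
  also have "\<dots> \<le> (\<Sum>j\<in>S. f i j)"
    using assms finite_S by (intro sum_mono2) auto
  finally show "(\<Sum>j\<in>S - {i}. g i j) \<le> (\<Sum>j\<in>S. f i j)" .
qed

lemma sum_decouple_error_le:
  defines "n \<equiv> real (card S)"
  shows "(\<Sum>i\<in>S. \<Sum>j\<in>S - {i}. decouple_error i j) \<le> (2 * sK + 3 * sG) / (n * (n - 1)) + sM / n"
proof -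
  have n: "n \<ge> 2" using card_S by (simp add: n_def)
  define f1 where "f1 i j = (\<Sum>r\<in>S. (\<Sum>k\<in>S. \<Sum>l\<in>S. moment 1 i k * moment 1 j l * moment 1 r l))" for i j
  define f2 where "f2 i j = (\<Sum>r\<in>S. (\<Sum>k\<in>S. \<Sum>l\<in>S. \<Sum>m\<in>S. moment 1 i k * moment 1 j l * moment 1 r m))" for i j
  define f3 where "f3 i j = (\<Sum>r\<in>S. (\<Sum>k\<in>S. moment 1 i k * moment 1 j k * moment 1 r k))" for i j
  define f4 where "f4 i j = (\<Sum>r\<in>S. (\<Sum>k\<in>S. \<Sum>m\<in>S. moment 1 i k * moment 1 j k * moment 1 r m))" for i j
  have "(\<Sum>i\<in>S. \<Sum>j\<in>S - {i}. decouple_error i j) \<le>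
    (\<Sum>i\<in>S. \<Sum>j\<in>S. f1 i j / (n * (n - 1)) + 3 * f2 i j / (n * n * (n - 1)) + f3 i j / n + f4 i j / (n * (n - 1)))"
    using n unfolding n_def f1_def f2_def f3_def f4_def
    by (intro sum_off_diagonal_le decouple_error_le add_nonneg_nonneg divide_nonneg_nonneg mult_nonneg_nonneg sum_nonneg moment_nonneg) auto
  also have "\<dots> = sK / (n * (n - 1)) + 3 * (\<Sum>i\<in>S. \<Sum>j\<in>S. \<Sum>r\<in>S. \<Sum>k\<in>S. \<Sum>l\<in>S. \<Sum>m\<in>S. moment 1 i k * moment 1 j l * moment 1 r m) / (n * n * (n - 1))
      + sM / n + sK / (n * (n - 1))"
  proof -
    have "(\<Sum>i\<in>S. \<Sum>j\<in>S. f1 i j) = sK" "(\<Sum>i\<in>S. \<Sum>j\<in>S. f3 i j) = sM" "(\<Sum>i\<in>S. \<Sum>j\<in>S. f4 i j) = sK"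
      unfolding f1_def f3_def f4_def by (rule sK_swap1 sM_swap sK_swap2)+
    then show ?thesis
      unfolding f2_def[symmetric] by (simp only: sum.distrib sum_divide_distrib[symmetric] sum_distrib_left[symmetric])
  qed
  also have "\<dots> \<le> sK / (n * (n - 1)) + 3 * (n * sG) / (n * n * (n - 1)) + sM / n + sK / (n * (n - 1))"
    using cube_le_sG n unfolding n_def by (intro add_mono divide_right_mono mult_left_mono) auto
  also have "3 * (n * sG) / (n * n * (n - 1)) = 3 * sG / (n * (n - 1))" using n by simp
  finally show ?thesis by (simp add: add_divide_distrib)
qed

text \<open>Besides the cubes, an exchange contributes one full and one half term with the two
  columns p i and p j, averaging to \<open>sC\<close>, and one full and one half term with the
  single column p j, averaging to \<open>sD\<close>; hence 3 / 2 in both places. The cubes occur n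
  times per row, once for j = i and n - 1 times for the other j, which cancels the n of the
  mean.\<close>

lemma sum_swap_error_le:
  defines "n \<equiv> real (card S)"
  shows "(\<Sum>i\<in>S. perm_mean S (\<lambda>p. moment 3 i (p i) / 2 + (\<Sum>j\<in>S - {i}. swap_error i j p)))
    \<le> sA / 2 + 3 / 2 * sC / (n * (n - 1)) + 3 / 2 * sD / n"
proof -
  have n: "n \<ge> 2" using card_S by (simp add: n_def)
  have cube: "perm_mean S (\<lambda>p. moment 3 i (p j) / 2) = (\<Sum>k\<in>S. moment 3 i k) / (2 * n)" if "j \<in> S" for i j
    using perm_mean_point[OF finite_S that, of "\<lambda>k. moment 3 i k / 2"] by (simp add: n_def sum_divide_distrib[symmetric])
  define B where "B i j = (\<Sum>k\<in>S. \<Sum>l\<in>S. moment 2 i k * moment 1 j l) / (n * (n - 1))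
      + 1 / 2 * ((\<Sum>k\<in>S. \<Sum>l\<in>S. moment 1 i k * moment 2 j l) / (n * (n - 1)))
      + 1 / 2 * ((\<Sum>k\<in>S. moment 1 i k * moment 2 j k) / n)
      + (\<Sum>k\<in>S. moment 2 i k * moment 1 j k) / n" for i j
  have other: "perm_mean S (swap_error i j) \<le> (\<Sum>k\<in>S. moment 3 i k) / (2 * n) + B i j"
    if ij: "i \<in> S" "j \<in> S" "i \<noteq> j" for i j
  proof -
    have a: "perm_mean S (\<lambda>p. moment 2 i (p j) * moment 1 j (p i)) \<le> (\<Sum>k\<in>S. \<Sum>l\<in>S. moment 2 i k * moment 1 j l) / (n * (n - 1))"
      unfolding n_def using ij finite_S moment_nonneg
      by (intro perm_mean_two_le[where \<phi> = "\<lambda>k l. moment 2 i k * moment 1 j l"]) auto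
    have b: "perm_mean S (\<lambda>p. moment 1 i (p j) * moment 2 j (p i)) \<le> (\<Sum>k\<in>S. \<Sum>l\<in>S. moment 1 i k * moment 2 j l) / (n * (n - 1))"
      unfolding n_def using ij finite_S moment_nonneg
      by (intro perm_mean_two_le[where \<phi> = "\<lambda>k l. moment 1 i k * moment 2 j l"]) auto
    have c: "perm_mean S (\<lambda>p. moment 1 i (p j) * moment 2 j (p j)) = (\<Sum>k\<in>S. moment 1 i k * moment 2 j k) / n"
      unfolding n_def using ij finite_S by (intro perm_mean_point[where \<phi> = "\<lambda>k. moment 1 i k * moment 2 j k"])
    have d: "perm_mean S (\<lambda>p. moment 2 i (p j) * moment 1 j (p j)) = (\<Sum>k\<in>S. moment 2 i k * moment 1 j k) / n"
      unfolding n_def using ij finite_S by (intro perm_mean_point[where \<phi> = "\<lambda>k. moment 2 i k * moment 1 j k"])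
    have "perm_mean S (swap_error i j) = perm_mean S (\<lambda>p. moment 3 i (p j) / 2)
        + (perm_mean S (\<lambda>p. moment 2 i (p j) * moment 1 j (p i))
        + 1 / 2 * perm_mean S (\<lambda>p. moment 1 i (p j) * moment 2 j (p i))
        + 1 / 2 * perm_mean S (\<lambda>p. moment 1 i (p j) * moment 2 j (p j))
        + perm_mean S (\<lambda>p. moment 2 i (p j) * moment 1 j (p j)))"
      unfolding perm_mean_cmult[symmetric] perm_mean_add[symmetric] by (simp add: swap_error_def[abs_def] add_ac)
    also have "\<dots> \<le> (\<Sum>k\<in>S. moment 3 i k) / (2 * n) + B i j"
      unfolding B_def cube[OF ij(2)] c d
      by (intro add_mono mult_left_mono a b order_refl) simp
    finally show ?thesis .
  qed
  have "(\<Sum>i\<in>S. perm_mean S (\<lambda>p. moment 3 i (p i) / 2 + (\<Sum>j\<in>S - {i}. swap_error i j p)))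
      = (\<Sum>i\<in>S. (\<Sum>k\<in>S. moment 3 i k) / (2 * n)) + (\<Sum>i\<in>S. \<Sum>j\<in>S - {i}. perm_mean S (swap_error i j))"
    by (simp add: perm_mean_add perm_mean_sum cube sum.distrib)
  also have "(\<Sum>i\<in>S. \<Sum>j\<in>S - {i}. perm_mean S (swap_error i j))
      \<le> (\<Sum>i\<in>S. \<Sum>j\<in>S - {i}. (\<Sum>k\<in>S. moment 3 i k) / (2 * n) + B i j)"
    using other by (intro sum_mono) auto
  also have "\<dots> = (\<Sum>i\<in>S. (n - 1) * ((\<Sum>k\<in>S. moment 3 i k) / (2 * n))) + (\<Sum>i\<in>S. \<Sum>j\<in>S - {i}. B i j)"
    using card_S by (simp add: sum.distrib n_def of_nat_diff)
  also have "(\<Sum>i\<in>S. \<Sum>j\<in>S - {i}. B i j) \<le> (\<Sum>i\<in>S. \<Sum>j\<in>S. B i j)"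
    using n unfolding B_def
    by (intro sum_off_diagonal_le add_nonneg_nonneg divide_nonneg_nonneg mult_nonneg_nonneg sum_nonneg moment_nonneg) auto
  also have "\<dots> = sC / (n * (n - 1)) + 1 / 2 * (sC / (n * (n - 1))) + 1 / 2 * (sD / n) + sD / n"
    unfolding B_def
    by (simp only: sum.distrib sum_divide_distrib[symmetric] sum_distrib_left[symmetric, of "1 / 2"] sC_swap sD_swap sC_def[symmetric] sD_def[symmetric])
  also have "(\<Sum>i\<in>S. (\<Sum>k\<in>S. moment 3 i k) / (2 * n)) + ((\<Sum>i\<in>S. (n - 1) * ((\<Sum>k\<in>S. moment 3 i k) / (2 * n)))
      + (sC / (n * (n - 1)) + 1 / 2 * (sC / (n * (n - 1))) + 1 / 2 * (sD / n) + sD / n))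
      = sA / (2 * n) + (n - 1) * (sA / (2 * n)) + 3 / 2 * sC / (n * (n - 1)) + 3 / 2 * sD / n"
    unfolding sA_def by (simp add: sum_distrib_left[symmetric] sum_divide_distrib[symmetric])
  also have "sA / (2 * n) + (n - 1) * (sA / (2 * n)) = sA / 2" using n by (simp add: field_simps)
  finally show ?thesis by simp
qed

text \<open>In the last part of \<open>row_error\<close> the product sums of means are estimated by
  first moments. Each is multiplied by the average of row i and by that of row j, both of which lead
  to \<open>sE\<close>; with the factor 2 of polarization this makes \<open>4 * sE\<close>.\<close>

lemma sum_row_error_le:
  defines "n \<equiv> real (card S)"
  shows "(\<Sum>i\<in>S. row_error i) / n \<le> sA / (2 * n) + 3 / 2 * sC / (n\<^sup>2 * (n - 1)) + 3 / 2 * sD / n\<^sup>2 + sB / n\<^sup>2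
    + 2 * (2 * sK + 3 * sG) / (n\<^sup>2 * (n - 1)\<^sup>2) + 2 * sM / (n\<^sup>2 * (n - 1)) + 4 * sE / (n\<^sup>2 * (n - 1))"
proof -
  have n: "n \<ge> 2" using card_S by (simp add: n_def)
  define v where "v i j = (\<Sum>k\<in>S. mean i k * mean j k)" for i j
  have point: "perm_mean S (\<lambda>p. moment 1 i (p j)) = (\<Sum>l\<in>S. moment 1 i l) / n" if "j \<in> S" for i j
    using perm_mean_point[OF finite_S that, of "moment 1 i"] by (simp add: n_def)
  have B: "(\<Sum>i\<in>S. (\<Sum>k\<in>S. moment 2 i k) * perm_mean S (\<lambda>p. moment 1 i (p i))) = sB / n"
  proof -
    have "(\<Sum>i\<in>S. (\<Sum>k\<in>S. moment 2 i k) * perm_mean S (\<lambda>p. moment 1 i (p i)))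
        = (\<Sum>i\<in>S. (\<Sum>k\<in>S. moment 2 i k) * (\<Sum>l\<in>S. moment 1 i l) / n)"
      by (intro sum.cong) (simp_all only: point times_divide_eq_right)
    then show ?thesis unfolding sB_def by (simp only: sum_divide_distrib sum_product)
  qed
  have "(\<Sum>i\<in>S. \<Sum>j\<in>S - {i}. \<bar>v i j\<bar> / (n - 1) * (2 * perm_mean S (\<lambda>p. moment 1 i (p i) + moment 1 j (p j))))
      \<le> (\<Sum>i\<in>S. \<Sum>j\<in>S. 2 / (n * (n - 1)) * ((\<Sum>k\<in>S. moment 1 i k * moment 1 j k) * ((\<Sum>l\<in>S. moment 1 i l) + (\<Sum>l\<in>S. moment 1 j l))))"
  proof (rule sum_off_diagonal_le)
    fix i j assume ij: "i \<in> S" "j \<in> S" "i \<noteq> j"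
    have "\<bar>v i j\<bar> \<le> (\<Sum>k\<in>S. \<bar>mean i k * mean j k\<bar>)" unfolding v_def by (rule sum_abs)
    also have "\<dots> \<le> (\<Sum>k\<in>S. moment 1 i k * moment 1 j k)"
      unfolding abs_mult using abs_mean_le moment_nonneg by (intro sum_mono mult_mono) auto
    finally have "\<bar>v i j\<bar> / (n - 1) * (2 * perm_mean S (\<lambda>p. moment 1 i (p i) + moment 1 j (p j)))
        \<le> (\<Sum>k\<in>S. moment 1 i k * moment 1 j k) / (n - 1) * (2 * perm_mean S (\<lambda>p. moment 1 i (p i) + moment 1 j (p j)))"
      using n by (intro mult_right_mono divide_right_mono) (auto simp del: One_nat_def simp: perm_mean_add point ij intro!: sum_nonneg moment_nonneg divide_nonneg_nonneg add_nonneg_nonneg)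
    also have "\<dots> = 2 / (n * (n - 1)) * ((\<Sum>k\<in>S. moment 1 i k * moment 1 j k) * ((\<Sum>l\<in>S. moment 1 i l) + (\<Sum>l\<in>S. moment 1 j l)))"
      by (simp add: perm_mean_add point ij add_divide_distrib[symmetric] del: One_nat_def) (simp add: algebra_simps del: One_nat_def)
    finally show "\<bar>v i j\<bar> / (n - 1) * (2 * perm_mean S (\<lambda>p. moment 1 i (p i) + moment 1 j (p j))) \<le> \<dots>" .
  qed (use n in \<open>intro mult_nonneg_nonneg divide_nonneg_nonneg add_nonneg_nonneg sum_nonneg moment_nonneg; simp\<close>)
  also have "\<dots> = 2 / (n * (n - 1)) * (\<Sum>i\<in>S. \<Sum>j\<in>S. (\<Sum>k\<in>S. moment 1 i k * moment 1 j k) * ((\<Sum>l\<in>S. moment 1 i l) + (\<Sum>l\<in>S. moment 1 j l)))"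
    by (simp only: sum_distrib_left[symmetric])
  also have "(\<Sum>i\<in>S. \<Sum>j\<in>S. (\<Sum>k\<in>S. moment 1 i k * moment 1 j k) * ((\<Sum>l\<in>S. moment 1 i l) + (\<Sum>l\<in>S. moment 1 j l))) = 2 * sE"
    by (simp only: distrib_left sum_product sum.distrib sE_swap1 sE_swap2)
  finally have E: "(\<Sum>i\<in>S. \<Sum>j\<in>S - {i}. \<bar>v i j\<bar> / (n - 1) * (2 * perm_mean S (\<lambda>p. moment 1 i (p i) + moment 1 j (p j))))
      \<le> 4 * sE / (n * (n - 1))" by simp
  have "(\<Sum>i\<in>S. \<Sum>j\<in>S - {i}. 2 / (n - 1) * decouple_error i j) = 2 / (n - 1) * (\<Sum>i\<in>S. \<Sum>j\<in>S - {i}. decouple_error i j)"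
    by (simp only: sum_distrib_left)
  also have "\<dots> \<le> 2 / (n - 1) * ((2 * sK + 3 * sG) / (n * (n - 1)) + sM / n)"
    using n sum_decouple_error_le unfolding n_def by (intro mult_left_mono) auto
  also have "\<dots> = 2 * (2 * sK + 3 * sG) / (n * (n - 1)\<^sup>2) + 2 * sM / (n * (n - 1))"
    unfolding distrib_left[of "2 / (n - 1)"] by (simp add: power2_eq_square mult_ac)
  finally have D: "(\<Sum>i\<in>S. \<Sum>j\<in>S - {i}. 2 / (n - 1) * decouple_error i j) \<le> 2 * (2 * sK + 3 * sG) / (n * (n - 1)\<^sup>2) + 2 * sM / (n * (n - 1))" .
  have "(\<Sum>i\<in>S. row_error i) = (\<Sum>i\<in>S. perm_mean S (\<lambda>p. moment 3 i (p i) / 2 + (\<Sum>j\<in>S - {i}. swap_error i j p)))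
    + (\<Sum>i\<in>S. (\<Sum>k\<in>S. moment 2 i k) * perm_mean S (\<lambda>p. moment 1 i (p i)))
    + ((\<Sum>i\<in>S. \<Sum>j\<in>S - {i}. 2 / (n - 1) * decouple_error i j)
      + (\<Sum>i\<in>S. \<Sum>j\<in>S - {i}. \<bar>v i j\<bar> / (n - 1) * (2 * perm_mean S (\<lambda>p. moment 1 i (p i) + moment 1 j (p j)))))"
    unfolding row_error_def v_def n_def by (simp only: sum.distrib)
  also have "\<dots> \<le> sA / 2 + 3 / 2 * sC / (n * (n - 1)) + 3 / 2 * sD / n + sB / n
    + (2 * (2 * sK + 3 * sG) / (n * (n - 1)\<^sup>2) + 2 * sM / (n * (n - 1)) + 4 * sE / (n * (n - 1)))"
    using sum_swap_error_le D E unfolding B n_def[symmetric] by linarith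
  finally have "(\<Sum>i\<in>S. row_error i) / n \<le> (sA / 2 + 3 / 2 * sC / (n * (n - 1)) + 3 / 2 * sD / n + sB / n
    + (2 * (2 * sK + 3 * sG) / (n * (n - 1)\<^sup>2) + 2 * sM / (n * (n - 1)) + 4 * sE / (n * (n - 1)))) / n"
    using n by (intro divide_right_mono) auto
  also have "\<dots> = sA / (2 * n) + 3 / 2 * sC / (n\<^sup>2 * (n - 1)) + 3 / 2 * sD / n\<^sup>2 + sB / n\<^sup>2
    + 2 * (2 * sK + 3 * sG) / (n\<^sup>2 * (n - 1)\<^sup>2) + 2 * sM / (n\<^sup>2 * (n - 1)) + 4 * sE / (n\<^sup>2 * (n - 1))"
    by (simp add: add_divide_distrib power2_eq_square mult_ac)
  finally show ?thesis .
qed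

end

section \<open>Gaussian integration by parts\<close>

text \<open>Only the vanishing of a boundary term at infinity is at stake, so the crude chain |x|
  \<le> 1 + x^2 / 2 \<le> exp (x^2 / 2) suffices.\<close>

lemma std_normal_density_le: "std_normal_density x \<le> \<bar>inverse x\<bar>" if "x \<noteq> 0"
proof -
  have "\<bar>x\<bar> \<le> 1 + x\<^sup>2 / 2" using sum_squares_bound[of "\<bar>x\<bar>" 1] by simp
  also have "\<dots> \<le> exp (x\<^sup>2 / 2)" by (rule exp_ge_add_one_self)
  finally have "inverse (exp (x\<^sup>2 / 2)) \<le> inverse \<bar>x\<bar>" using that by (intro le_imp_inverse_le) auto
  moreover have "1 / sqrt (2 * pi) \<le> 1" using pi_gt3 by (simp add: real_le_rsqrt)
  ultimately have "1 / sqrt (2 * pi) * inverse (exp (x\<^sup>2 / 2)) \<le> 1 * inverse \<bar>x\<bar>"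
    by (intro mult_mono) auto
  then show ?thesis by (simp add: std_normal_density_def exp_minus)
qed

text \<open>As the derivative of the density is - t times the density, the difference of the two
  integrands is the derivative of density times h, and a bounded h makes the boundary terms
  vanish.\<close>

lemma std_normal_integration_by_parts:
  fixes h h' :: "real \<Rightarrow> real"
  assumes h: "\<And>t. (h has_real_derivative h' t) (at t)" and cont: "continuous_on UNIV h'"
    and bounds: "\<And>t. \<bar>h t\<bar> \<le> C" "\<And>t. \<bar>h' t\<bar> \<le> C"
  shows "(\<integral>t. std_normal_density t * (t * h t) \<partial>lborel) = (\<integral>t. std_normal_density t * h' t \<partial>lborel)"
proof -
  let ?\<phi> = std_normal_density
  have cont_h: "continuous_on UNIV h"
    using h by (intro continuous_at_imp_continuous_on) (auto intro: DERIV_isCont)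
  note [measurable] = borel_measurable_continuous_onI[OF cont_h] borel_measurable_continuous_onI[OF cont]
  have \<phi>': "(?\<phi> has_real_derivative - t * ?\<phi> t) (at t)" for t
    unfolding std_normal_density_def by (auto intro!: derivative_eq_intros simp: field_simps)
  have int1: "integrable lborel (\<lambda>t. ?\<phi> t * (t * h t))"
  proof (rule Bochner_Integration.integrable_bound)
    show "integrable lborel (\<lambda>t. C * (?\<phi> t * \<bar>t\<bar> ^ 1))"
      using integrable_std_normal_moment_abs[of 1] by (intro integrable_mult_right) auto
    have "\<bar>?\<phi> t * (t * h t)\<bar> \<le> C * (?\<phi> t * \<bar>t\<bar>)" for t
      using mult_right_mono[OF bounds(1)[of t], of "?\<phi> t * \<bar>t\<bar>"] by (simp add: abs_mult mult_ac)
    then show "AE t in lborel. norm (?\<phi> t * (t * h t)) \<le> norm (C * (?\<phi> t * \<bar>t\<bar> ^ 1))"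
      by (intro AE_I2) (simp, meson abs_ge_self order_trans)
  qed simp
  have int2: "integrable lborel (\<lambda>t. ?\<phi> t * h' t)"
  proof (rule Bochner_Integration.integrable_bound)
    show "integrable lborel (\<lambda>t. C * ?\<phi> t)" by simp
    have "\<bar>?\<phi> t * h' t\<bar> \<le> C * ?\<phi> t" for t
      using mult_right_mono[OF bounds(2)[of t], of "?\<phi> t"] by (simp add: abs_mult mult_ac)
    then show "AE t in lborel. norm (?\<phi> t * h' t) \<le> norm (C * ?\<phi> t)"
      by (intro AE_I2) (simp, meson abs_ge_self order_trans)
  qed simp
  have lim: "((\<lambda>t. ?\<phi> t * h t) \<longlongrightarrow> 0) at_infinity"
  proof (rule Lim_null_comparison)
    have "\<bar>?\<phi> t * h t\<bar> \<le> C * \<bar>inverse t\<bar>" if "t \<noteq> 0" for t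
      using mult_mono[OF bounds(1)[of t] std_normal_density_le[OF that]] bounds(1)[of t] abs_ge_zero[of "h t"]
      by (simp add: abs_mult mult.commute)
    then show "\<forall>\<^sub>F t in at_infinity. norm (?\<phi> t * h t) \<le> C * \<bar>inverse t\<bar>"
      unfolding eventually_at_infinity by (intro exI[of _ 1]) auto
    have "((\<lambda>t::real. C * \<bar>inverse t\<bar>) \<longlongrightarrow> C * \<bar>0\<bar>) at_infinity"
      by (intro tendsto_intros tendsto_inverse_0)
    then show "((\<lambda>t::real. C * \<bar>inverse t\<bar>) \<longlongrightarrow> 0) at_infinity" by simp
  qed
  have "(LBINT t=-\<infinity>..\<infinity>. ?\<phi> t * h' t - ?\<phi> t * (t * h t)) = 0 - 0"
  proof (rule interval_integral_FTC_integrable[where F = "\<lambda>t. ?\<phi> t * h t"])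
    show "((\<lambda>t. ?\<phi> t * h t) has_vector_derivative ?\<phi> t * h' t - ?\<phi> t * (t * h t)) (at t)" for t
      unfolding has_real_derivative_iff_has_vector_derivative[symmetric]
      by (rule DERIV_cong[OF DERIV_mult[OF \<phi>' h]]) (simp add: algebra_simps)
    show "isCont (\<lambda>t. ?\<phi> t * h' t - ?\<phi> t * (t * h t)) t" for t
      using cont cont_h by (auto intro!: continuous_intros DERIV_isCont[OF \<phi>'] simp: continuous_on_eq_continuous_at)
    show "set_integrable lborel (einterval (-\<infinity>) \<infinity>) (\<lambda>t. ?\<phi> t * h' t - ?\<phi> t * (t * h t))"
      using int1 int2 by (simp add: set_integrable_def)
    show "(((\<lambda>t. ?\<phi> t * h t) \<circ> real_of_ereal) \<longlongrightarrow> 0) (at_right (-\<infinity>))"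
      "(((\<lambda>t. ?\<phi> t * h t) \<circ> real_of_ereal) \<longlongrightarrow> 0) (at_left \<infinity>)"
      unfolding ereal_tendsto_simps using lim at_bot_le_at_infinity at_top_le_at_infinity by (meson tendsto_mono)+
  qed simp
  then have "(\<integral>t. ?\<phi> t * h' t - ?\<phi> t * (t * h t) \<partial>lborel) = 0"
    by (simp add: interval_lebesgue_integral_def set_lebesgue_integral_def)
  then show ?thesis using int1 int2 by simp
qed

text \<open>Fubini for two blocks of an independent family: block \<open>B\<close> is frozen at a
  value y under its law, while block \<open>A\<close> stays on the original space. This permits a
  one-dimensional argument in a single coordinate.\<close>

lemma (in prob_space) integral_split_pair:
  fixes Z :: "'i \<Rightarrow> 'a \<Rightarrow> real" and H :: "('i \<Rightarrow> real) \<times> ('i \<Rightarrow> real) \<Rightarrow> real"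
  assumes ind: "indep_vars (\<lambda>_. borel) Z I" and AB: "A \<inter> B = {}" "A \<subseteq> I" "B \<subseteq> I"
    and H: "H \<in> borel_measurable (Pi\<^sub>M A (\<lambda>_. borel) \<Otimes>\<^sub>M Pi\<^sub>M B (\<lambda>_. borel))"
    and int: "integrable M (\<lambda>\<omega>. H (\<lambda>i\<in>A. Z i \<omega>, \<lambda>i\<in>B. Z i \<omega>))"
  shows "(\<integral>\<omega>. H (\<lambda>i\<in>A. Z i \<omega>, \<lambda>i\<in>B. Z i \<omega>) \<partial>M)
    = (\<integral>y. (\<integral>\<omega>. H (\<lambda>i\<in>A. Z i \<omega>, y) \<partial>M) \<partial>distr M (Pi\<^sub>M B (\<lambda>_. borel)) (\<lambda>\<omega>. \<lambda>i\<in>B. Z i \<omega>))"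
proof -
  let ?A = "\<lambda>\<omega>. \<lambda>i\<in>A. Z i \<omega>" and ?B = "\<lambda>\<omega>. \<lambda>i\<in>B. Z i \<omega>"
  let ?PA = "Pi\<^sub>M A (\<lambda>_. borel :: real measure)" and ?PB = "Pi\<^sub>M B (\<lambda>_. borel :: real measure)"
  have "indep_var ?PA ?A ?PB ?B" by (rule indep_var_restrict[OF ind AB])
  then have rv [measurable]: "?A \<in> M \<rightarrow>\<^sub>M ?PA" "?B \<in> M \<rightarrow>\<^sub>M ?PB"
    and eq: "distr M ?PA ?A \<Otimes>\<^sub>M distr M ?PB ?B = distr M (?PA \<Otimes>\<^sub>M ?PB) (\<lambda>x. (?A x, ?B x))"
    by (simp_all add: indep_var_distribution_eq)
  interpret A: prob_space "distr M ?PA ?A" by (rule prob_space_distr) simp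
  interpret B: prob_space "distr M ?PB ?B" by (rule prob_space_distr) simp
  interpret AB: pair_prob_space "distr M ?PA ?A" "distr M ?PB ?B" ..
  have int': "integrable (distr M ?PA ?A \<Otimes>\<^sub>M distr M ?PB ?B) H"
    unfolding eq using int H by (subst integrable_distr_eq) auto
  have "(\<integral>\<omega>. H (?A \<omega>, ?B \<omega>) \<partial>M) = (\<integral>x. H x \<partial>(distr M ?PA ?A \<Otimes>\<^sub>M distr M ?PB ?B))"
    unfolding eq using H by (subst integral_distr) auto
  also have "\<dots> = (\<integral>y. \<integral>x. H (x, y) \<partial>distr M ?PA ?A \<partial>distr M ?PB ?B)"
    using AB.integral_snd[of "\<lambda>x y. H (x, y)"] int' by simp
  also have "\<dots> = (\<integral>y. \<integral>\<omega>. H (?A \<omega>, y) \<partial>M \<partial>distr M ?PB ?B)"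
  proof (rule Bochner_Integration.integral_cong)
    fix y assume y: "y \<in> space (distr M ?PB ?B)"
    have "(\<lambda>x. H (x, y)) \<in> borel_measurable ?PA"
      using y by (intro measurable_compose[OF measurable_Pair2' H]) simp
    then show "(\<integral>x. H (x, y) \<partial>distr M ?PA ?A) = (\<integral>\<omega>. H (?A \<omega>, y) \<partial>M)"
      by (subst integral_distr) auto
  qed simp
  finally show ?thesis .
qed

context lipschitz_hessian
begin

text \<open>All variables except Z q are frozen, and the one-dimensional identity is applied along
  the line through \<open>w y\<close> in direction a q.\<close>

lemma gaussian_integration_by_parts:
  fixes Z :: "'i::countable \<Rightarrow> 'a \<Rightarrow> real" and a :: "'i \<Rightarrow> 'v"
  assumes N: "prob_space N" and I: "finite I" "q \<in> I"
    and ind: "prob_space.indep_vars N (\<lambda>_. borel) Z I"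
    and normal: "\<And>i. i \<in> I \<Longrightarrow> distributed N lborel (Z i) std_normal_density"
  shows "(\<integral>\<eta>. Z q \<eta> * F1 (\<Sum>i\<in>I. Z i \<eta> *\<^sub>R a i) (a q) \<partial>N) = (\<integral>\<eta>. F2 (\<Sum>i\<in>I. Z i \<eta> *\<^sub>R a i) (a q) (a q) \<partial>N)"
proof -
  interpret N: prob_space N by fact
  define B where "B = I - {q}"
  have Z [measurable]: "Z i \<in> borel_measurable N" if "i \<in> I" for i
    using distributed_measurable[OF normal[OF that]] by simp
  \<comment> \<open>The case distinction inside the coefficients keeps \<open>I\<close> as index
    set, so that joint measurability in x and y reduces to that of the coefficients.\<close>
  define g where "g x y = (\<Sum>i\<in>I. (if i = q then x q else y i :: real) *\<^sub>R a i)" for x y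
  define w where "w y = (\<Sum>i\<in>B. y i *\<^sub>R a i)" for y
  have I_eq: "I = insert q B" "q \<notin> B" "finite B" using I by (auto simp: B_def)
  have g: "g x y = w y + x q *\<^sub>R a q" for x y
    unfolding g_def w_def I_eq(1) using I_eq(2,3) by (subst sum.insert) (auto intro!: sum.cong simp: add.commute)
  have G: "(\<Sum>i\<in>I. Z i \<eta> *\<^sub>R a i) = g (\<lambda>i\<in>{q}. Z i \<eta>) (\<lambda>i\<in>B. Z i \<eta>)" for \<eta>
    unfolding g w_def I_eq(1) using I_eq(2,3) by (subst sum.insert) (auto intro!: sum.cong simp: add.commute)
  let ?P = "Pi\<^sub>M {q} (\<lambda>_. borel :: real measure) \<Otimes>\<^sub>M Pi\<^sub>M B (\<lambda>_. borel :: real measure)"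
  have meas: "(\<lambda>z. f (g (fst z) (snd z)) :: real) \<in> borel_measurable ?P" if "continuous_on UNIV f" for f :: "'v \<Rightarrow> real"
    unfolding g_def
  proof (rule borel_measurable_continuous_sum[OF that])
    fix i assume "i \<in> I"
    then show "(\<lambda>z. if i = q then fst z q else snd z i) \<in> borel_measurable ?P"
      by (cases "i = q") (auto simp: I_eq intro!: measurable_compose[OF measurable_fst] measurable_compose[OF measurable_snd] measurable_component_singleton)
  qed
  have measZ: "(\<lambda>\<eta>. f (\<Sum>i\<in>I. Z i \<eta> *\<^sub>R a i) :: real) \<in> borel_measurable N" if "continuous_on UNIV f" for f :: "'v \<Rightarrow> real"
    using that Z by (rule borel_measurable_continuous_sum)
  have intZ: "integrable N (Z q)"
    using distributed_integrable_var[OF normal[OF I(2)]] integrable_std_normal_moment[of 1] by simp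
  have parts: "(\<integral>\<eta>. Z q \<eta> * F1 (w y + Z q \<eta> *\<^sub>R a q) (a q) \<partial>N) = (\<integral>\<eta>. F2 (w y + Z q \<eta> *\<^sub>R a q) (a q) (a q) \<partial>N)" for y
  proof -
    have cont: "continuous_on UNIV (\<lambda>t. F1 (w y + t *\<^sub>R a q) (a q))" "continuous_on UNIV (\<lambda>t. F2 (w y + t *\<^sub>R a q) (a q) (a q))"
      by (auto intro!: continuous_on_compose2[OF F1_continuous] continuous_on_compose2[OF F2_continuous] continuous_intros)
    note [measurable] = cont[THEN borel_measurable_continuous_onI]
    have "(\<integral>\<eta>. Z q \<eta> * F1 (w y + Z q \<eta> *\<^sub>R a q) (a q) \<partial>N) = (\<integral>t. std_normal_density t * (t * F1 (w y + t *\<^sub>R a q) (a q)) \<partial>lborel)"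
      using distributed_integral[OF normal[OF I(2)], of "\<lambda>t. t * F1 (w y + t *\<^sub>R a q) (a q)"] by simp
    also have "\<dots> = (\<integral>t. std_normal_density t * F2 (w y + t *\<^sub>R a q) (a q) (a q) \<partial>lborel)"
    proof (rule std_normal_integration_by_parts[where C = "max (K * norm (a q)) (K * (norm (a q))\<^sup>2)"])
      show "\<bar>F1 (w y + t *\<^sub>R a q) (a q)\<bar> \<le> max (K * norm (a q)) (K * (norm (a q))\<^sup>2)" for t
        using F1_bound[of "w y + t *\<^sub>R a q" "a q"] by linarith
      show "\<bar>F2 (w y + t *\<^sub>R a q) (a q) (a q)\<bar> \<le> max (K * norm (a q)) (K * (norm (a q))\<^sup>2)" for t
        using F2_diag_bound[of "w y + t *\<^sub>R a q" "a q"] by linarith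
    qed (auto intro: F1_has_derivative_line cont)
    also have "\<dots> = (\<integral>\<eta>. F2 (w y + Z q \<eta> *\<^sub>R a q) (a q) (a q) \<partial>N)"
      using distributed_integral[OF normal[OF I(2)], of "\<lambda>t. F2 (w y + t *\<^sub>R a q) (a q) (a q)"] by simp
    finally show ?thesis .
  qed
  have AB: "{q} \<inter> B = {}" "{q} \<subseteq> I" "B \<subseteq> I" using I by (auto simp: B_def)
  define D where "D = distr N (Pi\<^sub>M B (\<lambda>_. borel)) (\<lambda>\<eta>. \<lambda>i\<in>B. Z i \<eta>)"
  have "(\<integral>\<eta>. Z q \<eta> * F1 (\<Sum>i\<in>I. Z i \<eta> *\<^sub>R a i) (a q) \<partial>N)
      = (\<integral>y. (\<integral>\<eta>. Z q \<eta> * F1 (w y + Z q \<eta> *\<^sub>R a q) (a q) \<partial>N) \<partial>D)"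
  proof -
    have H: "(\<lambda>z. fst z q * F1 (g (fst z) (snd z)) (a q)) \<in> borel_measurable ?P"
      by (intro borel_measurable_times meas F1_continuous measurable_compose[OF measurable_fst] measurable_component_singleton) simp
    have "integrable N (\<lambda>\<eta>. Z q \<eta> * F1 (\<Sum>i\<in>I. Z i \<eta> *\<^sub>R a i) (a q))"
    proof (rule Bochner_Integration.integrable_bound)
      show "integrable N (\<lambda>\<eta>. (K * norm (a q)) * Z q \<eta>)" using intZ by simp
      have "\<bar>Z q \<eta>\<bar> * \<bar>F1 (\<Sum>i\<in>I. Z i \<eta> *\<^sub>R a i) (a q)\<bar> \<le> \<bar>Z q \<eta>\<bar> * (K * norm (a q))" for \<eta>
        by (intro mult_left_mono F1_bound) simp
      then show "AE \<eta> in N. norm (Z q \<eta> * F1 (\<Sum>i\<in>I. Z i \<eta> *\<^sub>R a i) (a q)) \<le> norm ((K * norm (a q)) * Z q \<eta>)"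
        using K_nonneg by (intro AE_I2) (simp add: abs_mult mult_ac)
      show "(\<lambda>\<eta>. Z q \<eta> * F1 (\<Sum>i\<in>I. Z i \<eta> *\<^sub>R a i) (a q)) \<in> borel_measurable N"
        using I by (intro borel_measurable_times measZ F1_continuous Z)
    qed
    then show ?thesis
      using N.integral_split_pair[OF ind AB H] unfolding D_def by (simp add: G g)
  qed
  also have "\<dots> = (\<integral>y. (\<integral>\<eta>. F2 (w y + Z q \<eta> *\<^sub>R a q) (a q) (a q) \<partial>N) \<partial>D)"
    by (simp only: parts)
  also have "\<dots> = (\<integral>\<eta>. F2 (\<Sum>i\<in>I. Z i \<eta> *\<^sub>R a i) (a q) (a q) \<partial>N)"
  proof -
    have H: "(\<lambda>z. F2 (g (fst z) (snd z)) (a q) (a q)) \<in> borel_measurable ?P"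
      by (intro meas F2_continuous)
    have "integrable N (\<lambda>\<eta>. F2 (\<Sum>i\<in>I. Z i \<eta> *\<^sub>R a i) (a q) (a q))"
      by (rule N.integrable_const_bound[where B = "K * (norm (a q))\<^sup>2"]) (auto intro!: measZ F2_continuous F2_diag_bound)
    then show ?thesis
      using N.integral_split_pair[OF ind AB H] unfolding D_def by (simp add: G g)
  qed
  finally show ?thesis .
qed

end

section \<open>Expansion of the Gaussian mixture\<close>

context random_array
begin

lemma moment_1_power2_le:
  assumes "i \<in> S" "k \<in> S"
  shows "(moment 1 i k)\<^sup>2 \<le> moment 2 i k"
proof -
  let ?m = "moment 1 i k"
  have "(\<integral>\<omega>. 2 * ?m * \<bar>X i k \<omega>\<bar> ^ 1 - ?m\<^sup>2 \<partial>M) \<le> (\<integral>\<omega>. \<bar>X i k \<omega>\<bar> ^ 2 \<partial>M)"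
  proof (rule integral_mono)
    show "2 * ?m * \<bar>X i k \<omega>\<bar> ^ 1 - ?m\<^sup>2 \<le> \<bar>X i k \<omega>\<bar> ^ 2" for \<omega>
      using zero_le_power2[of "\<bar>X i k \<omega>\<bar> - ?m"] by (simp add: power2_diff algebra_simps)
  qed (intro Bochner_Integration.integrable_diff integrable_mult_right integrable_moment integrable_const assms; simp)+
  moreover have "(\<integral>\<omega>. 2 * ?m * \<bar>X i k \<omega>\<bar> ^ 1 - ?m\<^sup>2 \<partial>M) = 2 * ?m * ?m - ?m\<^sup>2"
    using integrable_moment[OF assms, of 1] by (simp add: prob_space moment_def)
  ultimately show ?thesis by (simp add: moment_def power2_eq_square)
qed

text \<open>Let m be the first moment. Integrating 3 m x^2 \<le> 2 x^3 + m^3 leaves the cube of m,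
  which the tangent to x^3 at m bounds by the third moment, as in Jensen's inequality. Both
  polynomial inequalities are (x - m)^2 times a nonnegative linear factor.\<close>

lemma moment_2_mult_moment_1_le:
  assumes "i \<in> S" "k \<in> S"
  shows "moment 2 i k * moment 1 i k \<le> moment 3 i k"
proof -
  define m where "m = moment 1 i k"
  have m: "m \<ge> 0" by (simp only: m_def moment_nonneg)
  have young: "3 * m * x\<^sup>2 \<le> 2 * x ^ 3 + m ^ 3" if "x \<ge> 0" for x
  proof -
    have "0 \<le> (x - m)\<^sup>2 * (2 * x + m)" using that m by simp
    then show ?thesis by (simp add: power2_eq_square power3_eq_cube algebra_simps)
  qed
  have tangent: "3 * m\<^sup>2 * x - 2 * m ^ 3 \<le> x ^ 3" if "x \<ge> 0" for x
  proof -
    have "0 \<le> (x - m)\<^sup>2 * (x + 2 * m)" using that m by simp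
    then show ?thesis by (simp add: power2_eq_square power3_eq_cube algebra_simps)
  qed
  have int: "integrable M (\<lambda>\<omega>. \<bar>X i k \<omega>\<bar>)" "integrable M (\<lambda>\<omega>. \<bar>X i k \<omega>\<bar>\<^sup>2)" "integrable M (\<lambda>\<omega>. \<bar>X i k \<omega>\<bar> ^ 3)"
    using integrable_moment[OF assms, of 1] integrable_moment[OF assms, of 2] integrable_moment[OF assms, of 3] by auto
  have "(\<integral>\<omega>. 3 * m * \<bar>X i k \<omega>\<bar>\<^sup>2 \<partial>M) \<le> (\<integral>\<omega>. 2 * \<bar>X i k \<omega>\<bar> ^ 3 + m ^ 3 \<partial>M)"
    using int young[of "\<bar>X i k _\<bar>"] by (intro integral_mono) auto
  then have 1: "3 * m * moment 2 i k \<le> 2 * moment 3 i k + m ^ 3"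
    using int by (simp add: prob_space moment_def)
  have "(\<integral>\<omega>. 3 * m\<^sup>2 * \<bar>X i k \<omega>\<bar> - 2 * m ^ 3 \<partial>M) \<le> (\<integral>\<omega>. \<bar>X i k \<omega>\<bar> ^ 3 \<partial>M)"
    using int tangent[of "\<bar>X i k _\<bar>"] by (intro integral_mono) auto
  then have "3 * m\<^sup>2 * m - 2 * m ^ 3 \<le> moment 3 i k"
    using int by (simp add: prob_space moment_def m_def)
  then have "m ^ 3 \<le> moment 3 i k" by (simp add: power2_eq_square power3_eq_cube)
  with 1 have "3 * (m * moment 2 i k) \<le> 3 * moment 3 i k" by linarith
  then show ?thesis by (simp add: m_def mult.commute)
qed

end

context array_expansion
begin

text \<open>This is \<open>D\<close> for fixed Gaussian weights \<open>\<theta>\<close>, with the entries in \<open>A\<close> left out.\<close>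

definition V :: "(nat \<times> nat \<Rightarrow> real) \<Rightarrow> (nat \<times> nat) set \<Rightarrow> 'a \<Rightarrow> 'v" where
  "V \<theta> A \<omega> = (\<Sum>q\<in>S \<times> S - A. (\<theta> q * X (fst q) (snd q) \<omega>) *\<^sub>R e (fst q))"

lemma V_measurable: "continuous_on UNIV G \<Longrightarrow> (\<lambda>\<omega>. G (V \<theta> A \<omega>) :: real) \<in> borel_measurable M"
  unfolding V_def by (rule borel_measurable_continuous_sum) (auto intro!: borel_measurable_times X_measurable)

text \<open>\<open>U\<close> depends on the entries in \<open>A\<close> only and is independent of
  the reduced sum \<open>V \<theta> A\<close>. Both E[U G(V)] and E[U] E[G(V)], with V the full sum,
  are compared with E[U] E[G(\<open>V \<theta> A\<close>)]. This accounts for the two parts of the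
  bound, a joint moment and a product of moments.\<close>

lemma leave_out:
  fixes u :: "(nat \<times> nat \<Rightarrow> real) \<Rightarrow> real" and U :: "'a \<Rightarrow> real" and G :: "'v \<Rightarrow> real"
  assumes A: "A \<subseteq> S \<times> S" and u: "u \<in> borel_measurable (Pi\<^sub>M A (\<lambda>_. borel))"
    and U: "\<And>\<omega>. U \<omega> = u (\<lambda>(i, k)\<in>A. X i k \<omega>)" and int: "integrable M U"
    and int_X: "\<And>q. q \<in> A \<Longrightarrow> integrable M (\<lambda>\<omega>. \<bar>U \<omega>\<bar> * \<bar>X (fst q) (snd q) \<omega>\<bar>)"
    and G: "continuous_on UNIV G" and G_bound: "\<And>w. \<bar>G w\<bar> \<le> C"
    and G_lipschitz: "\<And>v w. \<bar>G v - G w\<bar> \<le> \<kappa> * norm (v - w)" and "\<kappa> \<ge> 0"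
  shows "\<bar>(\<integral>\<omega>. U \<omega> * G (V \<theta> {} \<omega>) \<partial>M) - (\<integral>\<omega>. U \<omega> \<partial>M) * (\<integral>\<omega>. G (V \<theta> {} \<omega>) \<partial>M)\<bar>
    \<le> \<kappa> * \<epsilon> * (\<Sum>q\<in>A. \<bar>\<theta> q\<bar> * ((\<integral>\<omega>. \<bar>U \<omega>\<bar> * \<bar>X (fst q) (snd q) \<omega>\<bar> \<partial>M) + (\<integral>\<omega>. \<bar>U \<omega>\<bar> \<partial>M) * moment 1 (fst q) (snd q)))"
proof -
  define D where "D \<omega> = (\<Sum>q\<in>A. \<bar>\<theta> q\<bar> * \<bar>X (fst q) (snd q) \<omega>\<bar>)" for \<omega>
  have int_abs: "integrable M (\<lambda>\<omega>. \<bar>X (fst q) (snd q) \<omega>\<bar>)" if "q \<in> A" for q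
    using A that by (intro integrable_abs_X) auto
  have int_D: "integrable M D" unfolding D_def[abs_def] using int_abs by (intro Bochner_Integration.integrable_sum integrable_mult_right)
  have E_D: "(\<integral>\<omega>. D \<omega> \<partial>M) = (\<Sum>q\<in>A. \<bar>\<theta> q\<bar> * moment 1 (fst q) (snd q))"
    unfolding D_def using int_abs by (simp add: integral_abs_X)
  have int_UD: "integrable M (\<lambda>\<omega>. \<bar>U \<omega>\<bar> * D \<omega>)"
    unfolding D_def sum_distrib_left mult.left_commute[of "\<bar>U _\<bar>"] using int_X by (intro Bochner_Integration.integrable_sum integrable_mult_right)
  have E_UD: "(\<integral>\<omega>. \<bar>U \<omega>\<bar> * D \<omega> \<partial>M) = (\<Sum>q\<in>A. \<bar>\<theta> q\<bar> * (\<integral>\<omega>. \<bar>U \<omega>\<bar> * \<bar>X (fst q) (snd q) \<omega>\<bar> \<partial>M))"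
    unfolding D_def sum_distrib_left mult.left_commute[of "\<bar>U _\<bar>"] using int_X by simp
  have "norm (V \<theta> {} \<omega> - V \<theta> A \<omega>) \<le> \<epsilon> * D \<omega>" for \<omega>
  proof -
    have "V \<theta> {} \<omega> - V \<theta> A \<omega> = (\<Sum>q\<in>A. (\<theta> q * X (fst q) (snd q) \<omega>) *\<^sub>R e (fst q))"
      unfolding V_def using A finite_S by (simp add: sum_diff)
    also have "norm (\<Sum>q\<in>A. (\<theta> q * X (fst q) (snd q) \<omega>) *\<^sub>R e (fst q)) \<le> (\<Sum>q\<in>A. \<epsilon> * (\<bar>\<theta> q\<bar> * \<bar>X (fst q) (snd q) \<omega>\<bar>))"
      using norm_scaled_e by (intro order_trans[OF norm_sum] sum_mono) (simp add: abs_mult[symmetric])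
    finally show ?thesis by (simp add: D_def sum_distrib_left)
  qed
  then have close: "\<bar>G (V \<theta> {} \<omega>) - G (V \<theta> A \<omega>)\<bar> \<le> \<kappa> * \<epsilon> * D \<omega>" for \<omega>
    using order_trans[OF G_lipschitz mult_left_mono[OF _ \<open>\<kappa> \<ge> 0\<close>]] by (metis mult.assoc)
  have int_G: "integrable M (\<lambda>\<omega>. G (V \<theta> B \<omega>))" "integrable M (\<lambda>\<omega>. U \<omega> * G (V \<theta> B \<omega>))" for B
    using G_bound V_measurable[OF G] by (auto intro!: integrable_const_bound[where B = C] integral_mult_bounded[OF int])
  have 1: "\<bar>(\<integral>\<omega>. U \<omega> * G (V \<theta> {} \<omega>) \<partial>M) - (\<integral>\<omega>. U \<omega> * G (V \<theta> A \<omega>) \<partial>M)\<bar> \<le> (\<integral>\<omega>. \<kappa> * \<epsilon> * (\<bar>U \<omega>\<bar> * D \<omega>) \<partial>M)"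
  proof (rule abs_integral_diff_le)
    show "\<bar>U \<omega> * G (V \<theta> {} \<omega>) - U \<omega> * G (V \<theta> A \<omega>)\<bar> \<le> \<kappa> * \<epsilon> * (\<bar>U \<omega>\<bar> * D \<omega>)" for \<omega>
      using mult_left_mono[OF close[of \<omega>], of "\<bar>U \<omega>\<bar>"] by (simp add: right_diff_distrib[symmetric] abs_mult mult_ac)
  qed (use int_G int_UD in auto)
  have 2: "\<bar>(\<integral>\<omega>. G (V \<theta> {} \<omega>) \<partial>M) - (\<integral>\<omega>. G (V \<theta> A \<omega>) \<partial>M)\<bar> \<le> (\<integral>\<omega>. \<kappa> * \<epsilon> * D \<omega> \<partial>M)"
    using close int_G int_D by (intro abs_integral_diff_le) auto
  have split: "(\<integral>\<omega>. U \<omega> * G (V \<theta> A \<omega>) \<partial>M) = (\<integral>\<omega>. U \<omega> \<partial>M) * (\<integral>\<omega>. G (V \<theta> A \<omega>) \<partial>M)"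
  proof (rule split_rows(1))
    let ?v = "\<lambda>x. G (\<Sum>q\<in>S \<times> S - A. (\<theta> q * x q) *\<^sub>R e (fst q))"
    show "A \<inter> (S \<times> S - A) = {}" "A \<subseteq> S \<times> S" "S \<times> S - A \<subseteq> S \<times> S" using A by auto
    show "?v \<in> borel_measurable (Pi\<^sub>M (S \<times> S - A) (\<lambda>_. borel))"
      using G by (intro borel_measurable_continuous_sum) (auto intro!: borel_measurable_times measurable_component_singleton)
    show "G (V \<theta> A \<omega>) = ?v (\<lambda>(i, k)\<in>S \<times> S - A. X i k \<omega>)" for \<omega>
      by (auto simp: V_def intro!: arg_cong[where f = G] sum.cong)
  qed (fact u U int int_G)+
  have "\<bar>\<integral>\<omega>. U \<omega> \<partial>M\<bar> \<le> (\<integral>\<omega>. \<bar>U \<omega>\<bar> \<partial>M)" by (rule integral_abs_bound)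
  then have "\<bar>\<integral>\<omega>. U \<omega> \<partial>M\<bar> * \<bar>(\<integral>\<omega>. G (V \<theta> {} \<omega>) \<partial>M) - (\<integral>\<omega>. G (V \<theta> A \<omega>) \<partial>M)\<bar>
      \<le> (\<integral>\<omega>. \<bar>U \<omega>\<bar> \<partial>M) * (\<integral>\<omega>. \<kappa> * \<epsilon> * D \<omega> \<partial>M)"
    using 2 by (rule mult_mono) auto
  then have "\<bar>(\<integral>\<omega>. U \<omega> \<partial>M) * (\<integral>\<omega>. G (V \<theta> {} \<omega>) \<partial>M) - (\<integral>\<omega>. U \<omega> * G (V \<theta> A \<omega>) \<partial>M)\<bar>
      \<le> \<kappa> * \<epsilon> * ((\<integral>\<omega>. \<bar>U \<omega>\<bar> \<partial>M) * (\<integral>\<omega>. D \<omega> \<partial>M))"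
    unfolding split abs_mult[symmetric] right_diff_distrib[symmetric] by (simp add: mult_ac)
  with 1 have "\<bar>(\<integral>\<omega>. U \<omega> * G (V \<theta> {} \<omega>) \<partial>M) - (\<integral>\<omega>. U \<omega> \<partial>M) * (\<integral>\<omega>. G (V \<theta> {} \<omega>) \<partial>M)\<bar>
      \<le> \<kappa> * \<epsilon> * (\<integral>\<omega>. \<bar>U \<omega>\<bar> * D \<omega> \<partial>M) + \<kappa> * \<epsilon> * ((\<integral>\<omega>. \<bar>U \<omega>\<bar> \<partial>M) * (\<integral>\<omega>. D \<omega> \<partial>M))"
    by simp
  also have "\<dots> = \<kappa> * \<epsilon> * (\<Sum>q\<in>A. \<bar>\<theta> q\<bar> * ((\<integral>\<omega>. \<bar>U \<omega>\<bar> * \<bar>X (fst q) (snd q) \<omega>\<bar> \<partial>M) + (\<integral>\<omega>. \<bar>U \<omega>\<bar> \<partial>M) * moment 1 (fst q) (snd q)))"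
    unfolding E_D E_UD by (simp add: sum.distrib distrib_left sum_distrib_left mult_ac)
  finally show ?thesis .
qed

text \<open>Each of the two comparisons of \<open>leave_out\<close> costs at most
  \<open>moment 3 i l\<close>; the directions coincide, so polarization adds nothing.\<close>

lemma leave_out_square:
  assumes "i \<in> S" "l \<in> S"
  shows "\<bar>(\<integral>\<omega>. (X i l \<omega>)\<^sup>2 * F2 (V \<theta> {} \<omega>) (e i) (e i) \<partial>M) - moment 2 i l * (\<integral>\<omega>. F2 (V \<theta> {} \<omega>) (e i) (e i) \<partial>M)\<bar>
    \<le> L * \<epsilon> ^ 3 * (\<bar>\<theta> (i, l)\<bar> * (2 * moment 3 i l))"
proof -
  have 3: "\<bar>(x::real)\<^sup>2\<bar> * \<bar>x\<bar> = \<bar>x\<bar> ^ 3" for x by (simp add: power2_eq_square power3_eq_cube abs_mult)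
  have "\<bar>(\<integral>\<omega>. (X i l \<omega>)\<^sup>2 * F2 (V \<theta> {} \<omega>) (e i) (e i) \<partial>M) - (\<integral>\<omega>. (X i l \<omega>)\<^sup>2 \<partial>M) * (\<integral>\<omega>. F2 (V \<theta> {} \<omega>) (e i) (e i) \<partial>M)\<bar>
    \<le> L * \<epsilon>\<^sup>2 * \<epsilon> * (\<Sum>q\<in>{(i, l)}. \<bar>\<theta> q\<bar> * ((\<integral>\<omega>. \<bar>(X i l \<omega>)\<^sup>2\<bar> * \<bar>X (fst q) (snd q) \<omega>\<bar> \<partial>M) + (\<integral>\<omega>. \<bar>(X i l \<omega>)\<^sup>2\<bar> \<partial>M) * moment 1 (fst q) (snd q)))"
  proof (rule leave_out[where u = "\<lambda>x. (x (i, l))\<^sup>2" and C = "2 * K * \<epsilon>\<^sup>2"])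
    show "integrable M (\<lambda>\<omega>. (X i l \<omega>)\<^sup>2)" using integrable_moment[OF assms, of 2] by simp
    show "integrable M (\<lambda>\<omega>. \<bar>(X i l \<omega>)\<^sup>2\<bar> * \<bar>X (fst q) (snd q) \<omega>\<bar>)" if "q \<in> {(i, l)}" for q
      using that X_third_moment[OF assms] unfolding 3[symmetric] by simp
  qed (use assms L_nonneg in \<open>auto intro!: borel_measurable_power measurable_component_singleton F2_continuous F2_e_bound F2_e_diag_lipschitz\<close>)
  also have "\<dots> = L * \<epsilon> ^ 3 * (\<bar>\<theta> (i, l)\<bar> * (moment 3 i l + moment 2 i l * moment 1 i l))"
    using 3 by (simp add: moment_def power2_eq_square power3_eq_cube)
  also have "\<dots> \<le> L * \<epsilon> ^ 3 * (\<bar>\<theta> (i, l)\<bar> * (2 * moment 3 i l))"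
    using moment_2_mult_moment_1_le[OF assms] L_nonneg \<epsilon>_nonneg by (intro mult_left_mono) auto
  finally show ?thesis by (simp add: moment_def)
qed

text \<open>The factor 4 is 2 for polarization times 2 for the two comparisons of
  \<open>leave_out\<close>; the second comparison is dominated by the first because a squared first
  absolute moment is at most the second moment.\<close>

lemma leave_out_product:
  assumes "i \<in> S" "j \<in> S" "i \<noteq> j" "l \<in> S"
  shows "\<bar>(\<integral>\<omega>. X i l \<omega> * X j l \<omega> * F2 (V \<theta> {} \<omega>) (e i) (e j) \<partial>M) - mean i l * mean j l * (\<integral>\<omega>. F2 (V \<theta> {} \<omega>) (e i) (e j) \<partial>M)\<bar>
    \<le> L * \<epsilon> ^ 3 * (4 * (\<bar>\<theta> (i, l)\<bar> * (moment 2 i l * moment 1 j l) + \<bar>\<theta> (j, l)\<bar> * (moment 1 i l * moment 2 j l)))"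
proof -
  have ne: "(i, l) \<noteq> (j, l)" using assms by simp
  note m11 = moment_mult[OF assms(1,4,2,4) ne, of 1 1] and m21 = moment_mult[OF assms(1,4,2,4) ne, of 2 1]
    and m12 = moment_mult[OF assms(1,4,2,4) ne, of 1 2]
  have m: "(\<integral>\<omega>. \<bar>X i l \<omega>\<bar> ^ 1 * \<bar>X j l \<omega>\<bar> ^ 1 \<partial>M) = moment 1 i l * moment 1 j l"
    "(\<integral>\<omega>. \<bar>X i l \<omega>\<bar> ^ 2 * \<bar>X j l \<omega>\<bar> ^ 1 \<partial>M) = moment 2 i l * moment 1 j l"
    "(\<integral>\<omega>. \<bar>X i l \<omega>\<bar> ^ 1 * \<bar>X j l \<omega>\<bar> ^ 2 \<partial>M) = moment 1 i l * moment 2 j l"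
    by (intro m11(1) m21(1) m12(1); simp)+
  have a: "\<bar>(x::real) * y\<bar> * \<bar>x\<bar> = \<bar>x\<bar> ^ 2 * \<bar>y\<bar> ^ 1" "\<bar>x * y\<bar> * \<bar>y\<bar> = \<bar>x\<bar> ^ 1 * \<bar>y\<bar> ^ 2" "\<bar>x * y\<bar> = \<bar>x\<bar> ^ 1 * \<bar>y\<bar> ^ 1" for x y
    by (simp_all add: power2_eq_square abs_mult)
  have "\<bar>(\<integral>\<omega>. (X i l \<omega> * X j l \<omega>) * F2 (V \<theta> {} \<omega>) (e i) (e j) \<partial>M) - (\<integral>\<omega>. X i l \<omega> * X j l \<omega> \<partial>M) * (\<integral>\<omega>. F2 (V \<theta> {} \<omega>) (e i) (e j) \<partial>M)\<bar>
    \<le> 2 * L * \<epsilon>\<^sup>2 * \<epsilon> * (\<Sum>q\<in>{(i, l), (j, l)}. \<bar>\<theta> q\<bar> * ((\<integral>\<omega>. \<bar>X i l \<omega> * X j l \<omega>\<bar> * \<bar>X (fst q) (snd q) \<omega>\<bar> \<partial>M) + (\<integral>\<omega>. \<bar>X i l \<omega> * X j l \<omega>\<bar> \<partial>M) * moment 1 (fst q) (snd q)))"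
  proof (rule leave_out[where u = "\<lambda>x. x (i, l) * x (j, l)" and C = "2 * K * \<epsilon>\<^sup>2"])
    show "integrable M (\<lambda>\<omega>. X i l \<omega> * X j l \<omega>)" using mean_mult(2)[OF assms(1,4,2,4) ne] .
    show "integrable M (\<lambda>\<omega>. \<bar>X i l \<omega> * X j l \<omega>\<bar> * \<bar>X (fst q) (snd q) \<omega>\<bar>)" if "q \<in> {(i, l), (j, l)}" for q
      using that
    proof
      assume "q = (i, l)"
      then show ?thesis using m21(2) by (simp only: fst_conv snd_conv a(1))
    next
      assume "q \<in> {(j, l)}"
      then have "q = (j, l)" by simp
      then show ?thesis using m12(2) by (simp only: fst_conv snd_conv a(2))
    qed
  qed (use assms L_nonneg in \<open>auto intro!: borel_measurable_times measurable_component_singleton F2_continuous F2_e_bound F2_e_lipschitz\<close>)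
  also have "\<dots> = 2 * L * \<epsilon>\<^sup>2 * \<epsilon> * (\<bar>\<theta> (i, l)\<bar> * (moment 2 i l * moment 1 j l + moment 1 i l * moment 1 j l * moment 1 i l)
      + \<bar>\<theta> (j, l)\<bar> * (moment 1 i l * moment 2 j l + moment 1 i l * moment 1 j l * moment 1 j l))"
  proof -
    have pair: "(\<Sum>q\<in>{(i, l), (j, l)}. f q) = f (i, l) + f (j, l)" for f :: "nat \<times> nat \<Rightarrow> real"
      using ne by simp
    show ?thesis unfolding pair fst_conv snd_conv a(1,2) unfolding a(3) by (simp only: m)
  qed
  also have "\<dots> \<le> 2 * L * \<epsilon>\<^sup>2 * \<epsilon> * (\<bar>\<theta> (i, l)\<bar> * (2 * (moment 2 i l * moment 1 j l)) + \<bar>\<theta> (j, l)\<bar> * (2 * (moment 1 i l * moment 2 j l)))"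
  proof -
    have "moment 1 i l * moment 1 j l * moment 1 i l \<le> moment 2 i l * moment 1 j l"
      using mult_right_mono[OF moment_1_power2_le[OF assms(1,4)] moment_nonneg[of 1 j l]] by (simp add: power2_eq_square mult_ac)
    moreover have "moment 1 i l * moment 1 j l * moment 1 j l \<le> moment 1 i l * moment 2 j l"
      using mult_left_mono[OF moment_1_power2_le[OF assms(2,4)] moment_nonneg[of 1 i l]] by (simp add: power2_eq_square mult_ac)
    ultimately show ?thesis
      using L_nonneg \<epsilon>_nonneg by (intro mult_left_mono add_mono; (linarith | simp))
  qed
  finally show ?thesis
    using mean_mult(1)[OF assms(1,4,2,4) ne] by (simp add: power2_eq_square power3_eq_cube algebra_simps)
qed

end

text \<open>This is the variance identity for a bilinear form: with s the sum of the b i, centring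
  subtracts F2 w s s / n from the sum of the diagonal values. The value F2 w s s is then split into
  diagonal and off-diagonal parts, because these are estimated differently.\<close>

lemma (in lipschitz_hessian) centered_quadratic:
  fixes b :: "nat \<Rightarrow> 'v"
  assumes S: "finite S" "S \<noteq> {}"
  defines "n \<equiv> real (card S)"
  shows "(\<Sum>i\<in>S. F2 w (\<beta> *\<^sub>R (b i - (1 / n) *\<^sub>R (\<Sum>j\<in>S. b j))) (\<beta> *\<^sub>R (b i - (1 / n) *\<^sub>R (\<Sum>j\<in>S. b j))))
    = \<beta>\<^sup>2 * ((1 - 1 / n) * (\<Sum>i\<in>S. F2 w (b i) (b i)) - 1 / n * (\<Sum>i\<in>S. \<Sum>j\<in>S - {i}. F2 w (b i) (b j)))"
proof -
  have n: "n > 0" using S by (simp add: n_def card_gt_0_iff)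
  define s where "s = (\<Sum>j\<in>S. b j)"
  note lin = linear_diff[OF F2_linear] linear_scale[OF F2_linear] linear_diff[OF F2_linear_left] linear_scale[OF F2_linear_left]
  have "F2 w (\<beta> *\<^sub>R (b i - (1 / n) *\<^sub>R s)) (\<beta> *\<^sub>R (b i - (1 / n) *\<^sub>R s))
      = \<beta>\<^sup>2 * (F2 w (b i) (b i) - 2 / n * F2 w (b i) s + 1 / n\<^sup>2 * F2 w s s)" for i
    by (simp add: lin F2_sym[of w s "b i"] power2_eq_square algebra_simps)
  then have "(\<Sum>i\<in>S. F2 w (\<beta> *\<^sub>R (b i - (1 / n) *\<^sub>R s)) (\<beta> *\<^sub>R (b i - (1 / n) *\<^sub>R s)))
      = \<beta>\<^sup>2 * ((\<Sum>i\<in>S. F2 w (b i) (b i)) - 2 / n * (\<Sum>i\<in>S. F2 w (b i) s) + n * (1 / n\<^sup>2 * F2 w s s))"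
    by (simp only: sum_distrib_left[symmetric] sum.distrib sum_subtractf sum_constant n_def mult.left_commute[of "1 / _"])
  also have "(\<Sum>i\<in>S. F2 w (b i) s) = F2 w s s"
    using linear_sum[OF F2_linear_left, of w b S s] by (simp add: s_def)
  also have "\<beta>\<^sup>2 * ((\<Sum>i\<in>S. F2 w (b i) (b i)) - 2 / n * F2 w s s + n * (1 / n\<^sup>2 * F2 w s s))
      = \<beta>\<^sup>2 * ((\<Sum>i\<in>S. F2 w (b i) (b i)) - 1 / n * F2 w s s)"
    using n by (simp add: power2_eq_square field_simps)
  also have "F2 w s s = (\<Sum>i\<in>S. F2 w (b i) (b i)) + (\<Sum>i\<in>S. \<Sum>j\<in>S - {i}. F2 w (b i) (b j))"
  proof -
    have "F2 w s s = (\<Sum>i\<in>S. \<Sum>j\<in>S. F2 w (b i) (b j))"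
      using linear_sum[OF F2_linear_left, of w b S s] linear_sum[OF F2_linear, of w _ b S] by (simp add: s_def)
    also have "\<dots> = (\<Sum>i\<in>S. F2 w (b i) (b i) + (\<Sum>j\<in>S - {i}. F2 w (b i) (b j)))"
      using S by (intro sum.cong sum.remove) auto
    finally show ?thesis by (simp add: sum.distrib)
  qed
  finally show ?thesis
    by (simp add: s_def algebra_simps)
qed

lemma (in pair_prob_space) integrable_mult_pair:
  fixes f :: "'a \<Rightarrow> real" and g :: "'b \<Rightarrow> real"
  assumes "integrable M1 f" "integrable M2 g"
  shows "integrable (M1 \<Otimes>\<^sub>M M2) (\<lambda>x. f (fst x) * g (snd x))"
proof (rule Fubini_integrable)
  have [measurable]: "f \<in> borel_measurable M1" "g \<in> borel_measurable M2" using assms by auto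
  show "(\<lambda>x. f (fst x) * g (snd x)) \<in> borel_measurable (M1 \<Otimes>\<^sub>M M2)" by measurable
  show "integrable M1 (\<lambda>x. \<integral>y. norm (f (fst (x, y)) * g (snd (x, y))) \<partial>M2)"
    using assms by (simp add: abs_mult)
  show "AE x in M1. integrable M2 (\<lambda>y. f (fst (x, y)) * g (snd (x, y)))"
    using assms by simp
qed

text \<open>The normal weights get a space \<open>N\<close> of their own, so that their independence
  of the array is built into the product and Fubini can freeze either factor. In the application
  \<open>N\<close> is a second copy of \<open>M\<close>.\<close>

locale gaussian_array = array_expansion M X S F1 F2 K L e \<epsilon> + N: prob_space N
  for M :: "'a measure" and X S and F1 :: "'v::real_normed_vector \<Rightarrow> 'v \<Rightarrow> real" and F2 K L e \<epsilon>
    and N :: "'b measure" +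
  fixes Z :: "nat \<times> nat \<Rightarrow> 'b \<Rightarrow> real"
  assumes Z_indep: "N.indep_vars (\<lambda>_. borel) Z (S \<times> S)"
    and Z_normal: "\<And>q. q \<in> S \<times> S \<Longrightarrow> distributed N lborel (Z q) std_normal_density"
begin

sublocale MN: pair_prob_space M N ..

definition "\<zeta> q \<eta> = Z q \<eta> - 1 / real (card S) * (\<Sum>j\<in>S. Z (j, snd q) \<eta>)"
definition "\<theta> \<eta> q = 1 / sqrt (real (card S) - 1) * \<zeta> q \<eta>"
text \<open>The vector that multiplies the single variable \<open>Z q\<close> once \<open>V\<close>
  is written as a sum over independent weights.\<close>

definition "a q \<omega> = (1 / sqrt (real (card S) - 1)) *\<^sub>R
  (X (fst q) (snd q) \<omega> *\<^sub>R e (fst q) - (1 / real (card S)) *\<^sub>R (\<Sum>j\<in>S. X j (snd q) \<omega> *\<^sub>R e j))"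
definition "G x = V (\<theta> (snd x)) {} (fst x)"

lemma sum_pairs: "(\<Sum>q\<in>S \<times> S. f q) = (\<Sum>l\<in>S. \<Sum>i\<in>S. f (i, l))"
  by (subst sum.swap) (simp add: sum.cartesian_product)

text \<open>Centring the weights of a column amounts to centring the vectors that they multiply:
  both give the sum of the z_i x_i minus 1/n times the product of the two sums. In the second form
  the weights are independent, so integration by parts works one coordinate at a time.\<close>

lemma V_eq: "V (\<theta> \<eta>) {} \<omega> = (\<Sum>q\<in>S \<times> S. Z q \<eta> *\<^sub>R a q \<omega>)"
proof -
  define \<beta> where "\<beta> = 1 / sqrt (real (card S) - 1)"
  define n where "n = real (card S)"
  have "(\<Sum>i\<in>S. (\<theta> \<eta> (i, l) * X i l \<omega>) *\<^sub>R e i) = (\<Sum>i\<in>S. Z (i, l) \<eta> *\<^sub>R a (i, l) \<omega>)" for l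
  proof -
    define t where "t = (\<Sum>j\<in>S. Z (j, l) \<eta>)"
    define s where "s = (\<Sum>j\<in>S. X j l \<omega> *\<^sub>R e j)"
    have "(\<Sum>i\<in>S. (\<theta> \<eta> (i, l) * X i l \<omega>) *\<^sub>R e i)
        = (\<Sum>i\<in>S. (\<beta> * Z (i, l) \<eta>) *\<^sub>R (X i l \<omega> *\<^sub>R e i) - (\<beta> * (1 / n) * t) *\<^sub>R (X i l \<omega> *\<^sub>R e i))"
      by (simp add: \<theta>_def \<zeta>_def \<beta>_def n_def t_def algebra_simps)
    also have "\<dots> = (\<Sum>i\<in>S. (\<beta> * Z (i, l) \<eta>) *\<^sub>R (X i l \<omega> *\<^sub>R e i)) - (\<beta> * (1 / n) * t) *\<^sub>R s"
      by (simp only: sum_subtractf s_def scaleR_sum_right)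
    also have "(\<beta> * (1 / n) * t) *\<^sub>R s = (\<Sum>i\<in>S. (\<beta> * (1 / n) * Z (i, l) \<eta>) *\<^sub>R s)"
      by (simp only: t_def sum_distrib_left scaleR_sum_left)
    also have "(\<Sum>i\<in>S. (\<beta> * Z (i, l) \<eta>) *\<^sub>R (X i l \<omega> *\<^sub>R e i)) - \<dots> = (\<Sum>i\<in>S. Z (i, l) \<eta> *\<^sub>R a (i, l) \<omega>)"
      unfolding sum_subtractf[symmetric]
      by (rule sum.cong) (simp_all add: a_def s_def \<beta>_def n_def scaleR_diff_right mult_ac)
    finally show ?thesis .
  qed
  then show ?thesis by (simp add: V_def sum_pairs)
qed

text \<open>The contraction of \<open>F2 w\<close> with the covariance of the Gaussian sum for a
  given array. Taking means of its coefficients would produce \<open>covariance\<close>, but the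
  array also enters the point w; this is why entries have to be left out.\<close>

definition "\<Psi> w \<omega> = (\<Sum>l\<in>S. 1 / real (card S) * (\<Sum>i\<in>S. (X i l \<omega>)\<^sup>2 * F2 w (e i) (e i))
  - 1 / (real (card S) * (real (card S) - 1)) * (\<Sum>i\<in>S. \<Sum>j\<in>S - {i}. X i l \<omega> * X j l \<omega> * F2 w (e i) (e j)))"

lemma sum_quadratic: "(\<Sum>q\<in>S \<times> S. F2 w (a q \<omega>) (a q \<omega>)) = \<Psi> w \<omega>"
  unfolding sum_pairs \<Psi>_def
proof (rule sum.cong[OF refl])
  fix l
  define n where "n = real (card S)"
  have n: "n \<ge> 2" using card_S by (simp add: n_def)
  have scale: "F2 w (x *\<^sub>R e i) (y *\<^sub>R e j) = x * y * F2 w (e i) (e j)" for x y i j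
    by (simp add: linear_scale[OF F2_linear] linear_scale[OF F2_linear_left])
  have "(\<Sum>i\<in>S. F2 w (a (i, l) \<omega>) (a (i, l) \<omega>)) = (1 / sqrt (n - 1))\<^sup>2 * ((1 - 1 / n) * (\<Sum>i\<in>S. F2 w (X i l \<omega> *\<^sub>R e i) (X i l \<omega> *\<^sub>R e i))
      - 1 / n * (\<Sum>i\<in>S. \<Sum>j\<in>S - {i}. F2 w (X i l \<omega> *\<^sub>R e i) (X j l \<omega> *\<^sub>R e j)))"
    unfolding a_def n_def fst_conv snd_conv using finite_S card_S
    by (intro centered_quadratic[where b = "\<lambda>i. X i l \<omega> *\<^sub>R e i"]) auto
  also have "\<dots> = 1 / (n - 1) * ((1 - 1 / n) * (\<Sum>i\<in>S. (X i l \<omega>)\<^sup>2 * F2 w (e i) (e i))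
        - 1 / n * (\<Sum>i\<in>S. \<Sum>j\<in>S - {i}. X i l \<omega> * X j l \<omega> * F2 w (e i) (e j)))"
    using n by (simp add: scale power_divide power2_eq_square[of "X _ _ _"])
  also have "\<dots> = (1 / (n - 1) * (1 - 1 / n)) * (\<Sum>i\<in>S. (X i l \<omega>)\<^sup>2 * F2 w (e i) (e i))
        - 1 / (n * (n - 1)) * (\<Sum>i\<in>S. \<Sum>j\<in>S - {i}. X i l \<omega> * X j l \<omega> * F2 w (e i) (e j))"
    by (simp only: right_diff_distrib[of "1 / (n - 1)"] mult.assoc[symmetric] times_divide_times_eq mult_1 mult.commute[of "n - 1"])
  \<comment> \<open>Centring n variables loses a fraction 1 / n of the variance, and the
    normalization by sqrt (n - 1) compensates for this.\<close>
  also have "1 / (n - 1) * (1 - 1 / n) = 1 / n" using n by (simp add: field_simps)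
  finally show "(\<Sum>i\<in>S. F2 w (a (i, l) \<omega>) (a (i, l) \<omega>)) = 1 / real (card S) * (\<Sum>i\<in>S. (X i l \<omega>)\<^sup>2 * F2 w (e i) (e i))
      - 1 / (real (card S) * (real (card S) - 1)) * (\<Sum>i\<in>S. \<Sum>j\<in>S - {i}. X i l \<omega> * X j l \<omega> * F2 w (e i) (e j))"
    by (simp only: n_def)
qed

lemma Z_measurable [measurable]: "q \<in> S \<times> S \<Longrightarrow> Z q \<in> borel_measurable N"
  using distributed_measurable[OF Z_normal] by simp

lemma Z_square: "q \<in> S \<times> S \<Longrightarrow> integrable N (\<lambda>\<eta>. (Z q \<eta>)\<^sup>2)" "q \<in> S \<times> S \<Longrightarrow> (\<integral>\<eta>. (Z q \<eta>)\<^sup>2 \<partial>N) = 1"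
proof -
  assume q: "q \<in> S \<times> S"
  have moment: "has_bochner_integral lborel (\<lambda>x. std_normal_density x * x\<^sup>2) 1"
    using std_normal_moment_even[of 1] by (simp add: fact_numeral)
  show "integrable N (\<lambda>\<eta>. (Z q \<eta>)\<^sup>2)"
    using distributed_integrable[OF Z_normal[OF q], of "\<lambda>x. x\<^sup>2"] moment by (simp add: has_bochner_integral_iff)
  show "(\<integral>\<eta>. (Z q \<eta>)\<^sup>2 \<partial>N) = 1"
    using distributed_integral[OF Z_normal[OF q], of "\<lambda>x. x\<^sup>2"] moment by (simp add: has_bochner_integral_iff)
qed

lemma Z_first: "q \<in> S \<times> S \<Longrightarrow> integrable N (Z q)" "q \<in> S \<times> S \<Longrightarrow> (\<integral>\<eta>. Z q \<eta> \<partial>N) = 0"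
proof -
  assume q: "q \<in> S \<times> S"
  show "integrable N (Z q)"
    using distributed_integrable[OF Z_normal[OF q], of "\<lambda>x. x"] integrable_std_normal_moment[of 1] by simp
  show "(\<integral>\<eta>. Z q \<eta> \<partial>N) = 0"
    using distributed_integral[OF Z_normal[OF q], of "\<lambda>x. x"] integral_std_normal_moment_odd[of 0] by simp
qed

lemma Z_product:
  assumes "q \<in> S \<times> S" "r \<in> S \<times> S" 
  shows "integrable N (\<lambda>\<eta>. Z q \<eta> * Z r \<eta>)" "(\<integral>\<eta>. Z q \<eta> * Z r \<eta> \<partial>N) = (if q = r then 1 else 0)"
proof -
  have ne: "integrable N (\<lambda>\<eta>. Z q \<eta> * Z r \<eta>)" "(\<integral>\<eta>. Z q \<eta> * Z r \<eta> \<partial>N) = 0" if "q \<noteq> r"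
    using N.integral_split[OF Z_indep, of "{q}" "{r}" "\<lambda>x. x q" "\<lambda>x. x r"] that assms Z_first
    by (auto simp: measurable_component_singleton)
  show "integrable N (\<lambda>\<eta>. Z q \<eta> * Z r \<eta>)" "(\<integral>\<eta>. Z q \<eta> * Z r \<eta> \<partial>N) = (if q = r then 1 else 0)"
    using ne Z_square assms by (auto simp: power2_eq_square)
qed

lemma \<zeta>_measurable [measurable]: "q \<in> S \<times> S \<Longrightarrow> \<zeta> q \<in> borel_measurable N"
  unfolding \<zeta>_def[abs_def] by (cases q) (auto intro!: borel_measurable_diff borel_measurable_times borel_measurable_sum)

lemma \<zeta>_integrable: "q \<in> S \<times> S \<Longrightarrow> integrable N (\<zeta> q)"
  unfolding \<zeta>_def[abs_def] by (cases q) (auto intro!: Bochner_Integration.integrable_diff integrable_mult_right Bochner_Integration.integrable_sum Z_first)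

text \<open>The centred normal has second moment 1 - 1 / n, and |x| \<le> (1 + x^2) / 2 turns this
  into a bound for the first absolute moment.\<close>

lemma \<zeta>_abs_le:
  assumes "q \<in> S \<times> S"
  shows "(\<integral>\<eta>. \<bar>\<zeta> q \<eta>\<bar> \<partial>N) \<le> 1"
proof -
  obtain i l where q: "q = (i, l)" "i \<in> S" "l \<in> S" using assms by auto
  define n where "n = real (card S)"
  have n: "n \<ge> 2" using card_S by (simp add: n_def)
  have eq: "(\<zeta> q \<eta>)\<^sup>2 = (Z q \<eta>)\<^sup>2 - 2 / n * (\<Sum>j\<in>S. Z q \<eta> * Z (j, l) \<eta>) + 1 / n\<^sup>2 * (\<Sum>j\<in>S. \<Sum>k\<in>S. Z (j, l) \<eta> * Z (k, l) \<eta>)" for \<eta>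
  proof -
    have "(\<zeta> q \<eta>)\<^sup>2 = (Z q \<eta>)\<^sup>2 - 2 / n * (Z q \<eta> * (\<Sum>j\<in>S. Z (j, l) \<eta>)) + 1 / n\<^sup>2 * ((\<Sum>j\<in>S. Z (j, l) \<eta>) * (\<Sum>k\<in>S. Z (k, l) \<eta>))"
      unfolding \<zeta>_def q snd_conv n_def[symmetric] by (simp add: power2_eq_square algebra_simps)
    then show ?thesis unfolding sum_product by (simp only: sum_distrib_left)
  qed
  have int: "integrable N (\<lambda>\<eta>. (Z q \<eta>)\<^sup>2)" "integrable N (\<lambda>\<eta>. \<Sum>j\<in>S. Z q \<eta> * Z (j, l) \<eta>)"
    "integrable N (\<lambda>\<eta>. \<Sum>j\<in>S. \<Sum>k\<in>S. Z (j, l) \<eta> * Z (k, l) \<eta>)"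
    using assms q by (auto intro!: Bochner_Integration.integrable_sum Z_product Z_square)
  have 1: "(\<integral>\<eta>. (\<Sum>j\<in>S. Z q \<eta> * Z (j, l) \<eta>) \<partial>N) = 1"
    using assms q finite_S by (subst Bochner_Integration.integral_sum) (auto simp: Z_product)
  have 2: "(\<integral>\<eta>. (\<Sum>j\<in>S. \<Sum>k\<in>S. Z (j, l) \<eta> * Z (k, l) \<eta>) \<partial>N) = n"
  proof -
    have "(\<integral>\<eta>. (\<Sum>k\<in>S. Z (j, l) \<eta> * Z (k, l) \<eta>) \<partial>N) = 1" if "j \<in> S" for j
      using that q finite_S by (subst Bochner_Integration.integral_sum) (auto simp: Z_product)
    then show ?thesis
      using q by (subst Bochner_Integration.integral_sum) (auto intro!: Bochner_Integration.integrable_sum Z_product simp: n_def)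
  qed
  have int_sq: "integrable N (\<lambda>\<eta>. (\<zeta> q \<eta>)\<^sup>2)"
    unfolding eq using int by (intro Bochner_Integration.integrable_add Bochner_Integration.integrable_diff integrable_mult_right)
  have "(\<integral>\<eta>. (\<zeta> q \<eta>)\<^sup>2 \<partial>N) = 1 - 2 / n + 1 / n\<^sup>2 * n"
    unfolding eq using int Z_square[OF assms] 1 2 by simp
  also have "\<dots> \<le> 1" using n by (simp add: power2_eq_square)
  finally have le: "(\<integral>\<eta>. (\<zeta> q \<eta>)\<^sup>2 \<partial>N) \<le> 1" .
  have "(\<integral>\<eta>. \<bar>\<zeta> q \<eta>\<bar> \<partial>N) \<le> (\<integral>\<eta>. 1 / 2 + 1 / 2 * (\<zeta> q \<eta>)\<^sup>2 \<partial>N)"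
  proof (rule integral_mono)
    show "\<bar>\<zeta> q \<eta>\<bar> \<le> 1 / 2 + 1 / 2 * (\<zeta> q \<eta>)\<^sup>2" for \<eta>
      using sum_squares_bound[of "\<bar>\<zeta> q \<eta>\<bar>" 1] by simp
  qed (use \<zeta>_integrable[OF assms] int_sq in auto)
  also have "\<dots> = 1 / 2 + 1 / 2 * (\<integral>\<eta>. (\<zeta> q \<eta>)\<^sup>2 \<partial>N)" using int_sq by (simp add: N.prob_space)
  finally show ?thesis using le by linarith
qed

text \<open>The cost of leaving out entries for fixed weights. It is linear in the moduli of the
  weights, so that only their first absolute moments are needed when the weights are
  integrated.\<close>

definition "gauss_error \<eta> = (\<Sum>l\<in>S. 1 / real (card S) * (\<Sum>i\<in>S. \<bar>\<theta> \<eta> (i, l)\<bar> * (2 * moment 3 i l))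
  + 1 / (real (card S) * (real (card S) - 1)) * (\<Sum>i\<in>S. \<Sum>j\<in>S - {i}.
      4 * (\<bar>\<theta> \<eta> (i, l)\<bar> * (moment 2 i l * moment 1 j l) + \<bar>\<theta> \<eta> (j, l)\<bar> * (moment 1 i l * moment 2 j l))))"

lemma square_F2_integrable: "i \<in> S \<Longrightarrow> l \<in> S \<Longrightarrow> integrable M (\<lambda>\<omega>. (X i l \<omega>)\<^sup>2 * F2 (V \<theta>' A \<omega>) (e i) (e i))"
  using integrable_moment[of i l 2] by (intro integral_mult_bounded[OF _ V_measurable[OF F2_continuous] F2_e_bound]) simp

lemma product_F2_integrable:
  "i \<in> S \<Longrightarrow> j \<in> S \<Longrightarrow> i \<noteq> j \<Longrightarrow> l \<in> S \<Longrightarrow> integrable M (\<lambda>\<omega>. X i l \<omega> * X j l \<omega> * F2 (V \<theta>' A \<omega>) (e i) (e j))"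
  using mean_mult(2)[of i l j l] by (intro integral_mult_bounded[OF _ V_measurable[OF F2_continuous] F2_e_bound]) simp

lemma \<Psi>_leave_out:
  "\<bar>(\<integral>\<omega>. \<Psi> (V (\<theta> \<eta>) {} \<omega>) \<omega> \<partial>M) - (\<Sum>i\<in>S. \<Sum>j\<in>S. covariance i j * (\<integral>\<omega>. F2 (V (\<theta> \<eta>) {} \<omega>) (e i) (e j) \<partial>M))\<bar>
    \<le> L * \<epsilon> ^ 3 * gauss_error \<eta>"
proof -
  define n where "n = real (card S)"
  have n: "n \<ge> 2" using card_S by (simp add: n_def)
  define H where "H i j = (\<integral>\<omega>. F2 (V (\<theta> \<eta>) {} \<omega>) (e i) (e j) \<partial>M)" for i j
  define A where "A i l = (\<integral>\<omega>. (X i l \<omega>)\<^sup>2 * F2 (V (\<theta> \<eta>) {} \<omega>) (e i) (e i) \<partial>M)" for i l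
  define B where "B i j l = (\<integral>\<omega>. X i l \<omega> * X j l \<omega> * F2 (V (\<theta> \<eta>) {} \<omega>) (e i) (e j) \<partial>M)" for i j l
  have 1: "(\<integral>\<omega>. \<Psi> (V (\<theta> \<eta>) {} \<omega>) \<omega> \<partial>M) = (\<Sum>l\<in>S. 1 / n * (\<Sum>i\<in>S. A i l) - 1 / (n * (n - 1)) * (\<Sum>i\<in>S. \<Sum>j\<in>S - {i}. B i j l))"
  proof -
    have int: "integrable M (\<lambda>\<omega>. \<Sum>i\<in>S. (X i l \<omega>)\<^sup>2 * F2 (V (\<theta> \<eta>) {} \<omega>) (e i) (e i))"
      "integrable M (\<lambda>\<omega>. \<Sum>i\<in>S. \<Sum>j\<in>S - {i}. X i l \<omega> * X j l \<omega> * F2 (V (\<theta> \<eta>) {} \<omega>) (e i) (e j))" if "l \<in> S" for l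
      using that by (auto intro!: Bochner_Integration.integrable_sum square_F2_integrable product_F2_integrable)
    have "(\<integral>\<omega>. \<Psi> (V (\<theta> \<eta>) {} \<omega>) \<omega> \<partial>M) = (\<Sum>l\<in>S. 1 / n * (\<integral>\<omega>. (\<Sum>i\<in>S. (X i l \<omega>)\<^sup>2 * F2 (V (\<theta> \<eta>) {} \<omega>) (e i) (e i)) \<partial>M)
        - 1 / (n * (n - 1)) * (\<integral>\<omega>. (\<Sum>i\<in>S. \<Sum>j\<in>S - {i}. X i l \<omega> * X j l \<omega> * F2 (V (\<theta> \<eta>) {} \<omega>) (e i) (e j)) \<partial>M))"
      unfolding \<Psi>_def n_def[symmetric] using int by (subst Bochner_Integration.integral_sum) auto
    also have "\<dots> = (\<Sum>l\<in>S. 1 / n * (\<Sum>i\<in>S. A i l) - 1 / (n * (n - 1)) * (\<Sum>i\<in>S. \<Sum>j\<in>S - {i}. B i j l))"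
    proof (rule sum.cong[OF refl])
      fix l assume l: "l \<in> S"
      have "(\<integral>\<omega>. (\<Sum>i\<in>S. (X i l \<omega>)\<^sup>2 * F2 (V (\<theta> \<eta>) {} \<omega>) (e i) (e i)) \<partial>M) = (\<Sum>i\<in>S. A i l)"
        unfolding A_def using l by (intro Bochner_Integration.integral_sum square_F2_integrable)
      moreover have "(\<integral>\<omega>. (\<Sum>i\<in>S. \<Sum>j\<in>S - {i}. X i l \<omega> * X j l \<omega> * F2 (V (\<theta> \<eta>) {} \<omega>) (e i) (e j)) \<partial>M) = (\<Sum>i\<in>S. \<Sum>j\<in>S - {i}. B i j l)"
        unfolding B_def using l
        by (subst Bochner_Integration.integral_sum; (intro sum.cong refl Bochner_Integration.integral_sum Bochner_Integration.integrable_sum)?)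
          (auto intro!: product_F2_integrable)
      ultimately show "1 / n * (\<integral>\<omega>. (\<Sum>i\<in>S. (X i l \<omega>)\<^sup>2 * F2 (V (\<theta> \<eta>) {} \<omega>) (e i) (e i)) \<partial>M)
        - 1 / (n * (n - 1)) * (\<integral>\<omega>. (\<Sum>i\<in>S. \<Sum>j\<in>S - {i}. X i l \<omega> * X j l \<omega> * F2 (V (\<theta> \<eta>) {} \<omega>) (e i) (e j)) \<partial>M)
        = 1 / n * (\<Sum>i\<in>S. A i l) - 1 / (n * (n - 1)) * (\<Sum>i\<in>S. \<Sum>j\<in>S - {i}. B i j l)" by simp
    qed
    finally show ?thesis .
  qed
  \<comment> \<open>The entries of \<open>covariance\<close> are themselves sums over columns;
    writing the contraction column by column matches it with \<open>\<Psi>\<close>.\<close>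
  have 2: "(\<Sum>i\<in>S. \<Sum>j\<in>S. covariance i j * H i j)
      = (\<Sum>l\<in>S. 1 / n * (\<Sum>i\<in>S. moment 2 i l * H i i) - 1 / (n * (n - 1)) * (\<Sum>i\<in>S. \<Sum>j\<in>S - {i}. mean i l * mean j l * H i j))"
  proof -
    have "(\<Sum>j\<in>S. covariance i j * H i j) = (\<Sum>l\<in>S. 1 / n * (moment 2 i l * H i i) - 1 / (n * (n - 1)) * (\<Sum>j\<in>S - {i}. mean i l * mean j l * H i j))"
      if i: "i \<in> S" for i
    proof -
      have "(\<Sum>j\<in>S. covariance i j * H i j) = covariance i i * H i i + (\<Sum>j\<in>S - {i}. covariance i j * H i j)"
        using finite_S i by (rule sum.remove)
      also have "covariance i i * H i i = (\<Sum>l\<in>S. 1 / n * (moment 2 i l * H i i))"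
        by (simp add: covariance_def n_def sum_distrib_right sum_divide_distrib)
      also have "(\<Sum>j\<in>S - {i}. covariance i j * H i j) = (\<Sum>j\<in>S - {i}. \<Sum>l\<in>S. - (1 / (n * (n - 1)) * (mean i l * mean j l * H i j)))"
        using card_S by (intro sum.cong) (auto simp: covariance_def n_def sum_distrib_right sum_divide_distrib sum_negf of_nat_diff)
      also have "\<dots> = (\<Sum>l\<in>S. - (1 / (n * (n - 1)) * (\<Sum>j\<in>S - {i}. mean i l * mean j l * H i j)))"
        by (subst sum.swap) (simp only: sum_distrib_left sum_negf)
      finally show ?thesis by (simp only: sum.distrib diff_conv_add_uminus)
    qed
    then have "(\<Sum>i\<in>S. \<Sum>j\<in>S. covariance i j * H i j)
        = (\<Sum>i\<in>S. \<Sum>l\<in>S. 1 / n * (moment 2 i l * H i i) - 1 / (n * (n - 1)) * (\<Sum>j\<in>S - {i}. mean i l * mean j l * H i j))"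
      by (rule sum.cong[OF refl])
    also have "\<dots> = (\<Sum>l\<in>S. \<Sum>i\<in>S. 1 / n * (moment 2 i l * H i i) - 1 / (n * (n - 1)) * (\<Sum>j\<in>S - {i}. mean i l * mean j l * H i j))"
      by (rule sum.swap)
    finally show ?thesis by (simp only: sum_subtractf sum_distrib_left)
  qed
  have "\<bar>(1 / n * (\<Sum>i\<in>S. A i l) - 1 / (n * (n - 1)) * (\<Sum>i\<in>S. \<Sum>j\<in>S - {i}. B i j l))
      - (1 / n * (\<Sum>i\<in>S. moment 2 i l * H i i) - 1 / (n * (n - 1)) * (\<Sum>i\<in>S. \<Sum>j\<in>S - {i}. mean i l * mean j l * H i j))\<bar>
    \<le> L * \<epsilon> ^ 3 * (1 / n * (\<Sum>i\<in>S. \<bar>\<theta> \<eta> (i, l)\<bar> * (2 * moment 3 i l))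
      + 1 / (n * (n - 1)) * (\<Sum>i\<in>S. \<Sum>j\<in>S - {i}.
      4 * (\<bar>\<theta> \<eta> (i, l)\<bar> * (moment 2 i l * moment 1 j l) + \<bar>\<theta> \<eta> (j, l)\<bar> * (moment 1 i l * moment 2 j l))))" if l: "l \<in> S" for l
  proof -
    have "\<bar>\<Sum>i\<in>S. A i l - moment 2 i l * H i i\<bar> \<le> (\<Sum>i\<in>S. L * \<epsilon> ^ 3 * (\<bar>\<theta> \<eta> (i, l)\<bar> * (2 * moment 3 i l)))"
      unfolding A_def H_def using l by (intro order_trans[OF sum_abs] sum_mono leave_out_square)
    then have "1 / n * \<bar>\<Sum>i\<in>S. A i l - moment 2 i l * H i i\<bar> \<le> 1 / n * (\<Sum>i\<in>S. L * \<epsilon> ^ 3 * (\<bar>\<theta> \<eta> (i, l)\<bar> * (2 * moment 3 i l)))"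
      using n by (intro mult_left_mono) auto
    moreover have "\<bar>\<Sum>i\<in>S. \<Sum>j\<in>S - {i}. B i j l - mean i l * mean j l * H i j\<bar> \<le> (\<Sum>i\<in>S. \<Sum>j\<in>S - {i}. L * \<epsilon> ^ 3 * (4 * (\<bar>\<theta> \<eta> (i, l)\<bar> * (moment 2 i l * moment 1 j l) + \<bar>\<theta> \<eta> (j, l)\<bar> * (moment 1 i l * moment 2 j l))))"
      unfolding B_def H_def using l by (intro order_trans[OF sum_abs] sum_mono leave_out_product) auto
    then have "1 / (n * (n - 1)) * \<bar>\<Sum>i\<in>S. \<Sum>j\<in>S - {i}. B i j l - mean i l * mean j l * H i j\<bar> \<le> 1 / (n * (n - 1)) * (\<Sum>i\<in>S. \<Sum>j\<in>S - {i}. L * \<epsilon> ^ 3 * (4 * (\<bar>\<theta> \<eta> (i, l)\<bar> * (moment 2 i l * moment 1 j l) + \<bar>\<theta> \<eta> (j, l)\<bar> * (moment 1 i l * moment 2 j l))))"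
      using n by (intro mult_left_mono) auto
    moreover have "\<bar>(x - y) - (x' - y')\<bar> \<le> \<bar>x - x'\<bar> + \<bar>y - y'\<bar>" for x y x' y' :: real by linarith
    note this[of "1 / n * (\<Sum>i\<in>S. A i l)" "1 / (n * (n - 1)) * (\<Sum>i\<in>S. \<Sum>j\<in>S - {i}. B i j l)"
      "1 / n * (\<Sum>i\<in>S. moment 2 i l * H i i)" "1 / (n * (n - 1)) * (\<Sum>i\<in>S. \<Sum>j\<in>S - {i}. mean i l * mean j l * H i j)"]
    moreover have "\<bar>1 / n * x - 1 / n * y\<bar> = 1 / n * \<bar>x - y\<bar>" "\<bar>1 / (n * (n - 1)) * x - 1 / (n * (n - 1)) * y\<bar> = 1 / (n * (n - 1)) * \<bar>x - y\<bar>" for x y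
      using n unfolding right_diff_distrib[symmetric] abs_mult by simp_all
    ultimately show ?thesis
      unfolding distrib_left[of "L * \<epsilon> ^ 3"] mult.left_commute[of "L * \<epsilon> ^ 3" "1 / _"] sum_distrib_left[of "L * \<epsilon> ^ 3"]
      by (simp only: sum_subtractf)
  qed
  then show ?thesis
    unfolding H_def[symmetric] 1 2 sum_subtractf[symmetric] gauss_error_def n_def[symmetric] sum_distrib_left[of "L * \<epsilon> ^ 3"]
    by (intro order_trans[OF sum_abs] sum_mono)
qed

lemma \<theta>_abs: "integrable N (\<lambda>\<eta>. \<bar>\<theta> \<eta> q\<bar>)" "(\<integral>\<eta>. \<bar>\<theta> \<eta> q\<bar> \<partial>N) \<le> 1 / sqrt (real (card S) - 1)" if "q \<in> S \<times> S"
proof -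
  define \<beta> where "\<beta> = 1 / sqrt (real (card S) - 1)"
  have \<beta>: "\<beta> \<ge> 0" using card_S by (simp add: \<beta>_def)
  have eq: "\<bar>\<theta> \<eta> q\<bar> = \<beta> * \<bar>\<zeta> q \<eta>\<bar>" for \<eta> using \<beta> by (simp add: \<theta>_def abs_mult flip: \<beta>_def)
  show "integrable N (\<lambda>\<eta>. \<bar>\<theta> \<eta> q\<bar>)" unfolding eq using \<zeta>_integrable[OF that] by simp
  show "(\<integral>\<eta>. \<bar>\<theta> \<eta> q\<bar> \<partial>N) \<le> 1 / sqrt (real (card S) - 1)"
    unfolding eq using mult_left_mono[OF \<zeta>_abs_le[OF that] \<beta>] by (simp flip: \<beta>_def)
qed

lemma gauss_error_integrable: "integrable N gauss_error"
  unfolding gauss_error_def[abs_def]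
  by (intro Bochner_Integration.integrable_sum Bochner_Integration.integrable_add integrable_mult_right integrable_mult_left \<theta>_abs(1)) auto

lemma gauss_error_integral_le:
  defines "n \<equiv> real (card S)"
  shows "(\<integral>\<eta>. gauss_error \<eta> \<partial>N) \<le> 1 / sqrt (n - 1) * (2 * sA / n + 8 * sD / (n * (n - 1)))"
proof -
  have n: "n \<ge> 2" using card_S by (simp add: n_def)
  define \<beta> where "\<beta> = 1 / sqrt (n - 1)"
  have \<beta>: "\<beta> \<ge> 0" using n by (simp add: \<beta>_def)
  \<comment> \<open>\<open>\<Phi>\<close> is linear with nonnegative coefficients: linearity lets
    the integral pass to the weights, and monotonicity replaces each of their means by
    \<open>\<beta>\<close>.\<close>
  define \<Phi> where "\<Phi> t = (\<Sum>l\<in>S. 1 / n * (\<Sum>i\<in>S. t (i, l) * (2 * moment 3 i l))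
    + 1 / (n * (n - 1)) * (\<Sum>i\<in>S. \<Sum>j\<in>S - {i}.
      4 * (t (i, l) * (moment 2 i l * moment 1 j l) + t (j, l) * (moment 1 i l * moment 2 j l))))" for t :: "nat \<times> nat \<Rightarrow> real"
  have "gauss_error \<eta> = \<Phi> (\<lambda>q. \<bar>\<theta> \<eta> q\<bar>)" for \<eta> by (simp add: gauss_error_def \<Phi>_def n_def)
  then have "(\<integral>\<eta>. gauss_error \<eta> \<partial>N) = (\<integral>\<eta>. \<Phi> (\<lambda>q. \<bar>\<theta> \<eta> q\<bar>) \<partial>N)" by simp
  also have "\<dots> = \<Phi> (\<lambda>q. \<integral>\<eta>. \<bar>\<theta> \<eta> q\<bar> \<partial>N)"
    unfolding \<Phi>_def
    by (intro has_bochner_integral_integral_eq has_bochner_integral_sum has_bochner_integral_add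
        has_bochner_integral_mult_right has_bochner_integral_mult_left has_bochner_integral_integrable \<theta>_abs(1)) auto
  also have "\<dots> \<le> \<Phi> (\<lambda>q. \<beta>)"
    unfolding \<Phi>_def \<beta>_def n_def using n
    by (intro sum_mono add_mono mult_left_mono mult_right_mono \<theta>_abs(2) mult_nonneg_nonneg moment_nonneg) (auto simp: n_def)
  also have "\<Phi> (\<lambda>q. \<beta>) = \<beta> * (2 * sA / n + 4 / (n * (n - 1)) * (\<Sum>l\<in>S. \<Sum>i\<in>S. \<Sum>j\<in>S - {i}. moment 2 i l * moment 1 j l + moment 1 i l * moment 2 j l))"
  proof -
    have "sA = (\<Sum>l\<in>S. \<Sum>i\<in>S. moment 3 i l)" unfolding sA_def by (rule sum.swap)
    then show ?thesis
      unfolding \<Phi>_def by (simp add: sum.distrib sum_distrib_left sum_distrib_right sum_divide_distrib algebra_simps del: One_nat_def)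
  qed
  also have "\<dots> \<le> \<beta> * (2 * sA / n + 4 / (n * (n - 1)) * (2 * sD))"
  proof -
    have "(\<Sum>l\<in>S. \<Sum>i\<in>S. \<Sum>j\<in>S - {i}. moment 2 i l * moment 1 j l + moment 1 i l * moment 2 j l)
        \<le> (\<Sum>l\<in>S. \<Sum>i\<in>S. \<Sum>j\<in>S. moment 2 i l * moment 1 j l + moment 1 i l * moment 2 j l)"
      by (intro sum_mono sum_off_diagonal_le order_refl add_nonneg_nonneg mult_nonneg_nonneg moment_nonneg)
    also have "\<dots> = (\<Sum>i\<in>S. \<Sum>j\<in>S. \<Sum>l\<in>S. moment 2 i l * moment 1 j l + moment 1 i l * moment 2 j l)"
      by (subst sum.swap) (intro sum.cong refl sum.swap)
    also have "\<dots> = 2 * sD"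
      by (simp only: sum.distrib sD_swap sD_def[symmetric])
    finally show ?thesis using n \<beta> by (intro mult_left_mono add_mono) auto
  qed
  finally show ?thesis by (simp add: \<beta>_def)
qed

lemma G_measurable: "continuous_on UNIV f \<Longrightarrow> (\<lambda>x. f (G x) :: real) \<in> borel_measurable (M \<Otimes>\<^sub>M N)"
  unfolding G_def V_def
proof (rule borel_measurable_continuous_sum)
  fix q assume "q \<in> S \<times> S - {}"
  then have "X (fst q) (snd q) \<in> borel_measurable M" "\<zeta> q \<in> borel_measurable N" using X_measurable by auto
  then show "(\<lambda>x. \<theta> (snd x) q * X (fst q) (snd q) (fst x)) \<in> borel_measurable (M \<Otimes>\<^sub>M N)"
    unfolding \<theta>_def by measurable
qed

lemma V_measurable_N: "continuous_on UNIV f \<Longrightarrow> (\<lambda>\<eta>. f (V (\<theta> \<eta>) {} \<omega>) :: real) \<in> borel_measurable N"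
  unfolding V_eq by (intro borel_measurable_continuous_sum) auto

lemma integrable_fst_mult_bounded:
  assumes "integrable M U" "f \<in> borel_measurable (M \<Otimes>\<^sub>M N)" "\<And>x. \<bar>f x\<bar> \<le> C"
  shows "integrable (M \<Otimes>\<^sub>M N) (\<lambda>x. U (fst x) * f x :: real)"
proof (rule Bochner_Integration.integrable_bound)
  show "integrable (M \<Otimes>\<^sub>M N) (\<lambda>x. C * (U (fst x) * 1))"
    using assms MN.integrable_mult_pair[of U "\<lambda>_. 1"] by simp
  show "AE x in M \<Otimes>\<^sub>M N. norm (U (fst x) * f x) \<le> norm (C * (U (fst x) * 1))"
    using assms(3) by (intro AE_I2) (auto simp: abs_mult mult.commute[of C] intro!: mult_left_mono order_trans[OF assms(3) abs_ge_self])
  show "(\<lambda>x. U (fst x) * f x) \<in> borel_measurable (M \<Otimes>\<^sub>M N)"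
    using assms by (intro borel_measurable_times measurable_compose[OF measurable_fst]) auto
qed

lemma \<Psi>_integrable: "integrable (M \<Otimes>\<^sub>M N) (\<lambda>x. \<Psi> (G x) (fst x))"
proof -
  have "integrable (M \<Otimes>\<^sub>M N) (\<lambda>x. (X i l (fst x))\<^sup>2 * F2 (G x) (e i) (e i))" if "i \<in> S" "l \<in> S" for i l
    using integrable_moment[OF that, of 2] F2_e_bound
    by (intro integrable_fst_mult_bounded[where U = "\<lambda>\<omega>. (X i l \<omega>)\<^sup>2"] G_measurable[OF F2_continuous]) auto
  moreover have "integrable (M \<Otimes>\<^sub>M N) (\<lambda>x. X i l (fst x) * X j l (fst x) * F2 (G x) (e i) (e j))"
    if "i \<in> S" "j \<in> S" "i \<noteq> j" "l \<in> S" for i j l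
    using mean_mult(2)[of i l j l] that F2_e_bound
    by (intro integrable_fst_mult_bounded[where U = "\<lambda>\<omega>. X i l \<omega> * X j l \<omega>"] G_measurable[OF F2_continuous]) auto
  ultimately show ?thesis
    unfolding \<Psi>_def
    by (intro Bochner_Integration.integrable_sum Bochner_Integration.integrable_diff integrable_mult_right) auto
qed

lemma F1_G_integrable: "integrable (M \<Otimes>\<^sub>M N) (\<lambda>x. F1 (G x) (G x))"
proof -
  have eq: "F1 (G x) (G x) = (\<Sum>q\<in>S \<times> S. \<theta> (snd x) q * X (fst q) (snd q) (fst x) * F1 (G x) (e (fst q)))" for x
    by (subst (2) G_def) (simp add: V_def linear_sum[OF F1_linear] linear_scale[OF F1_linear])
  have "integrable (M \<Otimes>\<^sub>M N) (\<lambda>x. \<theta> (snd x) q * X (fst q) (snd q) (fst x) * F1 (G x) (e (fst q)))" if "q \<in> S \<times> S" for q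
  proof (rule Bochner_Integration.integrable_bound)
    have X: "integrable M (\<lambda>\<omega>. \<bar>X (fst q) (snd q) \<omega>\<bar>)" using that by (intro integrable_abs_X) auto
    show "integrable (M \<Otimes>\<^sub>M N) (\<lambda>x. K * \<epsilon> * (\<bar>X (fst q) (snd q) (fst x)\<bar> * \<bar>\<theta> (snd x) q\<bar>))"
      by (intro integrable_mult_right MN.integrable_mult_pair X \<theta>_abs(1) that)
    have "\<bar>\<theta> (snd x) q * X (fst q) (snd q) (fst x)\<bar> * \<bar>F1 (G x) (e (fst q))\<bar>
        \<le> \<bar>\<theta> (snd x) q * X (fst q) (snd q) (fst x)\<bar> * (K * \<epsilon>)" for x
      by (intro mult_left_mono F1_e_bound) simp
    then show "AE x in M \<Otimes>\<^sub>M N. norm (\<theta> (snd x) q * X (fst q) (snd q) (fst x) * F1 (G x) (e (fst q)))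
        \<le> norm (K * \<epsilon> * (\<bar>X (fst q) (snd q) (fst x)\<bar> * \<bar>\<theta> (snd x) q\<bar>))"
      using K_nonneg \<epsilon>_nonneg by (intro AE_I2) (simp add: abs_mult mult_ac)
    have [measurable]: "X (fst q) (snd q) \<in> borel_measurable M" "\<zeta> q \<in> borel_measurable N" using X_measurable that by auto
    have [measurable]: "(\<lambda>x. F1 (G x) (e (fst q))) \<in> borel_measurable (M \<Otimes>\<^sub>M N)" by (intro G_measurable F1_continuous)
    show "(\<lambda>x. \<theta> (snd x) q * X (fst q) (snd q) (fst x) * F1 (G x) (e (fst q))) \<in> borel_measurable (M \<Otimes>\<^sub>M N)"
      unfolding \<theta>_def by measurable
  qed
  then show ?thesis unfolding eq by (intro Bochner_Integration.integrable_sum)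
qed

text \<open>The double integral is used in both orders. For a fixed array the normals are
  integrated, and integration by parts yields \<open>\<Psi>\<close>; for fixed weights the array is
  integrated, and leaving out entries replaces their products by means.\<close>

lemma gaussian_expansion:
  defines "n \<equiv> real (card S)"
  shows "\<bar>(\<integral>x. F1 (G x) (G x) \<partial>(M \<Otimes>\<^sub>M N)) - (\<Sum>i\<in>S. \<Sum>j\<in>S. covariance i j * (\<integral>x. F2 (G x) (e i) (e j) \<partial>(M \<Otimes>\<^sub>M N)))\<bar>
    \<le> L * \<epsilon> ^ 3 * (1 / sqrt (n - 1) * (2 * sA / n + 8 * sD / (n * (n - 1))))"
proof -
  have F2_int: "integrable (M \<Otimes>\<^sub>M N) (\<lambda>x. F2 (G x) (e i) (e j))" for i j
    using F2_e_bound by (intro MN.integrable_const_bound[where B = "2 * K * \<epsilon>\<^sup>2"] G_measurable[OF F2_continuous]) auto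
  have F2_fubini: "(\<integral>x. F2 (G x) (e i) (e j) \<partial>(M \<Otimes>\<^sub>M N)) = (\<integral>\<eta>. \<integral>\<omega>. F2 (V (\<theta> \<eta>) {} \<omega>) (e i) (e j) \<partial>M \<partial>N)"
    and F2_int_N: "integrable N (\<lambda>\<eta>. \<integral>\<omega>. F2 (V (\<theta> \<eta>) {} \<omega>) (e i) (e j) \<partial>M)" for i j
    using MN.integral_snd[of "\<lambda>\<omega> \<eta>. F2 (G (\<omega>, \<eta>)) (e i) (e j)"] MN.integrable_snd[of "\<lambda>\<omega> \<eta>. F2 (G (\<omega>, \<eta>)) (e i) (e j)"] F2_int[of i j]
    by (simp_all add: G_def split_beta')
  have "(\<integral>x. F1 (G x) (G x) \<partial>(M \<Otimes>\<^sub>M N)) = (\<integral>\<omega>. \<integral>\<eta>. F1 (V (\<theta> \<eta>) {} \<omega>) (V (\<theta> \<eta>) {} \<omega>) \<partial>N \<partial>M)"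
    using MN.integral_fst'[OF F1_G_integrable] by (simp add: G_def)
  also have "\<dots> = (\<integral>\<omega>. \<integral>\<eta>. \<Psi> (V (\<theta> \<eta>) {} \<omega>) \<omega> \<partial>N \<partial>M)"
  proof (rule Bochner_Integration.integral_cong[OF refl])
    fix \<omega>
    have F1_int: "integrable N (\<lambda>\<eta>. Z q \<eta> * F1 (V (\<theta> \<eta>) {} \<omega>) (a q \<omega>))" if "q \<in> S \<times> S" for q
    proof (rule Bochner_Integration.integrable_bound)
      show "integrable N (\<lambda>\<eta>. K * norm (a q \<omega>) * Z q \<eta>)" using Z_first(1)[OF that] by simp
      have "\<bar>Z q \<eta>\<bar> * \<bar>F1 (V (\<theta> \<eta>) {} \<omega>) (a q \<omega>)\<bar> \<le> \<bar>Z q \<eta>\<bar> * (K * norm (a q \<omega>))" for \<eta>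
        by (intro mult_left_mono F1_bound) simp
      then show "AE \<eta> in N. norm (Z q \<eta> * F1 (V (\<theta> \<eta>) {} \<omega>) (a q \<omega>)) \<le> norm (K * norm (a q \<omega>) * Z q \<eta>)"
        using K_nonneg by (intro AE_I2) (simp add: abs_mult mult_ac)
      show "(\<lambda>\<eta>. Z q \<eta> * F1 (V (\<theta> \<eta>) {} \<omega>) (a q \<omega>)) \<in> borel_measurable N"
        using that by (intro borel_measurable_times V_measurable_N F1_continuous) auto
    qed
    have F2_int': "integrable N (\<lambda>\<eta>. F2 (V (\<theta> \<eta>) {} \<omega>) (a q \<omega>) (a q \<omega>))" for q
      by (rule N.integrable_const_bound[where B = "K * (norm (a q \<omega>))\<^sup>2"]) (auto intro!: V_measurable_N F2_continuous F2_diag_bound)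
    have "F1 (V (\<theta> \<eta>) {} \<omega>) (V (\<theta> \<eta>) {} \<omega>) = (\<Sum>q\<in>S \<times> S. Z q \<eta> * F1 (V (\<theta> \<eta>) {} \<omega>) (a q \<omega>))" for \<eta>
      by (subst (2) V_eq) (simp add: linear_sum[OF F1_linear] linear_scale[OF F1_linear])
    then have "(\<integral>\<eta>. F1 (V (\<theta> \<eta>) {} \<omega>) (V (\<theta> \<eta>) {} \<omega>) \<partial>N) = (\<Sum>q\<in>S \<times> S. \<integral>\<eta>. Z q \<eta> * F1 (V (\<theta> \<eta>) {} \<omega>) (a q \<omega>) \<partial>N)"
      using F1_int by simp
    also have "\<dots> = (\<Sum>q\<in>S \<times> S. \<integral>\<eta>. F2 (V (\<theta> \<eta>) {} \<omega>) (a q \<omega>) (a q \<omega>) \<partial>N)"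
      unfolding V_eq using finite_S Z_indep Z_normal
      by (intro sum.cong refl gaussian_integration_by_parts[OF N.prob_space_axioms]) auto
    also have "\<dots> = (\<integral>\<eta>. \<Psi> (V (\<theta> \<eta>) {} \<omega>) \<omega> \<partial>N)"
      unfolding sum_quadratic[symmetric] using F2_int' by simp
    finally show "(\<integral>\<eta>. F1 (V (\<theta> \<eta>) {} \<omega>) (V (\<theta> \<eta>) {} \<omega>) \<partial>N) = (\<integral>\<eta>. \<Psi> (V (\<theta> \<eta>) {} \<omega>) \<omega> \<partial>N)" .
  qed
  also have "\<dots> = (\<integral>\<eta>. \<integral>\<omega>. \<Psi> (V (\<theta> \<eta>) {} \<omega>) \<omega> \<partial>M \<partial>N)"
    using MN.integral_fst'[OF \<Psi>_integrable] MN.integral_snd[of "\<lambda>\<omega> \<eta>. \<Psi> (G (\<omega>, \<eta>)) \<omega>"] \<Psi>_integrable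
    by (simp add: G_def split_beta')
  finally have 1: "(\<integral>x. F1 (G x) (G x) \<partial>(M \<Otimes>\<^sub>M N)) = (\<integral>\<eta>. \<integral>\<omega>. \<Psi> (V (\<theta> \<eta>) {} \<omega>) \<omega> \<partial>M \<partial>N)" .
  have int_\<Psi>: "integrable N (\<lambda>\<eta>. \<integral>\<omega>. \<Psi> (V (\<theta> \<eta>) {} \<omega>) \<omega> \<partial>M)"
    using MN.integrable_snd[of "\<lambda>\<omega> \<eta>. \<Psi> (G (\<omega>, \<eta>)) \<omega>"] \<Psi>_integrable by (simp add: G_def split_beta')
  have 2: "(\<Sum>i\<in>S. \<Sum>j\<in>S. covariance i j * (\<integral>x. F2 (G x) (e i) (e j) \<partial>(M \<Otimes>\<^sub>M N)))
      = (\<integral>\<eta>. (\<Sum>i\<in>S. \<Sum>j\<in>S. covariance i j * (\<integral>\<omega>. F2 (V (\<theta> \<eta>) {} \<omega>) (e i) (e j) \<partial>M)) \<partial>N)"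
    using F2_int_N by (simp add: F2_fubini)
  have "\<bar>(\<integral>\<eta>. \<integral>\<omega>. \<Psi> (V (\<theta> \<eta>) {} \<omega>) \<omega> \<partial>M \<partial>N)
      - (\<integral>\<eta>. (\<Sum>i\<in>S. \<Sum>j\<in>S. covariance i j * (\<integral>\<omega>. F2 (V (\<theta> \<eta>) {} \<omega>) (e i) (e j) \<partial>M)) \<partial>N)\<bar>
    \<le> (\<integral>\<eta>. L * \<epsilon> ^ 3 * gauss_error \<eta> \<partial>N)"
    using int_\<Psi> F2_int_N gauss_error_integrable \<Psi>_leave_out by (intro abs_integral_diff_le) auto
  also have "\<dots> = L * \<epsilon> ^ 3 * (\<integral>\<eta>. gauss_error \<eta> \<partial>N)" by simp
  also have "\<dots> \<le> L * \<epsilon> ^ 3 * (1 / sqrt (n - 1) * (2 * sA / n + 8 * sD / (n * (n - 1))))"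
    unfolding n_def using L_nonneg \<epsilon>_nonneg by (intro mult_left_mono gauss_error_integral_le) auto
  finally show ?thesis unfolding 1 2 .
qed

end

section \<open>Interpolation\<close>

text \<open>By the mean value theorem the difference quotients are dominated by \<open>w\<close>, so
  dominated convergence applies along every sequence of increments.\<close>

lemma has_real_derivative_integral:
  fixes f f' :: "real \<Rightarrow> 'a \<Rightarrow> real"
  assumes f: "\<And>t. integrable M (f t)" and f': "integrable M (f' t)"
    and deriv: "\<And>t x. ((\<lambda>t. f t x) has_real_derivative f' t x) (at t)"
    and bound: "\<And>t x. \<bar>f' t x\<bar> \<le> w x" and w: "integrable M w"
  shows "((\<lambda>t. \<integral>x. f t x \<partial>M) has_real_derivative (\<integral>x. f' t x \<partial>M)) (at t)"
  unfolding DERIV_def tendsto_at_iff_sequentially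
proof (intro allI impI)
  fix h :: "nat \<Rightarrow> real" assume h: "\<forall>i. h i \<in> UNIV - {0}" "h \<longlonglongrightarrow> 0"
  have "(\<lambda>i. \<integral>x. (f (t + h i) x - f t x) / h i \<partial>M) \<longlonglongrightarrow> (\<integral>x. f' t x \<partial>M)"
  proof (rule integral_dominated_convergence)
    show "AE x in M. (\<lambda>i. (f (t + h i) x - f t x) / h i) \<longlonglongrightarrow> f' t x"
    proof (rule AE_I2)
      fix x
      have "((\<lambda>h. (f (t + h) x - f t x) / h) \<longlongrightarrow> f' t x) (at 0)"
        using deriv[of x t] by (simp add: DERIV_def)
      then show "(\<lambda>i. (f (t + h i) x - f t x) / h i) \<longlonglongrightarrow> f' t x"
        using h unfolding tendsto_at_iff_sequentially by (auto simp: o_def)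
    qed
    have "\<bar>f (t + h i) x - f t x\<bar> \<le> w x * \<bar>h i\<bar>" for i x
      using field_differentiable_bound[of UNIV "\<lambda>t. f t x" "\<lambda>t. f' t x" "w x" "t + h i" t] deriv bound by simp
    then show "AE x in M. norm ((f (t + h i) x - f t x) / h i) \<le> w x" for i
      using h by (intro AE_I2) (simp add: divide_le_eq)
  qed (use f f' w in auto)
  moreover have "(\<integral>x. (f (t + h i) x - f t x) / h i \<partial>M) = ((\<integral>x. f (t + h i) x \<partial>M) - (\<integral>x. f t x \<partial>M)) / h i" for i
    using f by simp
  ultimately show "((\<lambda>h. ((\<integral>x. f (t + h) x \<partial>M) - (\<integral>x. f t x \<partial>M)) / h) \<circ> h) \<longlonglongrightarrow> (\<integral>x. f' t x \<partial>M)"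
    unfolding o_def by (simp only:)
qed

text \<open>Centred Gaussian vectors with covariance \<open>C\<close> satisfy this with \<open>R = 0\<close> (Stein's identity).\<close>

definition stein_approx :: "'a measure \<Rightarrow> 'i set \<Rightarrow> ('i \<Rightarrow> 'v) \<Rightarrow> ('i \<Rightarrow> 'i \<Rightarrow> real) \<Rightarrow> ('a \<Rightarrow> 'v::real_normed_vector) \<Rightarrow> real \<Rightarrow> bool" where
  "stein_approx M S e C Y R \<longleftrightarrow> (\<forall>F1 F2 K L. lipschitz_hessian F1 F2 K L \<longrightarrow>
     \<bar>(\<integral>\<omega>. F1 (Y \<omega>) (Y \<omega>) \<partial>M) - (\<Sum>i\<in>S. \<Sum>j\<in>S. C i j * (\<integral>\<omega>. F2 (Y \<omega>) (e i) (e j) \<partial>M))\<bar> \<le> L * R)"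

text \<open>\<open>Y\<close> and \<open>D\<close> depend on different factors of a product and are
  thereby independent. Their coordinates over the common directions \<open>e\<close> carry all
  questions of measurability and integrability.\<close>

locale interpolation = lipschitz_hessian F1 F2 K L + pair_prob_space M N
  for F1 :: "'v::real_normed_vector \<Rightarrow> 'v \<Rightarrow> real" and F2 K L and M :: "'a measure" and N :: "'b measure" +
  fixes g :: "'v \<Rightarrow> real" and S :: "'i::countable set" and e :: "'i \<Rightarrow> 'v"
    and y :: "'i \<Rightarrow> 'a \<Rightarrow> real" and d :: "'i \<Rightarrow> 'b \<Rightarrow> real" and Y :: "'a \<Rightarrow> 'v" and D :: "'b \<Rightarrow> 'v"
  assumes g_derivative: "\<And>w. (g has_derivative F1 w) (at w)"
    and S: "finite S"
    and Y_eq: "\<And>\<omega>. Y \<omega> = (\<Sum>i\<in>S. y i \<omega> *\<^sub>R e i)" and y: "\<And>i. i \<in> S \<Longrightarrow> integrable M (y i)"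
    and D_eq: "\<And>\<omega>. D \<omega> = (\<Sum>i\<in>S. d i \<omega> *\<^sub>R e i)" and d: "\<And>i. i \<in> S \<Longrightarrow> integrable N (d i)"
begin

definition "mix t x = cos t *\<^sub>R Y (fst x) + sin t *\<^sub>R D (snd x)"
text \<open>One integrable function that dominates the norm of every mixture and, multiplied by
  \<open>K\<close>, the derivative in t of g along it; differentiation under the integral rests on
  it.\<close>

definition "W x = (\<Sum>i\<in>S. norm (e i) * \<bar>y i (fst x)\<bar>) + (\<Sum>i\<in>S. norm (e i) * \<bar>d i (snd x)\<bar>)"

lemma integrable_pair_fst: "integrable M f \<Longrightarrow> integrable (M \<Otimes>\<^sub>M N) (\<lambda>x. f (fst x) :: real)"
  using integrable_mult_pair[of f "\<lambda>_. 1"] by simp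

lemma integrable_pair_snd: "integrable N f \<Longrightarrow> integrable (M \<Otimes>\<^sub>M N) (\<lambda>x. f (snd x) :: real)"
  using integrable_mult_pair[of "\<lambda>_. 1" f] by simp

lemma W_integrable: "integrable (M \<Otimes>\<^sub>M N) W"
  unfolding W_def[abs_def] using y d integrable_pair_fst[of "\<lambda>\<omega>. \<bar>y _ \<omega>\<bar>"] integrable_pair_snd[of "\<lambda>\<omega>. \<bar>d _ \<omega>\<bar>"]
  by (intro Bochner_Integration.integrable_add Bochner_Integration.integrable_sum integrable_mult_right) auto

lemma norm_Y_le: "norm (Y \<omega>) \<le> (\<Sum>i\<in>S. norm (e i) * \<bar>y i \<omega>\<bar>)"
  unfolding Y_eq by (rule order_trans[OF norm_sum]) (simp add: mult.commute)

lemma norm_D_le: "norm (D \<eta>) \<le> (\<Sum>i\<in>S. norm (e i) * \<bar>d i \<eta>\<bar>)"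
  unfolding D_eq by (rule order_trans[OF norm_sum]) (simp add: mult.commute)

lemma norm_combination_le:
  assumes "\<bar>a\<bar> \<le> 1" "\<bar>b\<bar> \<le> 1"
  shows "norm (a *\<^sub>R Y (fst x) + b *\<^sub>R D (snd x)) \<le> W x"
proof -
  have "norm (a *\<^sub>R Y (fst x) + b *\<^sub>R D (snd x)) \<le> \<bar>a\<bar> * norm (Y (fst x)) + \<bar>b\<bar> * norm (D (snd x))"
    using norm_triangle_ineq[of "a *\<^sub>R Y (fst x)" "b *\<^sub>R D (snd x)"] by simp
  also have "\<dots> \<le> 1 * norm (Y (fst x)) + 1 * norm (D (snd x))"
    using assms by (intro add_mono mult_right_mono) auto
  also have "\<dots> \<le> W x" unfolding W_def using norm_Y_le[of "fst x"] norm_D_le[of "snd x"] by simp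
  finally show ?thesis .
qed

lemma mix_measurable: "continuous_on UNIV f \<Longrightarrow> (\<lambda>x. f (mix t x) :: real) \<in> borel_measurable (M \<Otimes>\<^sub>M N)"
proof -
  assume f: "continuous_on UNIV f"
  have eq: "mix t x = (\<Sum>i\<in>S. (cos t * y i (fst x) + sin t * d i (snd x)) *\<^sub>R e i)" for x
    by (simp add: mix_def Y_eq D_eq scaleR_sum_right sum.distrib scaleR_add_left)
  show ?thesis
    unfolding eq using y d
    by (intro borel_measurable_continuous_sum[OF f] borel_measurable_add borel_measurable_times borel_measurable_const
        measurable_compose[OF measurable_fst] measurable_compose[OF measurable_snd]) auto
qed

lemma F1_sum_eq: "F1 w (Y \<omega>) = (\<Sum>i\<in>S. y i \<omega> * F1 w (e i))" "F1 w (D \<eta>) = (\<Sum>i\<in>S. d i \<eta> * F1 w (e i))"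
  by (simp_all add: Y_eq D_eq linear_sum[OF F1_linear] linear_scale[OF F1_linear])

lemma F1_Y_measurable: "(\<lambda>x. F1 (mix t x) (Y (fst x))) \<in> borel_measurable (M \<Otimes>\<^sub>M N)"
  unfolding F1_sum_eq using y
  by (intro borel_measurable_sum borel_measurable_times measurable_compose[OF measurable_fst] mix_measurable F1_continuous) auto

lemma F1_D_measurable: "(\<lambda>x. F1 (mix t x) (D (snd x))) \<in> borel_measurable (M \<Otimes>\<^sub>M N)"
  unfolding F1_sum_eq using d
  by (intro borel_measurable_sum borel_measurable_times measurable_compose[OF measurable_snd] mix_measurable F1_continuous) auto

lemma F1_combination_bound:
  assumes "\<bar>a\<bar> \<le> 1" "\<bar>b\<bar> \<le> 1"
  shows "\<bar>F1 w (a *\<^sub>R Y (fst x) + b *\<^sub>R D (snd x))\<bar> \<le> K * W x"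
  using order_trans[OF F1_bound mult_left_mono[OF norm_combination_le[OF assms] K_nonneg]] .

lemma F1_Y_integrable: "integrable (M \<Otimes>\<^sub>M N) (\<lambda>x. F1 (mix t x) (Y (fst x)))"
proof (rule Bochner_Integration.integrable_bound)
  show "integrable (M \<Otimes>\<^sub>M N) (\<lambda>x. K * W x)" using W_integrable by simp
  show "AE x in M \<Otimes>\<^sub>M N. norm (F1 (mix t x) (Y (fst x))) \<le> norm (K * W x)"
    using F1_combination_bound[of 1 0] by (intro AE_I2) (simp, meson abs_ge_self order_trans)
qed (rule F1_Y_measurable)

lemma F1_D_integrable: "integrable (M \<Otimes>\<^sub>M N) (\<lambda>x. F1 (mix t x) (D (snd x)))"
proof (rule Bochner_Integration.integrable_bound)
  show "integrable (M \<Otimes>\<^sub>M N) (\<lambda>x. K * W x)" using W_integrable by simp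
  show "AE x in M \<Otimes>\<^sub>M N. norm (F1 (mix t x) (D (snd x))) \<le> norm (K * W x)"
    using F1_combination_bound[of 0 1] by (intro AE_I2) (simp, meson abs_ge_self order_trans)
qed (rule F1_D_measurable)

lemma g_continuous: "continuous_on UNIV g"
  using g_derivative has_derivative_continuous by (intro continuous_at_imp_continuous_on) blast

lemma mix_derivative:
  "((\<lambda>t. g (mix t x)) has_real_derivative F1 (mix t x) (- sin t *\<^sub>R Y (fst x) + cos t *\<^sub>R D (snd x))) (at t)"
proof -
  let ?p = "- sin t *\<^sub>R Y (fst x) + cos t *\<^sub>R D (snd x)"
  have "((\<lambda>t. mix t x) has_derivative (\<lambda>s. s *\<^sub>R ?p)) (at t)"
    unfolding mix_def by (auto intro!: derivative_eq_intros simp: algebra_simps)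
  then have "((\<lambda>t. g (mix t x)) has_derivative (\<lambda>s. F1 (mix t x) (s *\<^sub>R ?p))) (at t)"
    by (rule has_derivative_compose[OF _ g_derivative])
  moreover have "(\<lambda>s. F1 (mix t x) (s *\<^sub>R ?p)) = (*) (F1 (mix t x) ?p)"
    by (simp only: linear_scale[OF F1_linear] fun_eq_iff real_scaleR_def mult.commute simp_thms)
  ultimately show ?thesis by (simp add: has_field_derivative_def)
qed

lemma g_mix_integrable: "integrable (M \<Otimes>\<^sub>M N) (\<lambda>x. g (mix t x))"
proof (rule Bochner_Integration.integrable_bound)
  show "integrable (M \<Otimes>\<^sub>M N) (\<lambda>x. \<bar>g 0\<bar> + K * W x)" using W_integrable by simp
  have "\<bar>g w - g 0\<bar> \<le> K * norm w" for w
  proof -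
    have "norm (g w - g 0) \<le> K * norm (w - 0)"
    proof (rule differentiable_bound[of UNIV])
      show "onorm (F1 v) \<le> K" for v
        using F1_bound by (intro onorm_bound K_nonneg) auto
    qed (auto intro: has_derivative_at_withinI g_derivative)
    then show ?thesis by simp
  qed
  then have "\<bar>g (mix t x)\<bar> \<le> \<bar>g 0\<bar> + K * norm (mix t x)" for x
    by (smt (verit))
  moreover have "K * norm (mix t x) \<le> K * W x" for x
    unfolding mix_def by (intro mult_left_mono norm_combination_le K_nonneg) auto
  ultimately show "AE x in M \<Otimes>\<^sub>M N. norm (g (mix t x)) \<le> norm (\<bar>g 0\<bar> + K * W x)"
    by (intro AE_I2) (smt (verit) real_norm_def)
qed (rule mix_measurable[OF g_continuous])

lemma integral_mix_derivative:
  "((\<lambda>t. \<integral>x. g (mix t x) \<partial>(M \<Otimes>\<^sub>M N)) has_real_derivative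
    (- sin t * (\<integral>x. F1 (mix t x) (Y (fst x)) \<partial>(M \<Otimes>\<^sub>M N)) + cos t * (\<integral>x. F1 (mix t x) (D (snd x)) \<partial>(M \<Otimes>\<^sub>M N)))) (at t)"
proof -
  have eq: "F1 (mix t x) (- sin t *\<^sub>R Y (fst x) + cos t *\<^sub>R D (snd x))
      = - sin t * F1 (mix t x) (Y (fst x)) + cos t * F1 (mix t x) (D (snd x))" for t x
    unfolding linear_add[OF F1_linear] linear_scale[OF F1_linear] by simp
  have "((\<lambda>t. \<integral>x. g (mix t x) \<partial>(M \<Otimes>\<^sub>M N)) has_real_derivative
      (\<integral>x. F1 (mix t x) (- sin t *\<^sub>R Y (fst x) + cos t *\<^sub>R D (snd x)) \<partial>(M \<Otimes>\<^sub>M N))) (at t)"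
  proof (rule has_real_derivative_integral[where w = "\<lambda>x. K * W x"])
    show "integrable (M \<Otimes>\<^sub>M N) (\<lambda>x. F1 (mix t x) (- sin t *\<^sub>R Y (fst x) + cos t *\<^sub>R D (snd x)))"
      unfolding eq by (intro Bochner_Integration.integrable_add integrable_mult_right F1_Y_integrable F1_D_integrable)
    show "\<bar>F1 (mix t x) (- sin t *\<^sub>R Y (fst x) + cos t *\<^sub>R D (snd x))\<bar> \<le> K * W x" for t x
      by (rule F1_combination_bound) auto
  qed (use g_mix_integrable mix_derivative W_integrable in auto)
  then show ?thesis
    unfolding eq using F1_Y_integrable F1_D_integrable by simp
qed

lemma F2_mix_integrable: "integrable (M \<Otimes>\<^sub>M N) (\<lambda>x. F2 (mix t x) (e i) (e j))"
  using F2_bound by (intro P.integrable_const_bound[where B = "2 * K * norm (e i) * norm (e j)"] mix_measurable F2_continuous) auto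

text \<open>With \<eta> frozen, the pair rescaled by cos t is again admissible, which is why
  \<open>stein_approx\<close> quantifies over all pairs. The approximation then carries cos t on the
  first-order term, cos^2 t on the contraction and cos^3 t on the error, and cos t > 0 is divided
  out.\<close>

lemma stein_first:
  assumes approx: "stein_approx M S e C Y R" and t: "cos t > 0"
  shows "\<bar>(\<integral>x. F1 (mix t x) (Y (fst x)) \<partial>(M \<Otimes>\<^sub>M N))
      - cos t * (\<Sum>i\<in>S. \<Sum>j\<in>S. C i j * (\<integral>x. F2 (mix t x) (e i) (e j) \<partial>(M \<Otimes>\<^sub>M N)))\<bar> \<le> (cos t)\<^sup>2 * (L * R)"
proof -
  define u where "u = (\<lambda>\<eta>. \<integral>\<omega>. F1 (mix t (\<omega>, \<eta>)) (Y \<omega>) \<partial>M)"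
  define v where "v = (\<lambda>\<eta>. \<Sum>i\<in>S. \<Sum>j\<in>S. C i j * (\<integral>\<omega>. F2 (mix t (\<omega>, \<eta>)) (e i) (e j) \<partial>M))"
  have u: "integrable N u" "(\<integral>\<eta>. u \<eta> \<partial>N) = (\<integral>x. F1 (mix t x) (Y (fst x)) \<partial>(M \<Otimes>\<^sub>M N))"
    using integrable_snd[of "\<lambda>\<omega> \<eta>. F1 (mix t (\<omega>, \<eta>)) (Y \<omega>)"] integral_snd[of "\<lambda>\<omega> \<eta>. F1 (mix t (\<omega>, \<eta>)) (Y \<omega>)"]
      F1_Y_integrable[of t] by (simp_all add: u_def split_beta')
  have F2: "integrable N (\<lambda>\<eta>. \<integral>\<omega>. F2 (mix t (\<omega>, \<eta>)) (e i) (e j) \<partial>M)"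
    "(\<integral>\<eta>. \<integral>\<omega>. F2 (mix t (\<omega>, \<eta>)) (e i) (e j) \<partial>M \<partial>N) = (\<integral>x. F2 (mix t x) (e i) (e j) \<partial>(M \<Otimes>\<^sub>M N))" for i j
    using integrable_snd[of "\<lambda>\<omega> \<eta>. F2 (mix t (\<omega>, \<eta>)) (e i) (e j)"] integral_snd[of "\<lambda>\<omega> \<eta>. F2 (mix t (\<omega>, \<eta>)) (e i) (e j)"]
      F2_mix_integrable[of t i j] by (simp_all add: split_beta')
  have v: "integrable N v" "(\<integral>\<eta>. v \<eta> \<partial>N) = (\<Sum>i\<in>S. \<Sum>j\<in>S. C i j * (\<integral>x. F2 (mix t x) (e i) (e j) \<partial>(M \<Otimes>\<^sub>M N)))"
    using F2 by (simp_all add: v_def)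
  have "\<bar>u \<eta> - cos t * v \<eta>\<bar> \<le> (cos t)\<^sup>2 * (L * R)" for \<eta>
  proof -
    let ?G1 = "\<lambda>w x. cos t * F1 (cos t *\<^sub>R w + sin t *\<^sub>R D \<eta>) x"
    let ?G2 = "\<lambda>w x y. (cos t)\<^sup>2 * F2 (cos t *\<^sub>R w + sin t *\<^sub>R D \<eta>) x y"
    have "lipschitz_hessian ?G1 ?G2 K (cos t ^ 3 * L)" using t by (intro rescale) auto
    then have "\<bar>(\<integral>\<omega>. ?G1 (Y \<omega>) (Y \<omega>) \<partial>M) - (\<Sum>i\<in>S. \<Sum>j\<in>S. C i j * (\<integral>\<omega>. ?G2 (Y \<omega>) (e i) (e j) \<partial>M))\<bar> \<le> cos t ^ 3 * L * R"
      using approx unfolding stein_approx_def by blast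
    moreover have "(\<integral>\<omega>. ?G1 (Y \<omega>) (Y \<omega>) \<partial>M) = cos t * u \<eta>" by (simp add: u_def mix_def)
    moreover have "(\<Sum>i\<in>S. \<Sum>j\<in>S. C i j * (\<integral>\<omega>. ?G2 (Y \<omega>) (e i) (e j) \<partial>M)) = (cos t)\<^sup>2 * v \<eta>"
      by (simp add: v_def mix_def sum_distrib_left mult_ac)
    ultimately have "\<bar>cos t * u \<eta> - (cos t)\<^sup>2 * v \<eta>\<bar> \<le> cos t ^ 3 * L * R" by (simp only:)
    then have "\<bar>cos t * (u \<eta> - cos t * v \<eta>)\<bar> \<le> cos t * ((cos t)\<^sup>2 * (L * R))"
      by (simp add: power2_eq_square power3_eq_cube algebra_simps)
    then show ?thesis using t by (simp add: abs_mult)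
  qed
  then have "\<bar>(\<integral>\<eta>. u \<eta> \<partial>N) - (\<integral>\<eta>. cos t * v \<eta> \<partial>N)\<bar> \<le> (\<integral>\<eta>. (cos t)\<^sup>2 * (L * R) \<partial>N)"
    using u v by (intro abs_integral_diff_le) auto
  then show ?thesis using u v by (simp add: M2.prob_space)
qed

lemma stein_second:
  assumes approx: "stein_approx N S e C D R" and t: "sin t > 0"
  shows "\<bar>(\<integral>x. F1 (mix t x) (D (snd x)) \<partial>(M \<Otimes>\<^sub>M N))
      - sin t * (\<Sum>i\<in>S. \<Sum>j\<in>S. C i j * (\<integral>x. F2 (mix t x) (e i) (e j) \<partial>(M \<Otimes>\<^sub>M N)))\<bar> \<le> (sin t)\<^sup>2 * (L * R)"
proof -
  define u where "u = (\<lambda>\<omega>. \<integral>\<eta>. F1 (mix t (\<omega>, \<eta>)) (D \<eta>) \<partial>N)"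
  define v where "v = (\<lambda>\<omega>. \<Sum>i\<in>S. \<Sum>j\<in>S. C i j * (\<integral>\<eta>. F2 (mix t (\<omega>, \<eta>)) (e i) (e j) \<partial>N))"
  have u: "integrable M u" "(\<integral>\<omega>. u \<omega> \<partial>M) = (\<integral>x. F1 (mix t x) (D (snd x)) \<partial>(M \<Otimes>\<^sub>M N))"
    using integrable_fst'[OF F1_D_integrable[of t]] integral_fst'[OF F1_D_integrable[of t]] by (simp_all add: u_def)
  have F2: "integrable M (\<lambda>\<omega>. \<integral>\<eta>. F2 (mix t (\<omega>, \<eta>)) (e i) (e j) \<partial>N)"
    "(\<integral>\<omega>. \<integral>\<eta>. F2 (mix t (\<omega>, \<eta>)) (e i) (e j) \<partial>N \<partial>M) = (\<integral>x. F2 (mix t x) (e i) (e j) \<partial>(M \<Otimes>\<^sub>M N))" for i j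
    using integrable_fst'[OF F2_mix_integrable[of t i j]] integral_fst'[OF F2_mix_integrable[of t i j]] by simp_all
  have v: "integrable M v" "(\<integral>\<omega>. v \<omega> \<partial>M) = (\<Sum>i\<in>S. \<Sum>j\<in>S. C i j * (\<integral>x. F2 (mix t x) (e i) (e j) \<partial>(M \<Otimes>\<^sub>M N)))"
    using F2 by (simp_all add: v_def)
  have "\<bar>u \<omega> - sin t * v \<omega>\<bar> \<le> (sin t)\<^sup>2 * (L * R)" for \<omega>
  proof -
    let ?G1 = "\<lambda>w x. sin t * F1 (sin t *\<^sub>R w + cos t *\<^sub>R Y \<omega>) x"
    let ?G2 = "\<lambda>w x y. (sin t)\<^sup>2 * F2 (sin t *\<^sub>R w + cos t *\<^sub>R Y \<omega>) x y"
    have "lipschitz_hessian ?G1 ?G2 K (sin t ^ 3 * L)" using t by (intro rescale) auto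
    then have "\<bar>(\<integral>\<eta>. ?G1 (D \<eta>) (D \<eta>) \<partial>N) - (\<Sum>i\<in>S. \<Sum>j\<in>S. C i j * (\<integral>\<eta>. ?G2 (D \<eta>) (e i) (e j) \<partial>N))\<bar> \<le> sin t ^ 3 * L * R"
      using approx unfolding stein_approx_def by blast
    moreover have "(\<integral>\<eta>. ?G1 (D \<eta>) (D \<eta>) \<partial>N) = sin t * u \<omega>" by (simp add: u_def mix_def add.commute)
    moreover have "(\<Sum>i\<in>S. \<Sum>j\<in>S. C i j * (\<integral>\<eta>. ?G2 (D \<eta>) (e i) (e j) \<partial>N)) = (sin t)\<^sup>2 * v \<omega>"
      by (simp add: v_def mix_def sum_distrib_left mult_ac add.commute)
    ultimately have "\<bar>sin t * u \<omega> - (sin t)\<^sup>2 * v \<omega>\<bar> \<le> sin t ^ 3 * L * R" by (simp only:)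
    then have "\<bar>sin t * (u \<omega> - sin t * v \<omega>)\<bar> \<le> sin t * ((sin t)\<^sup>2 * (L * R))"
      by (simp add: power2_eq_square power3_eq_cube algebra_simps)
    then show ?thesis using t by (simp add: abs_mult)
  qed
  then have "\<bar>(\<integral>\<omega>. u \<omega> \<partial>M) - (\<integral>\<omega>. sin t * v \<omega> \<partial>M)\<bar> \<le> (\<integral>\<omega>. (sin t)\<^sup>2 * (L * R) \<partial>M)"
    using u v by (intro abs_integral_diff_le) auto
  then show ?thesis using u v by (simp add: M1.prob_space)
qed

lemma expectation_diff_le:
  assumes Y: "stein_approx M S e C Y R" and D: "stein_approx N S e C D R'"
  shows "\<bar>(\<integral>\<omega>. g (Y \<omega>) \<partial>M) - (\<integral>\<eta>. g (D \<eta>) \<partial>N)\<bar> \<le> L * (R + R') / 3"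
proof -
  define f where "f t = (\<integral>x. g (mix t x) \<partial>(M \<Otimes>\<^sub>M N))" for t
  define f' where "f' t = - sin t * (\<integral>x. F1 (mix t x) (Y (fst x)) \<partial>(M \<Otimes>\<^sub>M N)) + cos t * (\<integral>x. F1 (mix t x) (D (snd x)) \<partial>(M \<Otimes>\<^sub>M N))" for t
  have f: "(f has_real_derivative f' t) (at t)" for t
    unfolding f_def f'_def by (rule integral_mix_derivative)
  \<comment> \<open>An antiderivative of the bound \<open>h'\<close> for the modulus of
    \<open>f'\<close>: between 0 and pi / 2 its two terms grow by L R / 3 and L R' / 3.\<close>
  define h where "h t = L * R * (- (cos t ^ 3) / 3) + L * R' * (sin t ^ 3 / 3)" for t
  define h' where "h' t = L * R * ((cos t)\<^sup>2 * sin t) + L * R' * ((sin t)\<^sup>2 * cos t)" for t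
  have h: "(h has_real_derivative h' t) (at t)" for t
    unfolding h_def h'_def by (auto intro!: derivative_eq_intros simp: power2_eq_square)
  have bound: "\<bar>f' t\<bar> \<le> h' t" if t: "0 < t" "t < pi / 2" for t
  proof -
    have pos: "sin t > 0" "cos t > 0" using t sin_gt_zero[of t] cos_gt_zero[of t] by auto
    define H where "H = (\<Sum>i\<in>S. \<Sum>j\<in>S. C i j * (\<integral>x. F2 (mix t x) (e i) (e j) \<partial>(M \<Otimes>\<^sub>M N)))"
    define A where "A = (\<integral>x. F1 (mix t x) (Y (fst x)) \<partial>(M \<Otimes>\<^sub>M N))"
    define B where "B = (\<integral>x. F1 (mix t x) (D (snd x)) \<partial>(M \<Otimes>\<^sub>M N))"
    have "\<bar>A - cos t * H\<bar> \<le> (cos t)\<^sup>2 * (L * R)" "\<bar>B - sin t * H\<bar> \<le> (sin t)\<^sup>2 * (L * R')"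
      using stein_first[OF Y pos(2)] stein_second[OF D pos(1)] by (simp_all add: H_def A_def B_def)
    then have "sin t * \<bar>A - cos t * H\<bar> \<le> sin t * ((cos t)\<^sup>2 * (L * R))" "cos t * \<bar>B - sin t * H\<bar> \<le> cos t * ((sin t)\<^sup>2 * (L * R'))"
      using pos by (auto intro!: mult_left_mono)
    moreover have "f' t = - (sin t * (A - cos t * H)) + cos t * (B - sin t * H)"
      by (simp add: f'_def A_def B_def algebra_simps)
    then have "\<bar>f' t\<bar> \<le> sin t * \<bar>A - cos t * H\<bar> + cos t * \<bar>B - sin t * H\<bar>"
      using pos abs_triangle_ineq[of "- (sin t * (A - cos t * H))" "cos t * (B - sin t * H)"] by (simp add: abs_mult)
    ultimately show ?thesis by (simp add: h'_def mult_ac)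
  qed
  have cont: "continuous_on A f" "continuous_on A h" for A
    using f h by (auto intro!: continuous_at_imp_continuous_on intro: DERIV_isCont)
  \<comment> \<open>Instead of integrating \<open>f'\<close>, the proof uses that h - f and h + f
    increase. The bound is available on the open interval, where sin and cos are both positive;
    continuity covers the endpoints.\<close>
  have "h 0 - f 0 \<le> h (pi / 2) - f (pi / 2)"
  proof (rule DERIV_nonneg_imp_increasing_open[where f = "\<lambda>t. h t - f t"])
    show "\<exists>y. ((\<lambda>t. h t - f t) has_real_derivative y) (at t) \<and> 0 \<le> y" if "0 < t" "t < pi / 2" for t
      using bound[OF that] by (intro exI[of _ "h' t - f' t"] conjI DERIV_diff h f) auto
  qed (auto intro!: continuous_intros cont)
  moreover have "h 0 + f 0 \<le> h (pi / 2) + f (pi / 2)"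
  proof (rule DERIV_nonneg_imp_increasing_open[where f = "\<lambda>t. h t + f t"])
    show "\<exists>y. ((\<lambda>t. h t + f t) has_real_derivative y) (at t) \<and> 0 \<le> y" if "0 < t" "t < pi / 2" for t
      using bound[OF that] by (intro exI[of _ "h' t + f' t"] conjI DERIV_add h f) auto
  qed (auto intro!: continuous_intros cont)
  ultimately have "\<bar>f 0 - f (pi / 2)\<bar> \<le> h (pi / 2) - h 0" by linarith
  also have "h (pi / 2) - h 0 = L * (R + R') / 3" by (simp add: h_def field_simps)
  also have "f 0 = (\<integral>\<omega>. g (Y \<omega>) \<partial>M)"
    using integral_fst'[OF g_mix_integrable[of 0]] by (simp add: f_def mix_def M2.prob_space)
  also have "f (pi / 2) = (\<integral>\<eta>. g (D \<eta>) \<partial>N)"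
    using integral_fst'[OF g_mix_integrable[of "pi / 2"]] by (simp add: f_def mix_def M1.prob_space)
  finally show ?thesis .
qed

end

section \<open>Transfer to the given random elements\<close>

lemma skor_fun_sum: "skor_fun (\<Sum>i\<in>I. f i) t = (\<Sum>i\<in>I. skor_fun (f i) t)"
  by (induction I rule: infinite_finite_induct) simp_all

text \<open>For 1 \<le> i \<le> n this is the indicator function of [i / n, 1].\<close>

definition step_path :: "nat \<Rightarrow> nat \<Rightarrow> skorokhod" where
  "step_path n i = partial_sum_path n (\<lambda>m. if m = i then 1 else 0)"

lemma skor_fun_step_path:
  "t \<in> {0..1} \<Longrightarrow> skor_fun (step_path n i) t = (if i \<in> {1..nat \<lfloor>real n * t\<rfloor>} then 1 else 0)"
  by (simp add: step_path_def skor_fun_partial_sum_path)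

lemma norm_step_path: "norm (step_path n i) \<le> 1"
  by (rule norm_skorokhod_leI) (simp add: skor_fun_step_path)

text \<open>The paths in question lie in the span of n fixed step paths with the random summands as
  coefficients, which is the form that all preceding results require.\<close>

lemma partial_sum_path_eq: "partial_sum_path n a = (\<Sum>i\<in>{1..n}. a i *\<^sub>R step_path n i)"
proof (rule skor_fun_eqI)
  fix t :: real assume t: "t \<in> {0..1}"
  define m where "m = nat \<lfloor>real n * t\<rfloor>"
  have "real n * t \<le> real n * 1" using t by (intro mult_left_mono) auto
  then have "m \<le> n" unfolding m_def by (simp add: floor_le_iff nat_le_iff)
  then have "(\<Sum>i\<in>{1..n}. a i * (if i \<in> {1..m} then 1 else 0)) = (\<Sum>i\<in>{1..m}. a i)"
    by (intro sum.mono_neutral_cong_right) auto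
  then show "skor_fun (partial_sum_path n a) t = skor_fun (\<Sum>i\<in>{1..n}. a i *\<^sub>R step_path n i) t"
    using t by (simp add: skor_fun_partial_sum_path skor_fun_sum skor_fun_step_path m_def)
qed

section \<open>Independent random elements of different types\<close>

context prob_space
begin

lemma indep_elements_distr:
  assumes "indep_elements M S U T V"
  shows "distr M (S \<Otimes>\<^sub>M T) (\<lambda>\<omega>. (U \<omega>, V \<omega>)) = distr M S U \<Otimes>\<^sub>M distr M T V"
proof -
  have U: "U \<in> M \<rightarrow>\<^sub>M S" and V: "V \<in> M \<rightarrow>\<^sub>M T"
    and ind: "indep_set (sets (vimage_algebra (space M) U S)) (sets (vimage_algebra (space M) V T))"
    using assms by (auto simp: indep_elements_def)
  interpret U: prob_space "distr M S U" by (rule prob_space_distr[OF U])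
  interpret V: prob_space "distr M T V" by (rule prob_space_distr[OF V])
  have UV: "(\<lambda>\<omega>. (U \<omega>, V \<omega>)) \<in> M \<rightarrow>\<^sub>M S \<Otimes>\<^sub>M T" using U V by (rule measurable_Pair)
  show ?thesis
  proof (rule sym, rule pair_measure_eqI)
    show "sigma_finite_measure (distr M S U)" "sigma_finite_measure (distr M T V)" ..
    show "sets (distr M S U \<Otimes>\<^sub>M distr M T V) = sets (distr M (S \<Otimes>\<^sub>M T) (\<lambda>\<omega>. (U \<omega>, V \<omega>)))"
      by (simp add: sets_pair_measure_cong[OF sets_distr sets_distr])
    fix A B assume "A \<in> sets (distr M S U)" "B \<in> sets (distr M T V)"
    then have AB: "A \<in> sets S" "B \<in> sets T" by auto
    have "prob ((U -` A \<inter> space M) \<inter> (V -` B \<inter> space M)) = prob (U -` A \<inter> space M) * prob (V -` B \<inter> space M)"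
      using AB by (intro indep_setD[OF ind] in_vimage_algebra)
    moreover have "(\<lambda>\<omega>. (U \<omega>, V \<omega>)) -` (A \<times> B) \<inter> space M = (U -` A \<inter> space M) \<inter> (V -` B \<inter> space M)" by auto
    ultimately show "emeasure (distr M S U) A * emeasure (distr M T V) B = emeasure (distr M (S \<Otimes>\<^sub>M T) (\<lambda>\<omega>. (U \<omega>, V \<omega>))) (A \<times> B)"
      using AB U V UV by (simp add: emeasure_distr emeasure_eq_measure ennreal_mult)
  qed
qed

lemma indep_elements_compose:
  assumes ind: "indep_elements M S U T V" and h: "h \<in> S \<rightarrow>\<^sub>M S'"
  shows "indep_elements M S' (\<lambda>\<omega>. h (U \<omega>)) T V"
proof -
  have U: "U \<in> M \<rightarrow>\<^sub>M S" and V: "V \<in> M \<rightarrow>\<^sub>M T"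
    and indep: "indep_set (sets (vimage_algebra (space M) U S)) (sets (vimage_algebra (space M) V T))"
    using ind by (auto simp: indep_elements_def)
  have hU: "(\<lambda>\<omega>. h (U \<omega>)) \<in> M \<rightarrow>\<^sub>M S'" using U h by (rule measurable_compose)
  have "sets (vimage_algebra (space M) (\<lambda>\<omega>. h (U \<omega>)) S') \<subseteq> sets (vimage_algebra (space M) U S)"
  proof
    fix A assume "A \<in> sets (vimage_algebra (space M) (\<lambda>\<omega>. h (U \<omega>)) S')"
    then obtain B where B: "B \<in> sets S'" "A = (\<lambda>\<omega>. h (U \<omega>)) -` B \<inter> space M"
      using measurable_space[OF hU] by (auto simp: sets_vimage_algebra2)
    have "A = U -` (h -` B \<inter> space S) \<inter> space M" using B(2) measurable_space[OF U] by auto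
    then show "A \<in> sets (vimage_algebra (space M) U S)"
      using in_vimage_algebra[OF measurable_sets[OF h B(1)]] by (simp only:)
  qed
  then have "indep_set (sets (vimage_algebra (space M) (\<lambda>\<omega>. h (U \<omega>)) S')) (sets (vimage_algebra (space M) V T))"
    unfolding indep_set_def
    by (intro indep_sets_mono_sets[OF indep[unfolded indep_set_def]]) (simp split: bool.split)
  then show ?thesis using hU V by (simp add: indep_elements_def)
qed

lemma indep_elements_integral_mult:
  fixes f :: "'b \<Rightarrow> real" and h :: "'c \<Rightarrow> real"
  assumes ind: "indep_elements M S U T V" and f: "f \<in> borel_measurable S" and h: "h \<in> borel_measurable T"
    and int: "integrable M (\<lambda>\<omega>. f (U \<omega>))" "integrable M (\<lambda>\<omega>. h (V \<omega>))"
  shows "(\<integral>\<omega>. f (U \<omega>) * h (V \<omega>) \<partial>M) = (\<integral>\<omega>. f (U \<omega>) \<partial>M) * (\<integral>\<omega>. h (V \<omega>) \<partial>M)"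
    and "integrable M (\<lambda>\<omega>. f (U \<omega>) * h (V \<omega>))"
proof -
  have U: "U \<in> M \<rightarrow>\<^sub>M S" and V: "V \<in> M \<rightarrow>\<^sub>M T" using ind by (auto simp: indep_elements_def)
  interpret U: prob_space "distr M S U" by (rule prob_space_distr[OF U])
  interpret V: prob_space "distr M T V" by (rule prob_space_distr[OF V])
  interpret UV: pair_prob_space "distr M S U" "distr M T V" ..
  have int': "integrable (distr M S U) f" "integrable (distr M T V) h"
    using int U V f h by (simp_all add: integrable_distr_eq)
  have prod: "integrable (distr M S U \<Otimes>\<^sub>M distr M T V) (\<lambda>x. f (fst x) * h (snd x))"
    by (rule UV.integrable_mult_pair[OF int'])
  have meas: "(\<lambda>x. f (fst x) * h (snd x)) \<in> borel_measurable (S \<Otimes>\<^sub>M T)"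
    using f h by (intro borel_measurable_times measurable_compose[OF measurable_fst] measurable_compose[OF measurable_snd])
  have UV: "(\<lambda>\<omega>. (U \<omega>, V \<omega>)) \<in> M \<rightarrow>\<^sub>M S \<Otimes>\<^sub>M T" using U V by (rule measurable_Pair)
  show "integrable M (\<lambda>\<omega>. f (U \<omega>) * h (V \<omega>))"
    using prod unfolding indep_elements_distr[OF ind, symmetric] integrable_distr_eq[OF UV meas] by simp
  have "(\<integral>\<omega>. f (U \<omega>) * h (V \<omega>) \<partial>M) = (\<integral>x. f (fst x) * h (snd x) \<partial>(distr M S U \<Otimes>\<^sub>M distr M T V))"
    unfolding indep_elements_distr[OF ind, symmetric] integral_distr[OF UV meas] by simp
  also have "\<dots> = (\<integral>x. f x \<partial>distr M S U) * (\<integral>x. h x \<partial>distr M T V)"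
    using UV.integral_fst'[OF prod] by simp
  finally show "(\<integral>\<omega>. f (U \<omega>) * h (V \<omega>) \<partial>M) = (\<integral>\<omega>. f (U \<omega>) \<partial>M) * (\<integral>\<omega>. h (V \<omega>) \<partial>M)"
    using U V f h by (simp add: integral_distr)
qed

end

lemma measurable_permutation_space: "f \<in> permutation_space n \<rightarrow>\<^sub>M N \<longleftrightarrow> f \<in> space (permutation_space n) \<rightarrow> space N"
  by (auto simp: measurable_def permutation_space_def space_uniform_count_measure sets_uniform_count_measure)

text \<open>The integrand is decomposed along the finitely many events \<pi> = p. Each has
  probability 1 / n! and is independent of \<open>U\<close>, so every piece factors.\<close>

lemma (in prob_space) integral_uniform_permutation:
  fixes F :: "(nat \<Rightarrow> nat) \<Rightarrow> 'b \<Rightarrow> real"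
  assumes ind: "indep_elements M T U (permutation_space n) \<pi>"
    and unif: "distr M (permutation_space n) \<pi> = permutation_space n"
    and F: "\<And>p. p permutes {1..n} \<Longrightarrow> F p \<in> borel_measurable T"
    and int: "\<And>p. p permutes {1..n} \<Longrightarrow> integrable M (\<lambda>\<omega>. F p (U \<omega>))"
  shows "(\<integral>\<omega>. F (\<pi> \<omega>) (U \<omega>) \<partial>M) = perm_mean {1..n} (\<lambda>p. \<integral>\<omega>. F p (U \<omega>) \<partial>M)"
proof -
  let ?P = "{p. p permutes {1..n}}"
  have fin: "finite ?P" by (rule finite_permutations) simp
  have \<pi>: "\<pi> \<in> M \<rightarrow>\<^sub>M permutation_space n" using ind by (simp add: indep_elements_def)
  have mem: "\<pi> \<omega> \<in> ?P" if "\<omega> \<in> space M" for \<omega>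
    using measurable_space[OF \<pi> that] by (simp add: permutation_space_def space_uniform_count_measure)
  have ind_meas: "(indicator {p} :: (nat \<Rightarrow> nat) \<Rightarrow> real) \<in> borel_measurable (permutation_space n)" for p :: "nat \<Rightarrow> nat"
    by (simp add: measurable_permutation_space)
  have ind_int: "integrable M (\<lambda>\<omega>. indicator {p} (\<pi> \<omega>) :: real)" for p
  proof (rule integrable_const_bound[of _ 1])
    show "(\<lambda>\<omega>. indicator {p} (\<pi> \<omega>) :: real) \<in> borel_measurable M" by (rule measurable_compose[OF \<pi> ind_meas])
  qed (auto simp: indicator_def)
  have prob: "(\<integral>\<omega>. indicator {p} (\<pi> \<omega>) \<partial>M) = 1 / (fact n :: real)" if "p \<in> ?P" for p
  proof -
    have "(\<integral>\<omega>. indicator {p} (\<pi> \<omega>) \<partial>M) = (\<integral>q. indicator {p} q \<partial>permutation_space n :: real)"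
      using integral_distr[OF \<pi> ind_meas] unfolding unif by (rule sym)
    also have "\<dots> = (\<Sum>q\<in>?P. indicator {p} q) / card ?P"
      unfolding permutation_space_def by (rule integral_uniform_count_measure[OF fin])
    also have "\<dots> = 1 / fact n"
      using that fin by (simp add: indicator_def card_permutations)
    finally show ?thesis .
  qed
  note mult = indep_elements_integral_mult[of T U "permutation_space n" \<pi> "F p" "indicator {p}" for p,
      OF ind F ind_meas int ind_int]
  have "(\<integral>\<omega>. F (\<pi> \<omega>) (U \<omega>) \<partial>M) = (\<integral>\<omega>. (\<Sum>p\<in>?P. F p (U \<omega>) * indicator {p} (\<pi> \<omega>)) \<partial>M)"
    using mem fin by (intro Bochner_Integration.integral_cong) (auto simp: indicator_def)
  also have "\<dots> = (\<Sum>p\<in>?P. \<integral>\<omega>. F p (U \<omega>) * indicator {p} (\<pi> \<omega>) \<partial>M)"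
    using mult(2) by (intro Bochner_Integration.integral_sum) auto
  also have "\<dots> = (\<Sum>p\<in>?P. (\<integral>\<omega>. F p (U \<omega>) \<partial>M) * (1 / fact n))"
    using mult(1) prob by (intro sum.cong) auto
  also have "\<dots> = perm_mean {1..n} (\<lambda>p. \<integral>\<omega>. F p (U \<omega>) \<partial>M)"
    by (simp add: perm_mean_def sum_divide_distrib)
  finally show ?thesis .
qed

text \<open>After multiplication by n^2 (n - 1)^2 the claim compares the coefficients of eight
  nonnegative sums. The division by 3, which stems from the interpolation, triples the allowance on
  the right. The Gaussian part brings sqrt (n - 1) into the coefficients of \<open>sA\<close> and
  \<open>sD\<close>.\<close>

lemma (in random_array) error_le:
  defines "n \<equiv> real (card S)"
  shows "((\<Sum>i\<in>S. row_error i) / n + 1 / sqrt (n - 1) * (2 * sA / n + 8 * sD / (n * (n - 1)))) / 3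
    \<le> 1 / (2 * n\<^sup>2 * (n - 1)\<^sup>2) * (n ^ 3 * sA + 5 * (n\<^sup>2 * sB) + 9 * (n * sC) + 5 * (n\<^sup>2 * sD) + 14 * (n * sE) + 6 * sG + 8 * sK + 2 * (n * sM))"
proof -
  have n: "n \<ge> 2" using card_S by (simp add: n_def)
  define r where "r = sqrt (n - 1)"
  have r: "r > 0" "n - 1 = r * r" using n by (simp_all add: r_def)
  \<comment> \<open>This is (sqrt (n - 1) - 1)^2 \<ge> 0, expanded.\<close>
  have r_le: "r \<le> n / 2" using zero_le_power2[of "r - 1"] r(2) by (simp add: power2_eq_square algebra_simps)
  have nonneg: "sA \<ge> 0" "sB \<ge> 0" "sC \<ge> 0" "sD \<ge> 0" "sE \<ge> 0" "sG \<ge> 0" "sK \<ge> 0" "sM \<ge> 0"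
    unfolding sA_def sB_def sC_def sD_def sE_def sG_def sK_def sM_def
    by (intro sum_nonneg mult_nonneg_nonneg moment_nonneg)+
  define c where "c = n\<^sup>2 * (n - 1)\<^sup>2"
  have c: "c > 0" using n by (simp add: c_def)
  define Q where "Q = sA / (2 * n) + 3 / 2 * sC / (n\<^sup>2 * (n - 1)) + 3 / 2 * sD / n\<^sup>2 + sB / n\<^sup>2
    + 2 * (2 * sK + 3 * sG) / (n\<^sup>2 * (n - 1)\<^sup>2) + 2 * sM / (n\<^sup>2 * (n - 1)) + 4 * sE / (n\<^sup>2 * (n - 1))"
  have cQ: "c * Q = n * (n - 1)\<^sup>2 / 2 * sA + 3 / 2 * (n - 1) * sC + 3 / 2 * (n - 1)\<^sup>2 * sD + (n - 1)\<^sup>2 * sB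
    + 2 * (2 * sK + 3 * sG) + 2 * (n - 1) * sM + 4 * (n - 1) * sE"
  proof -
    define m where "m = n - 1"
    have pos: "n > 0" "m > 0" using n by (simp_all add: m_def)
    have "c * (sA / (2 * n)) = n * m\<^sup>2 / 2 * sA" "c * (3 / 2 * sC / (n\<^sup>2 * m)) = 3 / 2 * m * sC"
      "c * (3 / 2 * sD / n\<^sup>2) = 3 / 2 * m\<^sup>2 * sD" "c * (sB / n\<^sup>2) = m\<^sup>2 * sB"
      "c * (2 * (2 * sK + 3 * sG) / (n\<^sup>2 * m\<^sup>2)) = 2 * (2 * sK + 3 * sG)"
      "c * (2 * sM / (n\<^sup>2 * m)) = 2 * m * sM" "c * (4 * sE / (n\<^sup>2 * m)) = 4 * m * sE"
      using pos unfolding c_def m_def[symmetric] by (simp_all add: power2_eq_square)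
    then show ?thesis unfolding Q_def distrib_left[of c] m_def[symmetric] by (simp only:)
  qed
  have cR: "c * (1 / r * (2 * sA / n + 8 * sD / (n * (n - 1)))) = 2 * n * (r * (n - 1)) * sA + 8 * n * r * sD"
    using n r(1) unfolding c_def r(2) by (simp add: field_simps power2_eq_square)
  \<comment> \<open>The critical coefficient: twice the total gives \<open>sA\<close> the weight n
    (n - 1)^2 from the permuted sum and 4 n (n - 1) sqrt (n - 1) from the Gaussian one. These are
    estimated by n^3 and 2 n^3, which uses the factor 3 in full.\<close>
  have "r * (n - 1) \<le> n / 2 * n" using r_le r(1) n by (intro mult_mono) auto
  then have "n * (r * (n - 1)) \<le> n * (n / 2 * n)" using n by (intro mult_left_mono) auto
  moreover have sq: "(n - 1)\<^sup>2 \<le> n\<^sup>2" using n by (intro power_mono) auto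
  then have "n * (n - 1)\<^sup>2 \<le> n * n\<^sup>2" using n by (intro mult_left_mono) auto
  ultimately have "n * (n - 1)\<^sup>2 + 4 * (n * (r * (n - 1))) \<le> 3 * n ^ 3" by (simp add: power2_eq_square power3_eq_cube)
  then have A: "(n * (n - 1)\<^sup>2 + 4 * (n * (r * (n - 1)))) * sA \<le> 3 * n ^ 3 * sA" using nonneg by (intro mult_right_mono)
  have "n * r \<le> n * (n / 2)" using r_le n by (intro mult_left_mono) auto
  then have "3 * (n - 1)\<^sup>2 + 16 * (n * r) \<le> 15 * n\<^sup>2" using sq zero_le_power2[of n] unfolding power2_eq_square by linarith
  then have D: "(3 * (n - 1)\<^sup>2 + 16 * (n * r)) * sD \<le> 15 * n\<^sup>2 * sD" using nonneg by (intro mult_right_mono)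
  have B: "2 * (n - 1)\<^sup>2 * sB \<le> 15 * n\<^sup>2 * sB"
    using sq zero_le_power2[of n] nonneg by (intro mult_right_mono) (linarith, simp)
  have C: "3 * (n - 1) * sC \<le> 27 * n * sC" using n nonneg by (intro mult_right_mono) auto
  have M: "4 * (n - 1) * sM \<le> 6 * n * sM" using n nonneg by (intro mult_right_mono) auto
  have E: "8 * (n - 1) * sE \<le> 42 * n * sE" using n nonneg by (intro mult_right_mono) auto
  define T where "T = n ^ 3 * sA + 5 * (n\<^sup>2 * sB) + 9 * (n * sC) + 5 * (n\<^sup>2 * sD) + 14 * (n * sE) + 6 * sG + 8 * sK + 2 * (n * sM)"
  have "2 * (c * (Q + 1 / r * (2 * sA / n + 8 * sD / (n * (n - 1))))) \<le> 3 * T"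
  proof -
    have "2 * (c * (Q + 1 / r * (2 * sA / n + 8 * sD / (n * (n - 1)))))
        = (n * (n - 1)\<^sup>2 + 4 * (n * (r * (n - 1)))) * sA + 2 * (n - 1)\<^sup>2 * sB + 3 * (n - 1) * sC
          + (3 * (n - 1)\<^sup>2 + 16 * (n * r)) * sD + 8 * (n - 1) * sE + 12 * sG + 8 * sK + 4 * (n - 1) * sM"
      unfolding distrib_left[of c] cQ cR by (simp add: field_simps)
    also have "\<dots> \<le> 3 * n ^ 3 * sA + 15 * n\<^sup>2 * sB + 27 * n * sC + 15 * n\<^sup>2 * sD + 42 * n * sE + 18 * sG + 24 * sK + 6 * n * sM"
      using nonneg by (intro add_mono A B C D E M) auto
    also have "\<dots> = 3 * T" by (simp add: T_def)
    finally show ?thesis .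
  qed
  then have "(Q + 1 / r * (2 * sA / n + 8 * sD / (n * (n - 1)))) / 3 \<le> T / (2 * c)"
    using c by (simp add: field_simps)
  moreover have "((\<Sum>i\<in>S. row_error i) / n + 1 / r * (2 * sA / n + 8 * sD / (n * (n - 1)))) / 3
      \<le> (Q + 1 / r * (2 * sA / n + 8 * sD / (n * (n - 1)))) / 3"
    unfolding Q_def n_def by (intro divide_right_mono add_right_mono sum_row_error_le) simp
  ultimately have "((\<Sum>i\<in>S. row_error i) / n + 1 / r * (2 * sA / n + 8 * sD / (n * (n - 1)))) / 3 \<le> T / (2 * c)"
    by linarith
  then show ?thesis by (simp add: T_def c_def r_def mult.assoc)
qed

lemma (in random_array) sum_moments:
  defines "n \<equiv> real (card S)"
  shows "(\<Sum>i\<in>S. \<Sum>j\<in>S. \<Sum>k\<in>S. \<Sum>l\<in>S. \<Sum>u\<in>S. moment 3 i k + 5 * (moment 2 i k * moment 1 i l) + 9 * (moment 2 i k * moment 1 j l)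
      + 5 * (moment 2 i k * moment 1 j k) + 14 * (moment 1 i k * moment 1 i l * moment 1 j l)
      + 6 * (moment 1 i k * moment 1 j l * moment 1 i u) + 8 * (moment 1 u k * moment 1 i k * moment 1 j l)
      + 2 * (moment 1 u k * moment 1 i k * moment 1 j k))
    = n ^ 3 * sA + 5 * (n\<^sup>2 * sB) + 9 * (n * sC) + 5 * (n\<^sup>2 * sD) + 14 * (n * sE) + 6 * sG + 8 * sK + 2 * (n * sM)"
proof -
  have "(\<Sum>i\<in>S. \<Sum>j\<in>S. \<Sum>k\<in>S. \<Sum>l\<in>S. \<Sum>u\<in>S. moment 3 i k) = n ^ 3 * sA"
    "(\<Sum>i\<in>S. \<Sum>j\<in>S. \<Sum>k\<in>S. \<Sum>l\<in>S. \<Sum>u\<in>S. moment 2 i k * moment 1 i l) = n\<^sup>2 * sB"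
    "(\<Sum>i\<in>S. \<Sum>j\<in>S. \<Sum>k\<in>S. \<Sum>l\<in>S. \<Sum>u\<in>S. moment 2 i k * moment 1 j l) = n * sC"
    "(\<Sum>i\<in>S. \<Sum>j\<in>S. \<Sum>k\<in>S. \<Sum>l\<in>S. \<Sum>u\<in>S. moment 2 i k * moment 1 j k) = n\<^sup>2 * sD"
    "(\<Sum>i\<in>S. \<Sum>j\<in>S. \<Sum>k\<in>S. \<Sum>l\<in>S. \<Sum>u\<in>S. moment 1 i k * moment 1 i l * moment 1 j l) = n * sE"
    "(\<Sum>i\<in>S. \<Sum>j\<in>S. \<Sum>k\<in>S. \<Sum>l\<in>S. \<Sum>u\<in>S. moment 1 u k * moment 1 i k * moment 1 j k) = n * sM"
    by (simp_all add: n_def sA_def sB_def sC_def sD_def sE_def sM_def sum_distrib_left power2_eq_square power3_eq_cube mult_ac del: One_nat_def)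
  then show ?thesis
    by (simp only: sum.distrib sum_distrib_left[symmetric] sG_def sK_def)
qed

theorem theorem5p1:
  fixes M :: "'a measure"
    and n :: nat
    and X X'' Z :: "nat \<Rightarrow> nat \<Rightarrow> 'a \<Rightarrow> real"
    and \<pi> :: "'a \<Rightarrow> nat \<Rightarrow> nat"
    and c \<sigma> :: "nat \<Rightarrow> nat \<Rightarrow> real"
    and s :: real
    and Zhat :: "nat \<Rightarrow> 'a \<Rightarrow> real"
    and Y D :: "'a \<Rightarrow> skorokhod"
    and g :: "skorokhod \<Rightarrow> real"
  assumes "prob_space M"
    and "n \<ge> 2"
    and X_indep: "prob_space.indep_vars M (\<lambda>_. borel) (\<lambda>(i, j). X i j) (index_square n)"
    and X_third_moment: "\<And>i j. i \<in> {1..n} \<Longrightarrow> j \<in> {1..n} \<Longrightarrow> integrable M (\<lambda>\<omega>. \<bar>X i j \<omega>\<bar> ^ 3)"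
    and X_mean: "\<And>i j. i \<in> {1..n} \<Longrightarrow> j \<in> {1..n} \<Longrightarrow> (\<integral>\<omega>. X i j \<omega> \<partial>M) = c i j"
    and X_variance: "\<And>i j. i \<in> {1..n} \<Longrightarrow> j \<in> {1..n} \<Longrightarrow>
          (\<integral>\<omega>. (X i j \<omega> - (\<integral>\<omega>'. X i j \<omega>' \<partial>M))\<^sup>2 \<partial>M) = (\<sigma> i j)\<^sup>2"
    and row_sums: "\<And>i. i \<in> {1..n} \<Longrightarrow> (\<Sum>j\<in>{1..n}. c i j) = 0"
    and column_sums: "\<And>j. j \<in> {1..n} \<Longrightarrow> (\<Sum>i\<in>{1..n}. c i j) = 0"
    and pi_indep: "indep_elements M (array_space n) (array n X) (permutation_space n) \<pi>"
    and pi_uniform: "distr M (permutation_space n) \<pi> = permutation_space n"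
    and s_squared: "s\<^sup>2 = 1 / real n * (\<Sum>i\<in>{1..n}. \<Sum>j\<in>{1..n}. (\<sigma> i j)\<^sup>2)
          + 1 / (real n - 1) * (\<Sum>i\<in>{1..n}. \<Sum>j\<in>{1..n}. (c i j)\<^sup>2)"
    and s_pos: "s > 0"
    and Y_def: "\<And>\<omega>. Y \<omega> = (1 / s) *\<^sub>R partial_sum_path n (\<lambda>i. X i (\<pi> \<omega> i) \<omega>)"
    and X''_indep: "indep_elements M (array_space n) (array n X) (array_space n) (array n X'')"
    and X''_copy: "distr M (array_space n) (array n X'') = distr M (array_space n) (array n X)"
    and Z_indep: "prob_space.indep_vars M (\<lambda>_. borel) (\<lambda>(i, l). Z i l) (index_square n)"
    and Z_normal: "\<And>i l. i \<in> {1..n} \<Longrightarrow> l \<in> {1..n} \<Longrightarrow>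
          distributed M lborel (Z i l) std_normal_density"
    and Z_indep_X: "indep_elements M
          (array_space n \<Otimes>\<^sub>M array_space n) (\<lambda>\<omega>. (array n X \<omega>, array n X'' \<omega>))
          (array_space n) (array n Z)"
    and Zhat_def: "\<And>i \<omega>. Zhat i \<omega> = 1 / sqrt (real n - 1) *
          (\<Sum>l\<in>{1..n}. X'' i l \<omega> * (Z i l \<omega> - 1 / real n * (\<Sum>j\<in>{1..n}. Z j l \<omega>)))"
    and D_def: "\<And>\<omega>. D \<omega> = (1 / s) *\<^sub>R partial_sum_path n (\<lambda>i. Zhat i \<omega>)"
    and g: "g \<in> class_M1"
  shows "\<bar>(\<integral>\<omega>. g (Y \<omega>) \<partial>M) - (\<integral>\<omega>. g (D \<omega>) \<partial>M)\<bar> \<le>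
    enn2real (norm_M1 g) / (2 * real n ^ 2 * (real n - 1) ^ 2 * s ^ 3) *
      (\<Sum>i\<in>{1..n}. \<Sum>j\<in>{1..n}. \<Sum>k\<in>{1..n}. \<Sum>l\<in>{1..n}. \<Sum>u\<in>{1..n}.
          (\<integral>\<omega>. \<bar>X i k \<omega>\<bar> ^ 3 \<partial>M)
        + 5 * (\<integral>\<omega>. \<bar>X i k \<omega>\<bar>\<^sup>2 \<partial>M) * (\<integral>\<omega>. \<bar>X i l \<omega>\<bar> \<partial>M)
        + 9 * (\<integral>\<omega>. \<bar>X i k \<omega>\<bar>\<^sup>2 \<partial>M) * (\<integral>\<omega>. \<bar>X j l \<omega>\<bar> \<partial>M)
        + 5 * (\<integral>\<omega>. \<bar>X i k \<omega>\<bar>\<^sup>2 \<partial>M) * (\<integral>\<omega>. \<bar>X j k \<omega>\<bar> \<partial>M)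
        + 14 * (\<integral>\<omega>. \<bar>X i k \<omega>\<bar> \<partial>M) * (\<integral>\<omega>. \<bar>X i l \<omega>\<bar> \<partial>M) * (\<integral>\<omega>. \<bar>X j l \<omega>\<bar> \<partial>M)
        + 2 * (\<integral>\<omega>. \<bar>X i k \<omega>\<bar> \<partial>M) * (\<integral>\<omega>. \<bar>X i l \<omega>\<bar> \<partial>M) * (\<integral>\<omega>. \<bar>X i u \<omega>\<bar> \<partial>M)
        + 6 * (\<integral>\<omega>. \<bar>X i k \<omega>\<bar> \<partial>M) * (\<integral>\<omega>. \<bar>X j l \<omega>\<bar> \<partial>M) * (\<integral>\<omega>. \<bar>X i u \<omega>\<bar> \<partial>M)
        + 2 * (\<integral>\<omega>. \<bar>X u k \<omega>\<bar> * \<bar>X i k \<omega>\<bar>\<^sup>2 \<partial>M)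
        + 4 * (\<integral>\<omega>. \<bar>X u k \<omega> * X i k \<omega>\<bar> \<partial>M) * (\<integral>\<omega>. \<bar>X i l \<omega>\<bar> \<partial>M)
        + 4 * (\<integral>\<omega>. \<bar>X u k \<omega> * X i k \<omega>\<bar> \<partial>M) * (\<integral>\<omega>. \<bar>X j l \<omega>\<bar> \<partial>M)
        + 8 * (\<integral>\<omega>. \<bar>X u k \<omega>\<bar> \<partial>M) * (\<integral>\<omega>. \<bar>X i k \<omega>\<bar> \<partial>M) * (\<integral>\<omega>. \<bar>X j l \<omega>\<bar> \<partial>M)
        + 2 * (\<integral>\<omega>. \<bar>X u k \<omega> * X i k \<omega> * X j k \<omega>\<bar> \<partial>M)
        + 2 * (\<integral>\<omega>. \<bar>X u k \<omega>\<bar> \<partial>M) * (\<integral>\<omega>. \<bar>X i k \<omega>\<bar> \<partial>M) * (\<integral>\<omega>. \<bar>X j k \<omega>\<bar> \<partial>M)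
        + 2 / real n * (\<integral>\<omega>. 2 * \<bar>X i k \<omega>\<bar> + 6 * \<bar>X j l \<omega>\<bar> \<partial>M) *
            ((\<Sum>r\<in>{1..n}. (\<integral>\<omega>. \<bar>X i r \<omega>\<bar>\<^sup>2 \<partial>M)) + \<bar>\<Sum>r\<in>{1..n}. c i r * c j r\<bar>))
    + 2 * enn2real (norm_M1 g) / sqrt (real n)
    + enn2real (norm_M1 g) / (real n ^ 2 * s\<^sup>2) * (\<Sum>i\<in>{1..n}. \<Sum>j\<in>{1..n}. (\<sigma> i j)\<^sup>2)"

proof -
  interpret prob_space M by fact
  let ?S = "{1..n}"
  let ?N = "enn2real (norm_M1 g)"
  \<comment> \<open>The normalization is put into the directions, so that s enters the error through
    \<epsilon>^3 alone.\<close>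
  define e where "e i = (1 / s) *\<^sub>R step_path n i" for i
  have e_norm: "norm (e i) \<le> 1 / s" for i
    using norm_step_path[of n i] s_pos by (simp add: e_def divide_right_mono)
  interpret X: random_array M X ?S
    using \<open>n \<ge> 2\<close> X_indep X_third_moment by unfold_locales auto
  have expansion: "array_expansion M X ?S F1 F2 K L e (1 / s)" if "lipschitz_hessian F1 F2 K L" for F1 F2 K L
    using X.random_array_axioms that e_norm by (intro array_expansion.intro array_expansion_axioms.intro)
  define Z' where "Z' q = Z (fst q) (snd q)" for q
  have Z'_eq: "Z' = (\<lambda>(i, l). Z i l)" by (simp add: Z'_def fun_eq_iff)
  have gaussian: "gaussian_array M X ?S F1 F2 K L e (1 / s) M Z'" if "lipschitz_hessian F1 F2 K L" for F1 F2 K L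
    using expansion[OF that] prob_space_axioms Z_indep Z_normal
    by (intro gaussian_array.intro gaussian_array_axioms.intro) (auto simp: Z'_eq)
  have hessian: "lipschitz_hessian (\<lambda>w. blinfun_apply (frechet1 g w)) (\<lambda>w x. blinfun_apply (blinfun_apply (frechet2 g w) x)) ?N ?N"
    by (rule class_M1_lipschitz_hessian[OF g])
  have row_mean: "(\<Sum>k\<in>?S. X.mean j k) = 0" if "j \<in> ?S" for j
    using row_sums[OF that] X_mean that by (simp add: X.mean_def)

  let ?A = "array_space n"
  have X_array: "array n X \<in> M \<rightarrow>\<^sub>M ?A" using pi_indep by (simp add: indep_elements_def)
  have X''_array: "array n X'' \<in> M \<rightarrow>\<^sub>M ?A" using X''_indep by (simp add: indep_elements_def)
  have Z_array: "array n Z \<in> M \<rightarrow>\<^sub>M ?A" using Z_indep_X by (simp add: indep_elements_def)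
  have component: "(\<lambda>x. x q) \<in> borel_measurable ?A" if "q \<in> ?S \<times> ?S" for q
    using that unfolding array_space_def by (rule measurable_component_singleton)
  have permutes: "\<pi> \<omega> permutes ?S" if "\<omega> \<in> space M" for \<omega>
    using measurable_space[of \<pi> M "permutation_space n" \<omega>] pi_indep that
    by (simp add: indep_elements_def permutation_space_def space_uniform_count_measure)

  have Y_sum: "Y \<omega> = (\<Sum>i\<in>?S. X i (\<pi> \<omega> i) \<omega> *\<^sub>R e i)" for \<omega>
    by (simp add: Y_def partial_sum_path_eq e_def scaleR_sum_right mult.commute)
  have D_sum: "D \<omega> = (\<Sum>i\<in>?S. Zhat i \<omega> *\<^sub>R e i)" for \<omega>
    by (simp add: D_def partial_sum_path_eq e_def scaleR_sum_right mult.commute)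

  have stein_Y: "stein_approx M ?S e X.covariance Y ((1 / s) ^ 3 * ((\<Sum>i\<in>?S. X.row_error i) / real n))"
    unfolding stein_approx_def
  proof (intro allI impI)
    fix F1 :: "skorokhod \<Rightarrow> skorokhod \<Rightarrow> real" and F2 K L assume lh: "lipschitz_hessian F1 F2 K L"
    interpret E: array_expansion M X ?S F1 F2 K L e "1 / s" by (rule expansion[OF lh])
    \<comment> \<open>\<open>w p x\<close> is the path as a function of a permutation and an array.
      The independence assumption concerns \<open>array n X\<close> and \<pi>, so the integrands are
      rewritten through \<open>w\<close> before \<pi> is averaged out.\<close>
    define w where "w p x = (\<Sum>m\<in>?S. x (m, p m) *\<^sub>R e m)" for p and x :: "nat \<times> nat \<Rightarrow> real"
    have w_eq: "w p (array n X \<omega>) = E.W {} p \<omega>" if "p permutes ?S" for p \<omega>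
      unfolding w_def E.W_def using E.permutes_memb[OF that] by (intro sum.cong) (auto simp: array_def)
    have w_Y: "w (\<pi> \<omega>) (array n X \<omega>) = Y \<omega>" if "\<omega> \<in> space M" for \<omega>
      unfolding w_def Y_sum using E.permutes_memb[OF permutes[OF that]] by (intro sum.cong) (auto simp: array_def)
    have w_measurable: "(\<lambda>x. f (w p x) :: real) \<in> borel_measurable ?A" if "p permutes ?S" "continuous_on UNIV f" for f p
      unfolding w_def using that E.permutes_memb[OF that(1)] by (intro borel_measurable_continuous_sum component) auto
    have F1_w: "F1 v (w p x) = (\<Sum>m\<in>?S. x (m, p m) * F1 v (e m))" for v p x
      by (simp add: w_def E.F1_sum)
    have mean_F1: "(\<integral>\<omega>. F1 (w (\<pi> \<omega>) (array n X \<omega>)) (w (\<pi> \<omega>) (array n X \<omega>)) \<partial>M)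
        = perm_mean ?S (\<lambda>p. \<integral>\<omega>. F1 (w p (array n X \<omega>)) (w p (array n X \<omega>)) \<partial>M)"
    proof (rule integral_uniform_permutation[OF pi_indep pi_uniform, of "\<lambda>p x. F1 (w p x) (w p x)"])
      fix p assume p: "p permutes ?S"
      show "(\<lambda>x. F1 (w p x) (w p x)) \<in> borel_measurable ?A"
        unfolding F1_w using E.permutes_memb[OF p]
        by (intro borel_measurable_sum borel_measurable_times component w_measurable[OF p] E.F1_continuous) auto
      have "F1 (w p (array n X \<omega>)) (w p (array n X \<omega>)) = (\<Sum>m\<in>?S. X m (p m) \<omega> * F1 (E.W {} p \<omega>) (e m))" for \<omega>
        unfolding w_eq[OF p] by (subst (2) E.W_def) (simp add: E.F1_sum)
      then show "integrable M (\<lambda>\<omega>. F1 (w p (array n X \<omega>)) (w p (array n X \<omega>)))"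
        by (simp only:) (intro Bochner_Integration.integrable_sum E.X_F1_integrable[OF p] E.permutes_memb[OF p])
    qed
    have 1: "(\<integral>\<omega>. F1 (Y \<omega>) (Y \<omega>) \<partial>M) = perm_mean ?S (\<lambda>p. \<integral>\<omega>. F1 (E.W {} p \<omega>) (E.W {} p \<omega>) \<partial>M)"
    proof -
      have "(\<integral>\<omega>. F1 (Y \<omega>) (Y \<omega>) \<partial>M) = (\<integral>\<omega>. F1 (w (\<pi> \<omega>) (array n X \<omega>)) (w (\<pi> \<omega>) (array n X \<omega>)) \<partial>M)"
        by (intro Bochner_Integration.integral_cong) (simp_all only: w_Y)
      moreover have "perm_mean ?S (\<lambda>p. \<integral>\<omega>. F1 (w p (array n X \<omega>)) (w p (array n X \<omega>)) \<partial>M)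
          = perm_mean ?S (\<lambda>p. \<integral>\<omega>. F1 (E.W {} p \<omega>) (E.W {} p \<omega>) \<partial>M)"
        by (intro perm_mean_cong) (simp only: w_eq)
      ultimately show ?thesis by (simp only: mean_F1)
    qed
    have mean_F2: "(\<integral>\<omega>. F2 (w (\<pi> \<omega>) (array n X \<omega>)) (e i) (e j) \<partial>M)
        = perm_mean ?S (\<lambda>p. \<integral>\<omega>. F2 (w p (array n X \<omega>)) (e i) (e j) \<partial>M)" for i j
      using w_measurable E.F2_continuous E.F2_W_integrable
      by (intro integral_uniform_permutation[OF pi_indep pi_uniform, of "\<lambda>p x. F2 (w p x) (e i) (e j)"]) (auto simp: w_eq)
    have 2: "(\<integral>\<omega>. F2 (Y \<omega>) (e i) (e j) \<partial>M) = perm_mean ?S (\<lambda>p. \<integral>\<omega>. F2 (E.W {} p \<omega>) (e i) (e j) \<partial>M)" for i j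
    proof -
      have "(\<integral>\<omega>. F2 (Y \<omega>) (e i) (e j) \<partial>M) = (\<integral>\<omega>. F2 (w (\<pi> \<omega>) (array n X \<omega>)) (e i) (e j) \<partial>M)"
        by (intro Bochner_Integration.integral_cong) (simp_all only: w_Y)
      moreover have "perm_mean ?S (\<lambda>p. \<integral>\<omega>. F2 (w p (array n X \<omega>)) (e i) (e j) \<partial>M)
          = perm_mean ?S (\<lambda>p. \<integral>\<omega>. F2 (E.W {} p \<omega>) (e i) (e j) \<partial>M)"
        by (intro perm_mean_cong) (simp only: w_eq)
      ultimately show ?thesis by (simp only: mean_F2)
    qed
    show "\<bar>(\<integral>\<omega>. F1 (Y \<omega>) (Y \<omega>) \<partial>M) - (\<Sum>i\<in>?S. \<Sum>j\<in>?S. X.covariance i j * (\<integral>\<omega>. F2 (Y \<omega>) (e i) (e j) \<partial>M))\<bar>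
        \<le> L * ((1 / s) ^ 3 * ((\<Sum>i\<in>?S. X.row_error i) / real n))"
      using E.permutation_expansion[OF row_mean] unfolding 1 2 by (simp add: mult.assoc)
  qed

  \<comment> \<open>The function \<open>h\<close> defined with these coefficients expresses
    \<open>D\<close> through the arrays of \<open>X''\<close> and \<open>Z\<close>, so that only
    their joint law matters.\<close>
  define coeff where "coeff q z = 1 / sqrt (real n - 1) * (z q - 1 / real n * (\<Sum>j\<in>?S. z (j, snd q)))" for q and z :: "nat \<times> nat \<Rightarrow> real"
  define h where "h x = (\<Sum>q\<in>?S \<times> ?S. (coeff q (snd x) * fst x q) *\<^sub>R e (fst q))" for x :: "(nat \<times> nat \<Rightarrow> real) \<times> (nat \<times> nat \<Rightarrow> real)"
  have coeff_measurable: "(\<lambda>x. coeff q (snd x) * fst x q) \<in> borel_measurable (?A \<Otimes>\<^sub>M ?A)" if "q \<in> ?S \<times> ?S" for q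
    unfolding coeff_def using that
    by (intro borel_measurable_times borel_measurable_diff borel_measurable_sum borel_measurable_const
        measurable_compose[OF measurable_fst component] measurable_compose[OF measurable_snd component]) auto
  have h_measurable: "(\<lambda>x. f (h x) :: real) \<in> borel_measurable (?A \<Otimes>\<^sub>M ?A)" if "continuous_on UNIV f" for f
    unfolding h_def by (intro borel_measurable_continuous_sum that coeff_measurable)
  have h_D: "h (array n X'' \<omega>, array n Z \<omega>) = D \<omega>" for \<omega>
  proof -
    have "h (array n X'' \<omega>, array n Z \<omega>) = (\<Sum>i\<in>?S. \<Sum>l\<in>?S. (coeff (i, l) (array n Z \<omega>) * array n X'' \<omega> (i, l)) *\<^sub>R e i)"
      by (simp add: h_def sum.cartesian_product split_beta)
    also have "\<dots> = D \<omega>"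
      unfolding D_sum scaleR_sum_left[symmetric]
      by (intro sum.cong refl arg_cong[where f = "\<lambda>t. t *\<^sub>R _"])
        (auto simp: Zhat_def coeff_def array_def sum_distrib_left mult_ac intro!: sum.cong)
    finally show ?thesis .
  qed
  have X''_Z: "indep_elements M ?A (array n X'') ?A (array n Z)"
    using indep_elements_compose[OF Z_indep_X measurable_snd] by simp
  interpret MM: pair_prob_space M M ..
  \<comment> \<open>\<open>X''\<close> has the law of \<open>X\<close> and is independent of
    \<open>Z\<close>, so the pair has the law of \<open>X\<close> and \<open>Z\<close> placed on the
    two factors of a product. This moves \<open>D\<close> into the setting of
    \<open>gaussian_array\<close>, with \<open>X\<close> itself in the role of
    \<open>X''\<close>.\<close>
  have transfer: "(\<integral>\<omega>. f (array n X'' \<omega>, array n Z \<omega>) \<partial>M) = (\<integral>x. f (array n X (fst x), array n Z (snd x)) \<partial>(M \<Otimes>\<^sub>M M))"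
    if f: "f \<in> borel_measurable (?A \<Otimes>\<^sub>M ?A)" for f :: "_ \<Rightarrow> real"
  proof -
    interpret Z: prob_space "distr M ?A (array n Z)" by (rule prob_space_distr[OF Z_array])
    have "distr M (?A \<Otimes>\<^sub>M ?A) (\<lambda>\<omega>. (array n X'' \<omega>, array n Z \<omega>)) = distr M ?A (array n X) \<Otimes>\<^sub>M distr M ?A (array n Z)"
      using indep_elements_distr[OF X''_Z] X''_copy by simp
    also have "\<dots> = distr (M \<Otimes>\<^sub>M M) (?A \<Otimes>\<^sub>M ?A) (\<lambda>(x, y). (array n X x, array n Z y))"
      by (intro pair_measure_distr X_array Z_array Z.sigma_finite_measure_axioms)
    finally have eq: "distr M (?A \<Otimes>\<^sub>M ?A) (\<lambda>\<omega>. (array n X'' \<omega>, array n Z \<omega>))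
      = distr (M \<Otimes>\<^sub>M M) (?A \<Otimes>\<^sub>M ?A) (\<lambda>(x, y). (array n X x, array n Z y))" .
    have "(\<integral>\<omega>. f (array n X'' \<omega>, array n Z \<omega>) \<partial>M) = (\<integral>x. f x \<partial>distr M (?A \<Otimes>\<^sub>M ?A) (\<lambda>\<omega>. (array n X'' \<omega>, array n Z \<omega>)))"
      using f by (intro integral_distr[symmetric] measurable_Pair X''_array Z_array)
    also have "\<dots> = (\<integral>x. f (case x of (x, y) \<Rightarrow> (array n X x, array n Z y)) \<partial>(M \<Otimes>\<^sub>M M))"
    proof -
      have "(\<lambda>(x, y). (array n X x, array n Z y)) \<in> M \<Otimes>\<^sub>M M \<rightarrow>\<^sub>M ?A \<Otimes>\<^sub>M ?A"
        unfolding split_beta'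
        by (intro measurable_Pair measurable_compose[OF measurable_fst X_array] measurable_compose[OF measurable_snd Z_array])
      then show ?thesis unfolding eq using f by (rule integral_distr)
    qed
    finally show ?thesis by (simp add: split_beta')
  qed
  define R where "R = 1 / sqrt (real n - 1) * (2 * X.sA / real n + 8 * X.sD / (real n * (real n - 1)))"
  have stein_D: "stein_approx M ?S e X.covariance D ((1 / s) ^ 3 * R)"
    unfolding stein_approx_def
  proof (intro allI impI)
    fix F1 :: "skorokhod \<Rightarrow> skorokhod \<Rightarrow> real" and F2 K L assume lh: "lipschitz_hessian F1 F2 K L"
    interpret E: gaussian_array M X ?S F1 F2 K L e "1 / s" M Z' by (rule gaussian[OF lh])
    have h_G: "h (array n X (fst x), array n Z (snd x)) = E.G x" for x
      unfolding h_def E.G_def E.V_def E.\<theta>_def E.\<zeta>_def coeff_def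
      by (intro sum.cong) (auto simp: array_def Z'_def)
    have "F1 v (h x) = (\<Sum>q\<in>?S \<times> ?S. coeff q (snd x) * fst x q * F1 v (e (fst q)))" for v x
      by (simp add: h_def linear_sum[OF E.F1_linear] linear_scale[OF E.F1_linear])
    then have "(\<lambda>x. F1 (h x) (h x)) \<in> borel_measurable (?A \<Otimes>\<^sub>M ?A)"
      by (simp only:) (intro borel_measurable_sum borel_measurable_times coeff_measurable h_measurable E.F1_continuous)
    note 1 = transfer[OF this, unfolded h_D h_G]
    have 2: "(\<integral>\<omega>. F2 (D \<omega>) (e i) (e j) \<partial>M) = (\<integral>x. F2 (E.G x) (e i) (e j) \<partial>(M \<Otimes>\<^sub>M M))" for i j
      using transfer[OF h_measurable[OF E.F2_continuous], of "e i" "e j"] unfolding h_D h_G .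
    show "\<bar>(\<integral>\<omega>. F1 (D \<omega>) (D \<omega>) \<partial>M) - (\<Sum>i\<in>?S. \<Sum>j\<in>?S. X.covariance i j * (\<integral>\<omega>. F2 (D \<omega>) (e i) (e j) \<partial>M))\<bar>
        \<le> L * ((1 / s) ^ 3 * R)"
      using E.gaussian_expansion unfolding 1 2 R_def by (simp add: mult.assoc)
  qed

  interpret E: gaussian_array M X ?S "\<lambda>w. blinfun_apply (frechet1 g w)" "\<lambda>w x. blinfun_apply (blinfun_apply (frechet2 g w) x)"
      ?N ?N e "1 / s" M Z'
    by (rule gaussian[OF hessian])
  \<comment> \<open>The random column is resolved by the indicators of the events \<pi> i = k; the
    product of such an indicator with an entry is integrable as a product of independent
    factors.\<close>
  have Y_integrable: "integrable M (\<lambda>\<omega>. X i (\<pi> \<omega> i) \<omega>)" if i: "i \<in> ?S" for i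
  proof -
    have "integrable M (\<lambda>\<omega>. array n X \<omega> (i, k) * indicator {k} (\<pi> \<omega> i))" if k: "k \<in> ?S" for k
    proof (rule indep_elements_integral_mult(2)[OF pi_indep])
      have eq: "array n X \<omega> (i, k) = X i k \<omega>" for \<omega> using i k by (simp add: array_def)
      show "integrable M (\<lambda>\<omega>. array n X \<omega> (i, k))" unfolding eq using i k by (rule X.integrable_X)
      show m: "(\<lambda>p. indicator {k} (p i) :: real) \<in> borel_measurable (permutation_space n)"
        by (simp add: measurable_permutation_space)
      have "(\<lambda>\<omega>. indicator {k} (\<pi> \<omega> i) :: real) \<in> borel_measurable M"
        using pi_indep measurable_compose[OF _ m, of \<pi> M] by (simp add: indep_elements_def)
      then show "integrable M (\<lambda>\<omega>. indicator {k} (\<pi> \<omega> i) :: real)"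
        by (intro integrable_const_bound[of _ 1]) (auto simp: indicator_def)
    qed (use i k in \<open>intro component; simp\<close>)
    then have "integrable M (\<lambda>\<omega>. \<Sum>k\<in>?S. array n X \<omega> (i, k) * indicator {k} (\<pi> \<omega> i))"
      by (intro Bochner_Integration.integrable_sum)
    moreover have "(\<Sum>k\<in>?S. array n X \<omega> (i, k) * indicator {k} (\<pi> \<omega> i)) = X i (\<pi> \<omega> i) \<omega>" if "\<omega> \<in> space M" for \<omega>
    proof -
      have "\<pi> \<omega> i \<in> ?S" by (rule E.permutes_memb[OF permutes[OF that] i])
      then have "(\<Sum>k\<in>?S. array n X \<omega> (i, k) * indicator {k} (\<pi> \<omega> i)) = array n X \<omega> (i, \<pi> \<omega> i)"
        by (simp add: indicator_def sum.delta if_distrib[of "\<lambda>x. _ * x"] cong: if_cong)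
      then show ?thesis using \<open>\<pi> \<omega> i \<in> ?S\<close> i by (simp add: array_def)
    qed
    ultimately show ?thesis by (simp cong: Bochner_Integration.integrable_cong)
  qed
  have X''_integrable: "integrable M (\<lambda>\<omega>. array n X'' \<omega> (i, l))" if il: "i \<in> ?S" "l \<in> ?S" for i l
  proof -
    have m: "(\<lambda>x. x (i, l)) \<in> borel_measurable ?A" using il by (intro component) simp
    have eq: "array n X \<omega> (i, l) = X i l \<omega>" for \<omega> using il by (simp add: array_def)
    have "integrable (distr M ?A (array n X)) (\<lambda>x. x (i, l))"
      unfolding integrable_distr_eq[OF X_array m] eq using il by (rule X.integrable_X)
    then show ?thesis unfolding X''_copy[symmetric] integrable_distr_eq[OF X''_array m] .
  qed
  have Zhat_integrable: "integrable M (Zhat i)" if i: "i \<in> ?S" for i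
  proof -
    have prod: "integrable M (\<lambda>\<omega>. X'' i l \<omega> * Z j l \<omega>)" if "l \<in> ?S" "j \<in> ?S" for l j
    proof -
      have Z: "integrable M (\<lambda>\<omega>. array n Z \<omega> (j, l))"
        using E.Z_first(1)[of "(j, l)"] that by (simp add: array_def Z'_def)
      have "integrable M (\<lambda>\<omega>. array n X'' \<omega> (i, l) * array n Z \<omega> (j, l))"
        using that i by (intro indep_elements_integral_mult(2)[OF X''_Z] X''_integrable Z component) auto
      then show ?thesis using that i by (simp add: array_def)
    qed
    have eq: "Zhat i \<omega> = 1 / sqrt (real n - 1) * (\<Sum>l\<in>?S. X'' i l \<omega> * Z i l \<omega> - 1 / real n * (\<Sum>j\<in>?S. X'' i l \<omega> * Z j l \<omega>))" for \<omega>
      by (simp add: Zhat_def right_diff_distrib sum_distrib_left mult_ac)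
    show ?thesis
      unfolding eq[abs_def] using i
      by (intro integrable_mult_right Bochner_Integration.integrable_sum Bochner_Integration.integrable_diff prod) auto
  qed
  \<comment> \<open>Both factors of the product are \<open>M\<close>, so the interpolation runs
    between independent copies of \<open>Y\<close> and \<open>D\<close>. This is harmless, because
    the claim involves their separate expectations only.\<close>
  interpret I: interpolation "\<lambda>w. blinfun_apply (frechet1 g w)" "\<lambda>w x. blinfun_apply (blinfun_apply (frechet2 g w) x)"
      ?N ?N M M g ?S e "\<lambda>i \<omega>. X i (\<pi> \<omega> i) \<omega>" Zhat Y D
  proof (intro interpolation.intro interpolation_axioms.intro hessian MM.pair_prob_space_axioms Y_sum D_sum Y_integrable Zhat_integrable)
    have "twice_frechet_differentiable g" using g by (simp add: class_M1_def class_M_def)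
    then show "(g has_derivative blinfun_apply (frechet1 g w)) (at w)" for w by (rule frechet1_has_derivative)
  qed simp_all
  define RY where "RY = (\<Sum>i\<in>?S. X.row_error i) / real n"
  have "\<bar>(\<integral>\<omega>. g (Y \<omega>) \<partial>M) - (\<integral>\<omega>. g (D \<omega>) \<partial>M)\<bar> \<le> ?N * ((1 / s) ^ 3 * RY + (1 / s) ^ 3 * R) / 3"
    using I.expectation_diff_le[OF stein_Y stein_D] by (simp only: RY_def)
  also have "\<dots> = ?N * (1 / s) ^ 3 * ((RY + R) / 3)" by (simp add: algebra_simps)
  also have "\<dots> \<le> ?N * (1 / s) ^ 3 * (1 / (2 * real n ^ 2 * (real n - 1) ^ 2) *
      (real n ^ 3 * X.sA + 5 * ((real n)\<^sup>2 * X.sB) + 9 * (real n * X.sC) + 5 * ((real n)\<^sup>2 * X.sD)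
        + 14 * (real n * X.sE) + 6 * X.sG + 8 * X.sK + 2 * (real n * X.sM)))"
    using X.error_le s_pos unfolding RY_def R_def by (intro mult_left_mono) simp_all
  also have "\<dots> = ?N / (2 * real n ^ 2 * (real n - 1) ^ 2 * s ^ 3) *
      (real n ^ 3 * X.sA + 5 * ((real n)\<^sup>2 * X.sB) + 9 * (real n * X.sC) + 5 * ((real n)\<^sup>2 * X.sD)
        + 14 * (real n * X.sE) + 6 * X.sG + 8 * X.sK + 2 * (real n * X.sM))" (is "_ = ?c * ?T")
    by (simp add: power_divide)
  finally have main: "\<bar>(\<integral>\<omega>. g (Y \<omega>) \<partial>M) - (\<integral>\<omega>. g (D \<omega>) \<partial>M)\<bar> \<le> ?c * ?T" .
  have T: "?T = (\<Sum>i\<in>?S. \<Sum>j\<in>?S. \<Sum>k\<in>?S. \<Sum>l\<in>?S. \<Sum>u\<in>?S. X.moment 3 i k + 5 * (X.moment 2 i k * X.moment 1 i l) + 9 * (X.moment 2 i k * X.moment 1 j l)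
      + 5 * (X.moment 2 i k * X.moment 1 j k) + 14 * (X.moment 1 i k * X.moment 1 i l * X.moment 1 j l)
      + 6 * (X.moment 1 i k * X.moment 1 j l * X.moment 1 i u) + 8 * (X.moment 1 u k * X.moment 1 i k * X.moment 1 j l)
      + 2 * (X.moment 1 u k * X.moment 1 i k * X.moment 1 j k))" (is "_ = ?T'")
    using X.sum_moments by simp
  have nonneg: "?c \<ge> 0" using s_pos by simp
  show ?thesis (is "_ \<le> _ * ?U + ?a + ?b")
  proof -
    \<comment> \<open>The comparison is made for each choice of the five indices: eight summands
      agree with the same constants, and those listed in \<open>dropped\<close> are
      nonnegative.\<close>
    have "?T \<le> ?U"
      unfolding T
    proof (intro sum_mono)
      fix i j k l u
      have dropped: "0 \<le> 2 * ((\<integral>\<omega>. \<bar>X i k \<omega>\<bar> \<partial>M) * ((\<integral>\<omega>. \<bar>X i l \<omega>\<bar> \<partial>M) * (\<integral>\<omega>. \<bar>X i u \<omega>\<bar> \<partial>M)))"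
        "0 \<le> 2 * (\<integral>\<omega>. \<bar>X u k \<omega>\<bar> * \<bar>X i k \<omega>\<bar>\<^sup>2 \<partial>M)"
        "0 \<le> 4 * ((\<integral>\<omega>. \<bar>X u k \<omega> * X i k \<omega>\<bar> \<partial>M) * (\<integral>\<omega>. \<bar>X i l \<omega>\<bar> \<partial>M))"
        "0 \<le> 4 * ((\<integral>\<omega>. \<bar>X u k \<omega> * X i k \<omega>\<bar> \<partial>M) * (\<integral>\<omega>. \<bar>X j l \<omega>\<bar> \<partial>M))"
        "0 \<le> 2 * (\<integral>\<omega>. \<bar>X u k \<omega> * (X i k \<omega> * X j k \<omega>)\<bar> \<partial>M)"
        "0 \<le> 2 / real n * ((\<integral>\<omega>. 2 * \<bar>X i k \<omega>\<bar> + 6 * \<bar>X j l \<omega>\<bar> \<partial>M) *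
            ((\<Sum>r\<in>{1..n}. (\<integral>\<omega>. \<bar>X i r \<omega>\<bar>\<^sup>2 \<partial>M)) + \<bar>\<Sum>r\<in>{1..n}. c i r * c j r\<bar>))"
        by (intro mult_nonneg_nonneg add_nonneg_nonneg sum_nonneg Bochner_Integration.integral_nonneg divide_nonneg_nonneg; simp)+
      show "X.moment 3 i k + 5 * (X.moment 2 i k * X.moment 1 i l) + 9 * (X.moment 2 i k * X.moment 1 j l)
          + 5 * (X.moment 2 i k * X.moment 1 j k) + 14 * (X.moment 1 i k * X.moment 1 i l * X.moment 1 j l)
          + 6 * (X.moment 1 i k * X.moment 1 j l * X.moment 1 i u) + 8 * (X.moment 1 u k * X.moment 1 i k * X.moment 1 j l)
          + 2 * (X.moment 1 u k * X.moment 1 i k * X.moment 1 j k)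
        \<le> (\<integral>\<omega>. \<bar>X i k \<omega>\<bar> ^ 3 \<partial>M)
        + 5 * (\<integral>\<omega>. \<bar>X i k \<omega>\<bar>\<^sup>2 \<partial>M) * (\<integral>\<omega>. \<bar>X i l \<omega>\<bar> \<partial>M)
        + 9 * (\<integral>\<omega>. \<bar>X i k \<omega>\<bar>\<^sup>2 \<partial>M) * (\<integral>\<omega>. \<bar>X j l \<omega>\<bar> \<partial>M)
        + 5 * (\<integral>\<omega>. \<bar>X i k \<omega>\<bar>\<^sup>2 \<partial>M) * (\<integral>\<omega>. \<bar>X j k \<omega>\<bar> \<partial>M)
        + 14 * (\<integral>\<omega>. \<bar>X i k \<omega>\<bar> \<partial>M) * (\<integral>\<omega>. \<bar>X i l \<omega>\<bar> \<partial>M) * (\<integral>\<omega>. \<bar>X j l \<omega>\<bar> \<partial>M)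
        + 2 * (\<integral>\<omega>. \<bar>X i k \<omega>\<bar> \<partial>M) * (\<integral>\<omega>. \<bar>X i l \<omega>\<bar> \<partial>M) * (\<integral>\<omega>. \<bar>X i u \<omega>\<bar> \<partial>M)
        + 6 * (\<integral>\<omega>. \<bar>X i k \<omega>\<bar> \<partial>M) * (\<integral>\<omega>. \<bar>X j l \<omega>\<bar> \<partial>M) * (\<integral>\<omega>. \<bar>X i u \<omega>\<bar> \<partial>M)
        + 2 * (\<integral>\<omega>. \<bar>X u k \<omega>\<bar> * \<bar>X i k \<omega>\<bar>\<^sup>2 \<partial>M)
        + 4 * (\<integral>\<omega>. \<bar>X u k \<omega> * X i k \<omega>\<bar> \<partial>M) * (\<integral>\<omega>. \<bar>X i l \<omega>\<bar> \<partial>M)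
        + 4 * (\<integral>\<omega>. \<bar>X u k \<omega> * X i k \<omega>\<bar> \<partial>M) * (\<integral>\<omega>. \<bar>X j l \<omega>\<bar> \<partial>M)
        + 8 * (\<integral>\<omega>. \<bar>X u k \<omega>\<bar> \<partial>M) * (\<integral>\<omega>. \<bar>X i k \<omega>\<bar> \<partial>M) * (\<integral>\<omega>. \<bar>X j l \<omega>\<bar> \<partial>M)
        + 2 * (\<integral>\<omega>. \<bar>X u k \<omega> * X i k \<omega> * X j k \<omega>\<bar> \<partial>M)
        + 2 * (\<integral>\<omega>. \<bar>X u k \<omega>\<bar> \<partial>M) * (\<integral>\<omega>. \<bar>X i k \<omega>\<bar> \<partial>M) * (\<integral>\<omega>. \<bar>X j k \<omega>\<bar> \<partial>M)
        + 2 / real n * (\<integral>\<omega>. 2 * \<bar>X i k \<omega>\<bar> + 6 * \<bar>X j l \<omega>\<bar> \<partial>M) *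
            ((\<Sum>r\<in>{1..n}. (\<integral>\<omega>. \<bar>X i r \<omega>\<bar>\<^sup>2 \<partial>M)) + \<bar>\<Sum>r\<in>{1..n}. c i r * c j r\<bar>)"
        using dropped unfolding X.moment_def power_one_right mult.assoc by linarith
    qed
    then have "?c * ?T \<le> ?c * ?U" using nonneg by (rule mult_left_mono)
    moreover have "0 \<le> ?a" "0 \<le> ?b"
      using s_pos by (simp_all add: sum_nonneg)
    ultimately show ?thesis using main by linarith
  qed
qed

end
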